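(* Let $\mathcal U,\mathcal Y$ be Hilbert spaces, let $S(z)=\sum_vs_vz^v\in\mathcal S_{nc,d}(\mathcal U,\mathcal Y)$, and let $\mathcal H^\tau(K_S)=\tau\circ\mathcal H(K_S)$ be the associated (reflected) de Branges-Rovnyak space. Define operators (these formulas do define bounded operators between the indicated spaces) $$A_{{\rm dBR},j}:\mathcal H^\tau(K_S)\to\mathcal H^\tau(K_S),\quad B_{{\rm dBR},j}:\mathcal U\to\mathcal H^\tau(K_S)\ (j=1,\dots,d),$$ $$C_{\rm dBR}:\mathcal H^\tau(K_S)\to\mathcal Y,\quad D_{\rm dBR}:\mathcal U\to\mathcal Y$$ by $$A_{{\rm dBR},j}=(S^L_j)^*|_{\mathcal H^\tau(K_S)},\quad B_{{\rm dBR},j}=\tau(S^R_j)^*M_S|_{\mathcal U}=(S^L_j)^*\tau M_S|_{\mathcal U},\quad C_{\rm dBR}=E|_{\mathcal H^\tau(K_S)},\quad D_{\rm dBR}=s_\emptyset,$$ and set $$A_{\rm dBR}=\begin{bmatrix} A_{{\rm dBR},1} \\ \vdots \\ A_{{\rm dBR},d} \end{bmatrix}:\mathcal H^\tau(K_S)\to\mathcal H^\tau(K_S)^d,\qquad B_{\rm dBR}=\begin{bmatrix} B_{{\rm dBR},1} \\ \vdots \\ B_{{\rm dBR},d} \end{bmatrix}:\mathcal U\to\mathcal H^\tau(K_S)^d.$$ Then $$\mathbf U_{\rm dBR}=\begin{bmatrix} A_{\rm dBR} & B_{\rm dBR} \\ C_{\rm dBR} & D_{\rm dBR} \end{bmatrix}:\begin{bmatrix}\mathcal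 H^\tau(K_S) \\ \mathcal U\end{bmatrix}\to\begin{bmatrix}\mathcal H^\tau(K_S)^d \\ \mathcal Y\end{bmatrix}$$ is an observable coisometric colligation with transfer function equal to $S(z)$: $$S(z)=D_{\rm dBR}+C_{\rm dBR}(I_{\mathcal H^\tau(K_S)}-Z(z)A_{\rm dBR})^{-1}Z(z)B_{\rm dBR}.$$ Moreover, any other observable, coisometric realization of $S$ is unitarily equivalent to this functional-model realization of $S$.
   Context: $\mathcal L(\mathcal U,\mathcal Y)$ denotes the bounded linear operators between Hilbert spaces. $d\ge1$ is a fixed integer and $\mathcal F_d$ is the free semigroup with unit generated by the letters $\{1,\dots,d\}$: words $\alpha=i_N\cdots i_1$, product given by concatenation, unit the empty word $\emptyset$; $\alpha^\top=i_1\cdots i_N$. $z^\alpha=z_{i_N}\cdots z_{i_1}$, $z^\emptyset=1$; for an operator tuple $\mathbf A=(A_1,\dots,A_d)$, $\mathbf A^\alpha=A_{i_N}\cdots A_{i_1}$, $\mathbf A^\emptyset=I$. $z=(z_1,\dots,z_d)$ and $w=(w_1,\dots,w_d)$ are two sets of indeterminates, noncommuting within each set; each $z_i$ commutes with each $w_j$, and indeterminates commute with operator coefficients. Products of formal power series are given by convolution. If $S(z)=\sum_\alpha s_\alpha z^\alpha$ then $S(w)^*=\sum_\alpha s_\alpha^*w^{\alpha^\top}$. $H^2_{\mathcal Y}(\mathcal F_d)=\{f=\sum_\alpha f_\alpha z^\alpha:\ f_\alpha\in\mathcal Y,\ \|f\|^2=\sum_\alpha\|f_\alpha\|^2<\infty\}$.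 The noncommutative Schur class $\mathcal S_{nc,d}(\mathcal U,\mathcal Y)$ is the set of formal power series $S(z)=\sum_\alpha s_\alpha z^\alpha$, $s_\alpha\in\mathcal L(\mathcal U,\mathcal Y)$, for which $M_S:f(z)\mapsto S(z)f(z)$ is a contraction from $H^2_{\mathcal U}(\mathcal F_d)$ into $H^2_{\mathcal Y}(\mathcal F_d)$. $\mathcal U$ is identified with the constants in $H^2_{\mathcal U}(\mathcal F_d)$. For such $S$, $K_S(z,w)=k_{\rm Sz}(z,w)I_{\mathcal Y}-S(z)k_{\rm Sz}(z,w)S(w)^*$ with $k_{\rm Sz}(z,w)=\sum_\alpha z^\alpha w^{\alpha^\top}$; this is a positive kernel. For a positive formal kernel $K(z,w)=\sum_{\alpha,\beta}K_{\alpha,\beta}z^\alpha w^{\beta^\top}$, $K_{\alpha,\beta}\in\mathcal L(\mathcal Y)$ (positive means $\sum_{\alpha,\alpha'}\langle K_{\alpha,\alpha'}y_{\alpha'},y_\alpha\rangle\ge0$ for all finitely supported $\alpha\mapsto y_\alpha\in\mathcal Y$), $\mathcal H(K)$ is the unique Hilbert space of formal power series $f(z)=\sum_vf_vz^v\in\mathcal Y\langle\langle z\rangle\rangle$ such that for all $\beta\in\mathcal F_d$, $y\in\mathcal Y$ the series $\sum_\alpha K_{\alpha,\beta}y\,z^\alpha$ lies in $\mathcal H(K)$ and $\langle f,\sum_\alpha K_{\alpha,\beta}y\,z^\alpha\rangle_{\mathcal H(K)}=\langle f_\beta,y\rangle_{\mathcal Y}$ for all $f\in\mathcal H(K)$.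 The space $\mathcal H(K_S)$ is contained in $H^2_{\mathcal Y}(\mathcal F_d)$. On $H^2_{\mathcal Y}(\mathcal F_d)$: $\tau:\sum_vf_vz^v\mapsto\sum_vf_{v^\top}z^v$; $E:\sum_vf_vz^v\mapsto f_\emptyset\in\mathcal Y$; the right shifts $S^R_j:f(z)\mapsto f(z)z_j$ have adjoints $(S^R_j)^*:\sum_vf_vz^v\mapsto\sum_vf_{vj}z^v$; the left shifts $S^L_j:f(z)\mapsto z_jf(z)$ have adjoints $(S^L_j)^*:\sum_vf_vz^v\mapsto\sum_vf_{jv}z^v$. $\mathcal H^\tau(K_S)=\{\tau(f):f\in\mathcal H(K_S)\}$ with norm $\|\tau(f)\|_{\mathcal H^\tau(K_S)}=\|f\|_{\mathcal H(K_S)}$. A colligation is a bounded operator $\mathbf U=\begin{bmatrix} A & B \\ C & D \end{bmatrix}:\mathcal X\oplus\mathcal U\to\mathcal X^d\oplus\mathcal Y$, where $A,B$ are columns of $A_1,\dots,A_d$ and $B_1,\dots,B_d$. It is coisometric if $\mathbf U\mathbf U^*=I$, and observable if $x\mapsto\sum_v(C\mathbf A^vx)z^v$ is injective on $\mathcal X$. Its transfer function is $D+C(I-Z(z)A)^{-1}Z(z)B=D+\sum_{j=1}^d\sum_vC\mathbf A^vB_jz^vz_j$, where $Z(z)=\begin{bmatrix}z_1I_{\mathcal X}&\cdots&z_dI_{\mathcal X}\end{bmatrix}$; it is a realization of $S$ if its transfer function is $S$. Two colligations $\mathbf U:\mathcal X\oplus\mathcal U\to\mathcal X^d\oplus\mathcal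 Y$ and $\mathbf U':\mathcal X'\oplus\mathcal U\to\mathcal X'^d\oplus\mathcal Y$ are unitarily equivalent if there is a unitary $U:\mathcal X\to\mathcal X'$ with $\begin{bmatrix}\oplus_{k=1}^dU & 0 \\ 0 & I_{\mathcal Y}\end{bmatrix}\mathbf U=\mathbf U'\begin{bmatrix} U & 0 \\ 0 & I_{\mathcal U}\end{bmatrix}$. *)

theory Defs
  imports "HOL-Analysis.Analysis" "HOL-Library.Function_Algebras"
begin

section \<open>Complex vector spaces and Hilbert spaces with explicit carriers\<close>

class complex_vector = ab_group_add +
  fixes scaleC :: "complex \<Rightarrow> 'a \<Rightarrow> 'a"  (infixr "*\<^sub>C" 75)
  assumes scaleC_add_right: "a *\<^sub>C (x + y) = a *\<^sub>C x + a *\<^sub>C y"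
    and scaleC_add_left: "(a + b) *\<^sub>C x = a *\<^sub>C x + b *\<^sub>C x"
    and scaleC_scaleC: "a *\<^sub>C b *\<^sub>C x = (a * b) *\<^sub>C x"
    and scaleC_one: "1 *\<^sub>C x = x"

instantiation "fun" :: (type, complex_vector) complex_vector
begin

definition scaleC_fun_def: "a *\<^sub>C f = (\<lambda>x. a *\<^sub>C f x)"

instance
  by standard
    (simp_all add: scaleC_fun_def fun_eq_iff scaleC_add_right scaleC_add_left
      scaleC_scaleC scaleC_one)

end

instantiation prod :: (complex_vector, complex_vector) complex_vector
begin

definition scaleC_prod_def: "a *\<^sub>C p = (a *\<^sub>C fst p, a *\<^sub>C snd p)"

instance
  by standard
    (simp_all add: scaleC_prod_def prod_eq_iff scaleC_add_right scaleC_add_left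
      scaleC_scaleC scaleC_one)

end

text \<open>A Hilbert space is a complex-linear subspace of an ambient type, with its own inner
  product. Carriers are explicit because reproducing kernel spaces depend on the kernel.
  The values of \<open>cinner\<close> and of operators off the carriers are irrelevant.\<close>

record 'a hilbert =
  carrier :: "'a set"
  cinner :: "'a \<Rightarrow> 'a \<Rightarrow> complex"

definition hnorm :: "'a hilbert \<Rightarrow> 'a \<Rightarrow> real" where
  "hnorm H x = sqrt (Re (cinner H x x))"

locale hilbert_space =
  fixes H :: "'a::complex_vector hilbert"
  assumes zero_closed: "0 \<in> carrier H"
    and add_closed: "\<lbrakk>x \<in> carrier H; y \<in> carrier H\<rbrakk> \<Longrightarrow> x + y \<in> carrier H"
    and scaleC_closed: "x \<in> carrier H \<Longrightarrow> a *\<^sub>C x \<in> carrier H"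
    and cinner_add_left: "\<lbrakk>x \<in> carrier H; y \<in> carrier H; z \<in> carrier H\<rbrakk>
      \<Longrightarrow> cinner H (x + y) z = cinner H x z + cinner H y z"
    and cinner_scaleC_left: "\<lbrakk>x \<in> carrier H; y \<in> carrier H\<rbrakk>
      \<Longrightarrow> cinner H (a *\<^sub>C x) y = a * cinner H x y"
    and cinner_commute: "\<lbrakk>x \<in> carrier H; y \<in> carrier H\<rbrakk>
      \<Longrightarrow> cinner H x y = cnj (cinner H y x)"
    and cinner_pos: "\<lbrakk>x \<in> carrier H; x \<noteq> 0\<rbrakk> \<Longrightarrow> Re (cinner H x x) > 0"
    and complete: "\<lbrakk>\<And>n::nat. X n \<in> carrier H;
        \<forall>e>0. \<exists>N. \<forall>m\<ge>N. \<forall>n\<ge>N. hnorm H (X m - X n) < e\<rbrakk>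
      \<Longrightarrow> \<exists>x\<in>carrier H. (\<lambda>n. hnorm H (X n - x)) \<longlonglongrightarrow> 0"

definition bounded_op ::
    "'a::complex_vector hilbert \<Rightarrow> 'b::complex_vector hilbert \<Rightarrow> ('a \<Rightarrow> 'b) \<Rightarrow> bool" where
  "bounded_op H K T \<longleftrightarrow>
     (\<forall>x\<in>carrier H. T x \<in> carrier K) \<and>
     (\<forall>x\<in>carrier H. \<forall>y\<in>carrier H. T (x + y) = T x + T y) \<and>
     (\<forall>a. \<forall>x\<in>carrier H. T (a *\<^sub>C x) = a *\<^sub>C T x) \<and>
     (\<exists>M. \<forall>x\<in>carrier H. hnorm K (T x) \<le> M * hnorm H x)"

definition contraction ::
    "'a::complex_vector hilbert \<Rightarrow> 'b::complex_vector hilbert \<Rightarrow> ('a \<Rightarrow> 'b) \<Rightarrow> bool" where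
  "contraction H K T \<longleftrightarrow>
     bounded_op H K T \<and> (\<forall>x\<in>carrier H. hnorm K (T x) \<le> hnorm H x)"

definition hadj :: "'a hilbert \<Rightarrow> 'b hilbert \<Rightarrow> ('a \<Rightarrow> 'b) \<Rightarrow> 'b \<Rightarrow> 'a" where
  "hadj H K T y =
     (THE x. x \<in> carrier H \<and> (\<forall>h\<in>carrier H. cinner K (T h) y = cinner H h x))"

definition unitary_op ::
    "'a::complex_vector hilbert \<Rightarrow> 'b::complex_vector hilbert \<Rightarrow> ('a \<Rightarrow> 'b) \<Rightarrow> bool" where
  "unitary_op H K T \<longleftrightarrow>
     bounded_op H K T \<and> T ` carrier H = carrier K \<and>
     (\<forall>x\<in>carrier H. \<forall>y\<in>carrier H. cinner K (T x) (T y) = cinner H x y)"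

definition hsum :: "'a hilbert \<Rightarrow> 'b hilbert \<Rightarrow> ('a \<times> 'b) hilbert" where
  "hsum H K = \<lparr>carrier = carrier H \<times> carrier K,
     cinner = (\<lambda>p q. cinner H (fst p) (fst q) + cinner K (snd p) (snd q))\<rparr>"

definition hpow :: "'a hilbert \<Rightarrow> ('d::finite \<Rightarrow> 'a) hilbert" where
  "hpow H = \<lparr>carrier = {f. \<forall>j. f j \<in> carrier H},
     cinner = (\<lambda>f g. \<Sum>j\<in>UNIV. cinner H (f j) (g j))\<rparr>"


section \<open>Noncommutative formal power series\<close>

text \<open>The letters form a finite type \<open>'d\<close>, and the word \<open>i\<^sub>N \<cdots> i\<^sub>1\<close> is the list
  \<open>[i\<^sub>N, \<dots>, i\<^sub>1]\<close>; the transpose of a word is \<open>rev\<close>. A formal power series is its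
  coefficient function.\<close>

type_synonym ('d, 'a) nc_series = "'d list \<Rightarrow> 'a"

definition series_apply ::
    "('d, 'a \<Rightarrow> 'b::comm_monoid_add) nc_series \<Rightarrow> ('d, 'a) nc_series \<Rightarrow> ('d, 'b) nc_series" where
  "series_apply S f w = (\<Sum>(\<alpha>, \<beta>) | \<alpha> @ \<beta> = w. S \<alpha> (f \<beta>))"

definition const_series :: "'a::zero \<Rightarrow> ('d, 'a) nc_series" where
  "const_series u w = (if w = [] then u else 0)"

definition H2 :: "'y hilbert \<Rightarrow> ('d, 'y) nc_series hilbert" where
  "H2 Y = \<lparr>carrier = {f. (\<forall>v. f v \<in> carrier Y) \<and> (\<lambda>v. (hnorm Y (f v))\<^sup>2) summable_on UNIV},
     cinner = (\<lambda>f g. \<Sum>\<^sub>\<infinity>v. cinner Y (f v) (g v))\<rparr>"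

definition schur_class ::
    "'u::complex_vector hilbert \<Rightarrow> 'y::complex_vector hilbert \<Rightarrow>
     ('d, 'u \<Rightarrow> 'y) nc_series \<Rightarrow> bool" where
  "schur_class U Y S \<longleftrightarrow>
     (\<forall>\<alpha>. bounded_op U Y (S \<alpha>)) \<and> contraction (H2 U) (H2 Y) (series_apply S)"

definition reflect :: "('d, 'a) nc_series \<Rightarrow> ('d, 'a) nc_series" where
  "reflect f v = f (rev v)"

definition left_shift :: "'d \<Rightarrow> ('d, 'a::zero) nc_series \<Rightarrow> ('d, 'a) nc_series" where
  "left_shift j f w = (case w of [] \<Rightarrow> 0 | i # v \<Rightarrow> if i = j then f v else 0)"

definition right_shift :: "'d \<Rightarrow> ('d, 'a::zero) nc_series \<Rightarrow> ('d, 'a) nc_series" where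
  "right_shift j f w = (if w \<noteq> [] \<and> last w = j then f (butlast w) else 0)"


section \<open>Formal kernels and de Branges--Rovnyak spaces\<close>

text \<open>For a series in two sets of indeterminates, \<open>F \<alpha> \<beta>\<close> is the coefficient of
  \<open>z\<^sup>\<alpha> w\<^sup>\<beta>\<close>.\<close>

type_synonym ('d, 'a) nc_biseries = "'d list \<Rightarrow> 'd list \<Rightarrow> 'a"

definition bimult ::
    "('d, 'b \<Rightarrow> 'c::comm_monoid_add) nc_biseries \<Rightarrow> ('d, 'a \<Rightarrow> 'b) nc_biseries \<Rightarrow>
     ('d, 'a \<Rightarrow> 'c) nc_biseries" where
  "bimult F G \<alpha> \<beta> = (\<lambda>x.
     \<Sum>(\<alpha>1, \<alpha>2) | \<alpha>1 @ \<alpha>2 = \<alpha>. \<Sum>(\<beta>1, \<beta>2) | \<beta>1 @ \<beta>2 = \<beta>. F \<alpha>1 \<beta>1 (G \<alpha>2 \<beta>2 x))"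

definition szego :: "('d, complex) nc_biseries" where
  "szego \<alpha> \<beta> = (if \<beta> = rev \<alpha> then 1 else 0)"

definition szego_op :: "('d, 'a::complex_vector \<Rightarrow> 'a) nc_biseries" where
  "szego_op \<alpha> \<beta> = (\<lambda>x. szego \<alpha> \<beta> *\<^sub>C x)"

definition series_z :: "('d, 'a \<Rightarrow> 'b::zero) nc_series \<Rightarrow> ('d, 'a \<Rightarrow> 'b) nc_biseries" where
  "series_z S \<alpha> \<beta> = (\<lambda>x. if \<beta> = [] then S \<alpha> x else 0)"

definition series_w_adj ::
    "'u::zero hilbert \<Rightarrow> 'y hilbert \<Rightarrow> ('d, 'u \<Rightarrow> 'y) nc_series \<Rightarrow>
     ('d, 'y \<Rightarrow> 'u) nc_biseries" where
  "series_w_adj U Y S \<alpha> \<beta> = (\<lambda>y. if \<alpha> = [] then hadj U Y (S (rev \<beta>)) y else 0)"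

definition dBR_kernel ::
    "'u::complex_vector hilbert \<Rightarrow> 'y::complex_vector hilbert \<Rightarrow>
     ('d, 'u \<Rightarrow> 'y) nc_series \<Rightarrow> ('d, 'y \<Rightarrow> 'y) nc_biseries" where
  "dBR_kernel U Y S \<alpha> \<beta> = (\<lambda>y. szego_op \<alpha> \<beta> y -
     bimult (bimult (series_z S) szego_op) (series_w_adj U Y S) \<alpha> \<beta> y)"

text \<open>Here \<open>F \<alpha> (rev \<beta>)\<close> is the coefficient of \<open>z\<^sup>\<alpha> w\<^sup>\<beta>\<^sup>\<top>\<close>, i.e.\ the kernel
  coefficient usually denoted \<open>K\<^sub>\<alpha>\<^sub>,\<^sub>\<beta>\<close>. The last conjunct only fixes the inner product off
  the carrier, so that the space is unique as a record.\<close>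

definition formal_RKHS ::
    "'y::complex_vector hilbert \<Rightarrow> ('d, 'y \<Rightarrow> 'y) nc_biseries \<Rightarrow>
     ('d, 'y) nc_series hilbert \<Rightarrow> bool" where
  "formal_RKHS Y F H \<longleftrightarrow>
     hilbert_space H \<and>
     (\<forall>f\<in>carrier H. \<forall>v. f v \<in> carrier Y) \<and>
     (\<forall>\<beta>. \<forall>y\<in>carrier Y.
        (\<lambda>\<alpha>. F \<alpha> (rev \<beta>) y) \<in> carrier H \<and>
        (\<forall>f\<in>carrier H. cinner H f (\<lambda>\<alpha>. F \<alpha> (rev \<beta>) y) = cinner Y (f \<beta>) y)) \<and>
     (\<forall>f g. f \<notin> carrier H \<or> g \<notin> carrier H \<longrightarrow> cinner H f g = 0)"

definition RKHS ::
    "'y::complex_vector hilbert \<Rightarrow> ('d, 'y \<Rightarrow> 'y) nc_biseries \<Rightarrow>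
     ('d, 'y) nc_series hilbert" where
  "RKHS Y F = (THE H. formal_RKHS Y F H)"

text \<open>\<open>reflect\<close> is an involution, so this inner product makes it unitary from \<open>H\<close>.\<close>

definition reflected_space :: "('d, 'y) nc_series hilbert \<Rightarrow> ('d, 'y) nc_series hilbert" where
  "reflected_space H = \<lparr>carrier = reflect ` carrier H,
     cinner = (\<lambda>f g. cinner H (reflect f) (reflect g))\<rparr>"

definition dBR_space ::
    "'u::complex_vector hilbert \<Rightarrow> 'y::complex_vector hilbert \<Rightarrow>
     ('d, 'u \<Rightarrow> 'y) nc_series \<Rightarrow> ('d, 'y) nc_series hilbert" where
  "dBR_space U Y S = reflected_space (RKHS Y (dBR_kernel U Y S))"


section \<open>Colligations\<close>

record ('d, 'x, 'u, 'y) colligation =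
  opA :: "'d \<Rightarrow> 'x \<Rightarrow> 'x"
  opB :: "'d \<Rightarrow> 'u \<Rightarrow> 'x"
  opC :: "'x \<Rightarrow> 'y"
  opD :: "'u \<Rightarrow> 'y"

definition block_op ::
    "('d, 'x::plus, 'u, 'y::plus) colligation \<Rightarrow> 'x \<times> 'u \<Rightarrow> ('d \<Rightarrow> 'x) \<times> 'y" where
  "block_op W = (\<lambda>(x, u). ((\<lambda>j. opA W j x + opB W j u), opC W x + opD W u))"

text \<open>The blocks are required to be operators themselves: linearity of the block operator
  alone would allow them to be affine with cancelling constants.\<close>

definition is_colligation ::
    "'x::complex_vector hilbert \<Rightarrow> 'u::complex_vector hilbert \<Rightarrow>
     'y::complex_vector hilbert \<Rightarrow> ('d::finite, 'x, 'u, 'y) colligation \<Rightarrow> bool" where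
  "is_colligation X U Y W \<longleftrightarrow>
     (\<forall>j. bounded_op X X (opA W j)) \<and> (\<forall>j. bounded_op U X (opB W j)) \<and>
     bounded_op X Y (opC W) \<and> bounded_op U Y (opD W) \<and>
     bounded_op (hsum X U) (hsum (hpow X) Y) (block_op W)"

definition coisometric ::
    "'x::complex_vector hilbert \<Rightarrow> 'u::complex_vector hilbert \<Rightarrow>
     'y::complex_vector hilbert \<Rightarrow> ('d::finite, 'x, 'u, 'y) colligation \<Rightarrow> bool" where
  "coisometric X U Y W \<longleftrightarrow>
     (\<forall>p\<in>carrier (hsum (hpow X) Y).
        block_op W (hadj (hsum X U) (hsum (hpow X) Y) (block_op W) p) = p)"

fun word_op :: "('d \<Rightarrow> 'x \<Rightarrow> 'x) \<Rightarrow> 'd list \<Rightarrow> 'x \<Rightarrow> 'x" where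
  "word_op A [] x = x"
| "word_op A (i # v) x = A i (word_op A v x)"

definition observable :: "'x hilbert \<Rightarrow> ('d, 'x, 'u, 'y) colligation \<Rightarrow> bool" where
  "observable X W \<longleftrightarrow> inj_on (\<lambda>x v. opC W (word_op (opA W) v x)) (carrier X)"

text \<open>Coefficientwise expansion of \<open>D + C (I - Z(z) A)\<^sup>-\<^sup>1 Z(z) B\<close>, that is, of
  \<open>D + \<Sum>\<^sub>j \<Sum>\<^sub>v C A\<^sup>v B\<^sub>j z\<^sup>v z\<^sub>j\<close>; at each word the sum has at most one term.\<close>

definition transfer_function ::
    "('d, 'x, 'u, 'y::comm_monoid_add) colligation \<Rightarrow> ('d, 'u \<Rightarrow> 'y) nc_series" where
  "transfer_function W w = (\<lambda>u. (if w = [] then opD W u else 0) +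
     (\<Sum>(v, j) | v @ [j] = w. opC W (word_op (opA W) v (opB W j u))))"

definition is_realization ::
    "'u hilbert \<Rightarrow> ('d, 'u \<Rightarrow> 'y::comm_monoid_add) nc_series \<Rightarrow>
     ('d, 'x, 'u, 'y) colligation \<Rightarrow> bool" where
  "is_realization U S W \<longleftrightarrow> (\<forall>v. \<forall>u\<in>carrier U. transfer_function W v u = S v u)"

definition unitarily_equivalent ::
    "'u hilbert \<Rightarrow> 'x::complex_vector hilbert \<Rightarrow> ('d, 'x, 'u, 'y::plus) colligation \<Rightarrow>
     'x2::complex_vector hilbert \<Rightarrow> ('d, 'x2, 'u, 'y) colligation \<Rightarrow> bool" where
  "unitarily_equivalent U X W X' W' \<longleftrightarrow>
     (\<exists>T. unitary_op X X' T \<and>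
        (\<forall>x\<in>carrier X. \<forall>u\<in>carrier U.
           map_prod (\<lambda>h j. T (h j)) id (block_op W (x, u)) = block_op W' (T x, u)))"

text \<open>The shift adjoints are taken in \<open>H2 Y\<close>; \<open>U\<close> enters as the constant series.\<close>

definition dBR_colligation ::
    "'u::complex_vector hilbert \<Rightarrow> 'y::complex_vector hilbert \<Rightarrow>
     ('d, 'u \<Rightarrow> 'y) nc_series \<Rightarrow> ('d, ('d, 'y) nc_series, 'u, 'y) colligation" where
  "dBR_colligation U Y S = \<lparr>
     opA = (\<lambda>j. hadj (H2 Y) (H2 Y) (left_shift j)),
     opB = (\<lambda>j u. reflect
       (hadj (H2 Y) (H2 Y) (right_shift j) (series_apply S (const_series u)))),
     opC = (\<lambda>f. f []),
     opD = S []\<rparr>"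

end

theory Submission
  imports Defs
begin

text \<open>
  Everything takes place in the Fock space \<open>H2 Y\<close>, in the reflected picture. Let \<open>M\<close> be
  multiplication by \<open>S\<close> conjugated by \<open>reflect\<close>, let \<open>N\<close> be its adjoint and \<open>P = I - M N\<close>, a positive
  contraction. The reflected de Branges--Rovnyak space is the range space \<open>H\<close> of \<open>P\<close>: the Hilbert
  space inside \<open>H2 Y\<close> that contains all \<open>P x\<close> and satisfies
  \<open>\<langle>f, P x\<rangle>\<^sub>H = \<langle>f, x\<rangle>\<close>. Taking monomials for \<open>x\<close> gives, after
  reflection, the kernel functions of \<open>K\<^sub>S\<close> (\<open>dBR_kernel_P\<close>, \<open>dBR_space_eq\<close>).

  The range space is usually built from the square root of \<open>P\<close>. Here the recursion
  \<open>P\<^sub>0 = P\<close>, \<open>P\<^sub>n\<^sub>+\<^sub>1 = P\<^sub>n - P\<^sub>n\<^sup>2\<close> replaces it: it stays inside the positive contractions and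
  telescopes to \<open>\<langle>P x, y\<rangle> = (\<Sum>n. \<langle>P\<^sub>n x, P\<^sub>n y\<rangle>)\<close>, so that
  \<open>x \<mapsto> (P\<^sub>n x)\<^sub>n\<close> is a factor of \<open>P\<close> through a space of square-summable sequences, and the
  adjoint of this factor has the required range (\<open>operator_range_exists\<close>).

  Everything about the functional model rests on one identity (\<open>backward_shift_M\<close>): the backward
  shifts commute with \<open>M\<close> up to the constant term of the argument. The block operator sends \<open>(f, u)\<close>
  to the backward shifts and the constant term of \<open>f + M u\<close>. Therefore its adjoint sends
  \<open>((P (backward_shift j x))\<^sub>j, x\<^sub>\<emptyset>)\<close> to \<open>(P x, (N x)\<^sub>\<emptyset>)\<close>, and the identity shows that
  the block operator sends the latter back to the former. Vectors of the former kind are total, so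
  the colligation is coisometric. The operators are bounded on \<open>H\<close> because membership in \<open>H\<close> is
  equivalent to an estimate \<open>\<bar>\<langle>f, x\<rangle>\<bar>\<^sup>2 \<le> c\<^sup>2 \<langle>P x, x\<rangle>\<close>, and
  the left shifts do not increase \<open>\<langle>P x, x\<rangle>\<close>. Since the state operators are backward shifts,
  the observability map reads off all coefficients of \<open>f\<close>; this gives injectivity and the transfer
  function.

  For uniqueness, let \<open>O\<^sub>\<alpha> = C A\<^sup>\<alpha>\<close> come from any observable coisometric realization. The
  coisometry relations turn into a recursion for \<open>O\<^sub>\<alpha> O\<^sub>\<beta>\<^sup>*\<close> in the last letters of both words,
  which is the recursion of the kernel coefficients of \<open>K\<^sub>S\<close> (\<open>obs_coeff_adj_obs\<close>). So the range of
  the observability map, with the norm of the state space, has reproducing kernel \<open>K\<^sub>S\<close>. Such a space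
  is unique (\<open>formal_RKHS_unique\<close>), and the reflected observability map is the unitary equivalence.
\<close>

section \<open>Hilbert spaces with explicit carriers\<close>

lemma scaleC_0_left [simp]: "0 *\<^sub>C (x::'a::complex_vector) = 0"
  using scaleC_add_left[of 0 0 x] by simp

lemma scaleC_0_right [simp]: "a *\<^sub>C (0::'a::complex_vector) = 0"
  using scaleC_add_right[of a 0 0] by simp

lemma scaleC_minus_one [simp]: "(- 1) *\<^sub>C (x::'a::complex_vector) = - x"
proof -
  have "(- 1) *\<^sub>C x + 1 *\<^sub>C x = (- 1 + 1) *\<^sub>C x" by (simp only: scaleC_add_left)
  then have "(- 1) *\<^sub>C x + x = 0" by (simp add: scaleC_one)
  then show ?thesis by (simp add: add_eq_0_iff2)
qed

lemma scaleC_diff_right: "a *\<^sub>C (x - y) = a *\<^sub>C x - a *\<^sub>C (y::'a::complex_vector)"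
  using scaleC_add_right[of a "x - y" y] by (simp add: eq_diff_eq)

lemma fun_apply_simps [simp]:
  "(f + g) v = f v + g v" "(f - g) v = f v - g v" "(- f) v = - f v" "(a *\<^sub>C h) v = a *\<^sub>C h v"
  for f g :: "'i \<Rightarrow> 'a::ab_group_add" and h :: "'i \<Rightarrow> 'b::complex_vector"
  by (simp_all add: scaleC_fun_def)

context hilbert_space
begin

lemma uminus_closed: "x \<in> carrier H \<Longrightarrow> - x \<in> carrier H"
  using scaleC_closed[of x "- 1"] by simp

lemma diff_closed: "\<lbrakk>x \<in> carrier H; y \<in> carrier H\<rbrakk> \<Longrightarrow> x - y \<in> carrier H"
  using add_closed[of x "- y"] uminus_closed by simp

lemma sum_closed: "(\<And>i. i \<in> F \<Longrightarrow> f i \<in> carrier H) \<Longrightarrow> sum f F \<in> carrier H"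
  by (induction F rule: infinite_finite_induct) (auto intro: zero_closed add_closed)

lemmas closed = zero_closed add_closed scaleC_closed uminus_closed diff_closed

lemma cinner_zero_left [simp]: "y \<in> carrier H \<Longrightarrow> cinner H 0 y = 0"
  using cinner_add_left[of 0 0 y] zero_closed by simp

lemma cinner_zero_right [simp]: "y \<in> carrier H \<Longrightarrow> cinner H y 0 = 0"
  using cinner_commute[of y 0] zero_closed by simp

lemma cinner_add_right:
  "\<lbrakk>x \<in> carrier H; y \<in> carrier H; z \<in> carrier H\<rbrakk>
    \<Longrightarrow> cinner H z (x + y) = cinner H z x + cinner H z y"
  by (metis add_closed cinner_add_left cinner_commute complex_cnj_add)

lemma cinner_scaleC_right:
  "\<lbrakk>x \<in> carrier H; y \<in> carrier H\<rbrakk> \<Longrightarrow> cinner H x (a *\<^sub>C y) = cnj a * cinner H x y"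
  by (metis scaleC_closed cinner_scaleC_left cinner_commute complex_cnj_mult)

lemma cinner_minus_left: "\<lbrakk>x \<in> carrier H; y \<in> carrier H\<rbrakk> \<Longrightarrow> cinner H (- x) y = - cinner H x y"
  using cinner_scaleC_left[of x y "- 1"] by simp

lemma cinner_minus_right: "\<lbrakk>x \<in> carrier H; y \<in> carrier H\<rbrakk> \<Longrightarrow> cinner H x (- y) = - cinner H x y"
  using cinner_scaleC_right[of x y "- 1"] by simp

lemma cinner_diff_left:
  "\<lbrakk>x \<in> carrier H; y \<in> carrier H; z \<in> carrier H\<rbrakk>
    \<Longrightarrow> cinner H (x - y) z = cinner H x z - cinner H y z"
  using cinner_add_left[of x "- y" z] by (simp add: uminus_closed cinner_minus_left)

lemma cinner_diff_right:
  "\<lbrakk>x \<in> carrier H; y \<in> carrier H; z \<in> carrier H\<rbrakk>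
    \<Longrightarrow> cinner H z (x - y) = cinner H z x - cinner H z y"
  using cinner_add_right[of x "- y" z] by (simp add: uminus_closed cinner_minus_right)

lemmas cinner_simps = cinner_add_left cinner_add_right cinner_diff_left cinner_diff_right
  cinner_scaleC_left cinner_scaleC_right cinner_minus_left cinner_minus_right closed

lemma cinner_sum_left:
  "\<lbrakk>\<And>i. i \<in> F \<Longrightarrow> f i \<in> carrier H; y \<in> carrier H\<rbrakk>
    \<Longrightarrow> cinner H (sum f F) y = (\<Sum>i\<in>F. cinner H (f i) y)"
  by (induction F rule: infinite_finite_induct) (auto simp: cinner_add_left sum_closed)

lemma cinner_sum_right:
  "\<lbrakk>\<And>i. i \<in> F \<Longrightarrow> f i \<in> carrier H; y \<in> carrier H\<rbrakk>
    \<Longrightarrow> cinner H y (sum f F) = (\<Sum>i\<in>F. cinner H y (f i))"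
  by (induction F rule: infinite_finite_induct) (auto simp: cinner_add_right sum_closed)

lemma cinner_self_nonneg: "x \<in> carrier H \<Longrightarrow> Re (cinner H x x) \<ge> 0"
  by (cases "x = 0") (auto dest: cinner_pos)

lemma hnorm_nonneg: "x \<in> carrier H \<Longrightarrow> hnorm H x \<ge> 0"
  by (simp add: hnorm_def cinner_self_nonneg)

lemma hnorm_sq: "x \<in> carrier H \<Longrightarrow> (hnorm H x)\<^sup>2 = Re (cinner H x x)"
  by (simp add: hnorm_def cinner_self_nonneg)

lemma cinner_self: "x \<in> carrier H \<Longrightarrow> cinner H x x = of_real ((hnorm H x)\<^sup>2)"
  using cinner_commute[of x x] by (simp add: complex_eq_iff hnorm_sq)

lemma hnorm_zero [simp]: "hnorm H 0 = 0"
  by (simp add: hnorm_def zero_closed)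

lemma hnorm_eq_0: "x \<in> carrier H \<Longrightarrow> hnorm H x = 0 \<longleftrightarrow> x = 0"
  using cinner_pos[of x] hnorm_sq[of x] by force

lemma cinner_Re_commute:
  "\<lbrakk>x \<in> carrier H; y \<in> carrier H\<rbrakk> \<Longrightarrow> Re (cinner H y x) = Re (cinner H x y)"
  by (subst cinner_commute) auto

lemma hnorm_add_sq:
  assumes "x \<in> carrier H" "y \<in> carrier H"
  shows "(hnorm H (x + y))\<^sup>2 = (hnorm H x)\<^sup>2 + 2 * Re (cinner H x y) + (hnorm H y)\<^sup>2"
  using assms cinner_Re_commute[OF assms] by (simp add: hnorm_sq cinner_simps)

lemma hnorm_scaleC: "x \<in> carrier H \<Longrightarrow> hnorm H (a *\<^sub>C x) = cmod a * hnorm H x"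
proof -
  assume x: "x \<in> carrier H"
  have "cinner H (a *\<^sub>C x) (a *\<^sub>C x) = a * cnj a * cinner H x x"
    using x by (simp add: cinner_simps)
  also have "\<dots> = of_real ((cmod a * hnorm H x)\<^sup>2)"
    using x by (simp add: cinner_self power_mult_distrib flip: complex_norm_square)
  finally have "cinner H (a *\<^sub>C x) (a *\<^sub>C x) = of_real ((cmod a * hnorm H x)\<^sup>2)" .
  then have "Re (cinner H (a *\<^sub>C x) (a *\<^sub>C x)) = (cmod a * hnorm H x)\<^sup>2" by simp
  then show ?thesis using x hnorm_nonneg[of x] by (simp add: hnorm_def real_sqrt_abs abs_mult)
qed

lemma hnorm_minus: "x \<in> carrier H \<Longrightarrow> hnorm H (- x) = hnorm H x"
  using hnorm_scaleC[of x "- 1"] by simp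

lemma hnorm_diff_commute:
  "\<lbrakk>x \<in> carrier H; y \<in> carrier H\<rbrakk> \<Longrightarrow> hnorm H (x - y) = hnorm H (y - x)"
  using hnorm_minus[of "x - y"] diff_closed by simp

lemma hnorm_diff_sq:
  assumes "x \<in> carrier H" "y \<in> carrier H"
  shows "(hnorm H (x - y))\<^sup>2 = (hnorm H x)\<^sup>2 - 2 * Re (cinner H x y) + (hnorm H y)\<^sup>2"
  using hnorm_add_sq[of x "- y"] assms by (simp add: hnorm_minus cinner_simps)

lemma parallelogram:
  assumes "x \<in> carrier H" "y \<in> carrier H"
  shows "(hnorm H (x + y))\<^sup>2 + (hnorm H (x - y))\<^sup>2 = 2 * (hnorm H x)\<^sup>2 + 2 * (hnorm H y)\<^sup>2"
  using hnorm_add_sq[OF assms] hnorm_diff_sq[OF assms] by simp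

lemma cauchy_schwarz:
  assumes x: "x \<in> carrier H" and y: "y \<in> carrier H"
  shows "cmod (cinner H x y) \<le> hnorm H x * hnorm H y"
proof (cases "y = 0")
  case True
  then show ?thesis using x by simp
next
  case False
  define a where "a = cinner H x y"
  define t where "t = (hnorm H y)\<^sup>2"
  have t: "t > 0" using False y cinner_pos hnorm_sq t_def by simp
  have yx: "cinner H y x = cnj a" unfolding a_def by (rule cinner_commute[OF y x])
  have aa: "cnj a * a = of_real ((cmod a)\<^sup>2)"
    by (simp only: complex_norm_square mult.commute)
  have "0 \<le> (hnorm H (t *\<^sub>C x - a *\<^sub>C y))\<^sup>2" by simp
  also have "\<dots> = t\<^sup>2 * (hnorm H x)\<^sup>2 - 2 * Re (of_real t * (cnj a * a)) + (cmod a)\<^sup>2 * t"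
    using x y t by (simp add: hnorm_diff_sq hnorm_scaleC cinner_simps power_mult_distrib
        mult.left_commute[of "cnj a"] del: times_complex.sel flip: a_def t_def)
  also have "\<dots> = t * (t * (hnorm H x)\<^sup>2 - (cmod a)\<^sup>2)"
    unfolding aa by (simp add: power2_eq_square algebra_simps)
  finally have "(cmod a)\<^sup>2 \<le> t * (hnorm H x)\<^sup>2"
    using t by (simp add: zero_le_mult_iff)
  then have "(cmod a)\<^sup>2 \<le> (hnorm H x * hnorm H y)\<^sup>2"
    by (simp add: t_def power_mult_distrib mult.commute)
  then show ?thesis
    unfolding a_def by (rule power2_le_imp_le) (auto intro: hnorm_nonneg mult_nonneg_nonneg x y)
qed

lemma hnorm_triangle:
  assumes "x \<in> carrier H" "y \<in> carrier H"
  shows "hnorm H (x + y) \<le> hnorm H x + hnorm H y"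
proof -
  have "Re (cinner H x y) \<le> hnorm H x * hnorm H y"
    using cauchy_schwarz[OF assms] complex_Re_le_cmod order_trans by blast
  then have "(hnorm H (x + y))\<^sup>2 \<le> (hnorm H x + hnorm H y)\<^sup>2"
    using assms by (simp add: hnorm_add_sq power2_sum)
  then show ?thesis
    by (rule power2_le_imp_le) (auto intro: hnorm_nonneg add_nonneg_nonneg assms)
qed

lemma hnorm_triangle_diff:
  assumes "x \<in> carrier H" "y \<in> carrier H" "z \<in> carrier H"
  shows "hnorm H (x - z) \<le> hnorm H (x - y) + hnorm H (y - z)"
  using hnorm_triangle[of "x - y" "y - z"] assms diff_closed by simp

lemma hnorm_add_sq_le:
  assumes "x \<in> carrier H" "y \<in> carrier H"
  shows "(hnorm H (x + y))\<^sup>2 \<le> 2 * (hnorm H x)\<^sup>2 + 2 * (hnorm H y)\<^sup>2"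
  using parallelogram[OF assms] zero_le_power2[of "hnorm H (x - y)"] by linarith

lemma cinner_ext:
  assumes "x \<in> carrier H" "y \<in> carrier H" "\<And>z. z \<in> carrier H \<Longrightarrow> cinner H z x = cinner H z y"
  shows "x = y"
proof -
  have "cinner H (x - y) (x - y) = 0"
    using assms(1,2) assms(3)[of "x - y"] by (simp add: cinner_diff_right diff_closed)
  then have "hnorm H (x - y) = 0" by (simp add: hnorm_def)
  then show ?thesis using hnorm_eq_0[OF diff_closed[OF assms(1,2)]] by simp
qed

lemma tendsto_cinner_right:
  assumes X: "\<And>n. X n \<in> carrier H" and x: "x \<in> carrier H" and y: "y \<in> carrier H"
    and lim: "(\<lambda>n. hnorm H (X n - x)) \<longlonglongrightarrow> 0"
  shows "(\<lambda>n. cinner H y (X n)) \<longlonglongrightarrow> cinner H y x"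
proof -
  have "(\<lambda>n. hnorm H y * hnorm H (X n - x)) \<longlonglongrightarrow> 0"
    using tendsto_mult[OF tendsto_const lim] by simp
  moreover have "norm (cinner H y (X n) - cinner H y x) \<le> hnorm H y * hnorm H (X n - x)" for n
    using cauchy_schwarz[OF y diff_closed[OF X x], of n] cinner_diff_right[OF X x y, of n] by simp
  ultimately have "(\<lambda>n. cinner H y (X n) - cinner H y x) \<longlonglongrightarrow> 0"
    by (intro Lim_null_comparison[of "\<lambda>n. cinner H y (X n) - cinner H y x"] always_eventually) auto
  then show ?thesis by (simp add: LIM_zero_iff)
qed

lemma tendsto_hnorm:
  assumes X: "\<And>n. X n \<in> carrier H" and x: "x \<in> carrier H"
    and lim: "(\<lambda>n. hnorm H (X n - x)) \<longlonglongrightarrow> 0"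
  shows "(\<lambda>n. hnorm H (X n)) \<longlonglongrightarrow> hnorm H x"
proof -
  have "norm (hnorm H (X n) - hnorm H x) \<le> hnorm H (X n - x)" for n
    using hnorm_triangle_diff[of "X n" x 0] hnorm_triangle_diff[of x "X n" 0]
      hnorm_diff_commute[of x "X n"] X[of n] x zero_closed by auto
  then have "(\<lambda>n. hnorm H (X n) - hnorm H x) \<longlonglongrightarrow> 0"
    using lim by (intro Lim_null_comparison[OF _ lim]) auto
  then show ?thesis by (simp add: LIM_zero_iff)
qed

text \<open>The functional lives on a subspace \<open>E\<close> that need not be closed or dense; the representing
  vector lies in the whole space and is the limit of a minimizing sequence in \<open>E\<close> for
  \<open>\<parallel>x\<parallel>\<^sup>2 - 2 Re (\<phi> x)\<close>, which is Cauchy by the parallelogram law. Working with arbitrary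
  subspaces replaces orthogonal projections and extensions by continuity in the later proofs.\<close>

lemma riesz_subspace:
  assumes E: "E \<subseteq> carrier H" "0 \<in> E"
    and E_add: "\<And>x y. \<lbrakk>x \<in> E; y \<in> E\<rbrakk> \<Longrightarrow> x + y \<in> E"
    and E_scale: "\<And>a x. x \<in> E \<Longrightarrow> a *\<^sub>C x \<in> E"
    and phi_add: "\<And>x y. \<lbrakk>x \<in> E; y \<in> E\<rbrakk> \<Longrightarrow> \<phi> (x + y) = \<phi> x + \<phi> y"
    and phi_scale: "\<And>a x. x \<in> E \<Longrightarrow> \<phi> (a *\<^sub>C x) = a * \<phi> x"
    and bound: "\<And>x. x \<in> E \<Longrightarrow> cmod (\<phi> x) \<le> M * hnorm H x" and M: "M \<ge> 0"
  obtains a where "a \<in> carrier H" "\<And>x. x \<in> E \<Longrightarrow> \<phi> x = cinner H x a" "hnorm H a \<le> M"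
proof -
  have EH: "x \<in> carrier H" if "x \<in> E" for x using that E by auto
  define q where "q x = (hnorm H x)\<^sup>2 - 2 * Re (\<phi> x)" for x
  have q_ge: "q x \<ge> - M\<^sup>2" if "x \<in> E" for x
  proof -
    have "Re (\<phi> x) \<le> M * hnorm H x" using bound[OF that] complex_Re_le_cmod order_trans by blast
    moreover have "0 \<le> (hnorm H x - M)\<^sup>2" by simp
    ultimately show ?thesis unfolding q_def power2_diff by (simp add: mult.commute)
  qed
  define m where "m = Inf (q ` E)"
  have bdd: "bdd_below (q ` E)" using q_ge by (auto intro!: bdd_belowI[of _ "- M\<^sup>2"])
  have m_le: "m \<le> q x" if "x \<in> E" for x
    unfolding m_def using that bdd by (intro cInf_lower) auto
  have "\<exists>x\<in>E. q x < m + inverse (real (Suc n))" for n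
    using cInf_lessD[of "q ` E" "m + inverse (real (Suc n))"] E(2) unfolding m_def by fastforce
  then obtain e where e: "\<And>n. e n \<in> E" and e_less: "\<And>n. q (e n) < m + inverse (real (Suc n))"
    by metis
  have eH: "e n \<in> carrier H" for n using e EH by blast
  have close: "(hnorm H (e k - e l))\<^sup>2 < 2 * inverse (real (Suc k)) + 2 * inverse (real (Suc l))" for k l
  proof -
    have s: "e k + e l \<in> E" using e E_add by blast
    let ?h = "(1/2) *\<^sub>C (e k + e l)"
    have "m \<le> q ?h" by (intro m_le E_scale s)
    moreover have "4 * q ?h = (hnorm H (e k + e l))\<^sup>2 - 4 * Re (\<phi> (e k)) - 4 * Re (\<phi> (e l))"
      unfolding q_def using s e EH by (simp add: hnorm_scaleC phi_scale phi_add power_divide algebra_simps)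
    moreover have "2 * q (e k) + 2 * q (e l) =
        2 * (hnorm H (e k))\<^sup>2 + 2 * (hnorm H (e l))\<^sup>2 - 4 * Re (\<phi> (e k)) - 4 * Re (\<phi> (e l))"
      by (simp add: q_def)
    ultimately show ?thesis
      using parallelogram[OF eH[of k] eH[of l]] e_less[of k] e_less[of l] by linarith
  qed
  have cauchy: "\<forall>r>0. \<exists>N. \<forall>k\<ge>N. \<forall>l\<ge>N. hnorm H (e k - e l) < r"
  proof (intro allI impI)
    fix r :: real assume r: "r > 0"
    then obtain N where N: "inverse (real (Suc N)) < r\<^sup>2 / 4"
      using reals_Archimedean[of "r\<^sup>2 / 4"] by auto
    have "hnorm H (e k - e l) < r" if "k \<ge> N" "l \<ge> N" for k l
    proof -
      have "inverse (real (Suc k)) \<le> inverse (real (Suc N))"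
        "inverse (real (Suc l)) \<le> inverse (real (Suc N))"
        using that by (auto intro!: le_imp_inverse_le)
      then have "(hnorm H (e k - e l))\<^sup>2 < r\<^sup>2" using close[of k l] N by linarith
      then show ?thesis using r by (simp add: power2_less_imp_less)
    qed
    then show "\<exists>N. \<forall>k\<ge>N. \<forall>l\<ge>N. hnorm H (e k - e l) < r" by blast
  qed
  obtain a where a: "a \<in> carrier H" and lim: "(\<lambda>n. hnorm H (e n - a)) \<longlonglongrightarrow> 0"
    using complete[OF eH cauchy] by blast
  \<comment> \<open>The first variation of the quadratic functional vanishes at the limit \<open>a\<close>.\<close>
  have Re_eq: "Re (\<phi> x) = Re (cinner H x a)" if x: "x \<in> E" for x
  proof -
    define \<delta> where "\<delta> = Re (\<phi> x) - Re (cinner H x a)"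
    have ineq: "2 * t * \<delta> \<le> t\<^sup>2 * (hnorm H x)\<^sup>2" for t
    proof -
      have "- inverse (real (Suc n)) \<le> 2 * t * (Re (cinner H x (e n)) - Re (\<phi> x)) + t\<^sup>2 * (hnorm H x)\<^sup>2" for n
      proof -
        have "m \<le> q (e n + of_real t *\<^sub>C x)" by (intro m_le E_add E_scale e x)
        also have "\<dots> = q (e n) + 2 * t * (Re (cinner H x (e n)) - Re (\<phi> x)) + t\<^sup>2 * (hnorm H x)\<^sup>2"
          unfolding q_def using x e EH[OF x] eH[of n] cinner_Re_commute[of "e n" x]
          by (simp add: hnorm_add_sq phi_add phi_scale E_scale hnorm_scaleC cinner_simps
              power_mult_distrib algebra_simps)
        finally show ?thesis using e_less[of n] by linarith
      qed
      moreover have "(\<lambda>n. - inverse (real (Suc n))) \<longlonglongrightarrow> - 0"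
        by (intro tendsto_minus LIMSEQ_inverse_real_of_nat)
      moreover have "(\<lambda>n. 2 * t * (Re (cinner H x (e n)) - Re (\<phi> x)) + t\<^sup>2 * (hnorm H x)\<^sup>2)
          \<longlonglongrightarrow> 2 * t * (Re (cinner H x a) - Re (\<phi> x)) + t\<^sup>2 * (hnorm H x)\<^sup>2"
        using tendsto_cinner_right[OF eH a EH[OF x] lim] by (intro tendsto_intros)
      ultimately have "- 0 \<le> 2 * t * (Re (cinner H x a) - Re (\<phi> x)) + t\<^sup>2 * (hnorm H x)\<^sup>2"
        by (intro LIMSEQ_le) auto
      then show ?thesis unfolding \<delta>_def by (simp add: algebra_simps)
    qed
    have "\<delta> = 0"
    proof (rule ccontr)
      assume d: "\<delta> \<noteq> 0"
      \<comment> \<open>At \<open>t = \<delta> / c\<close> the linear term beats the quadratic one; adding 1 keeps \<open>c\<close> positive when \<open>x = 0\<close>.\<close>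
      define c where "c = (hnorm H x)\<^sup>2 + 1"
      have c: "c > 0" "(hnorm H x)\<^sup>2 \<le> c" unfolding c_def by (auto intro: add_nonneg_pos)
      have "2 * (\<delta> / c) * \<delta> \<le> (\<delta> / c)\<^sup>2 * (hnorm H x)\<^sup>2" by (rule ineq)
      also have "\<dots> \<le> (\<delta> / c)\<^sup>2 * c" using c by (intro mult_left_mono) auto
      finally have "2 * (\<delta>\<^sup>2 / c) \<le> \<delta>\<^sup>2 / c" using c by (simp add: power2_eq_square)
      moreover have "\<delta>\<^sup>2 / c > 0" using d c by simp
      ultimately show False by linarith
    qed
    then show ?thesis by (simp add: \<delta>_def)
  qed
  have eq: "\<phi> x = cinner H x a" if x: "x \<in> E" for x
  proof -
    \<comment> \<open>The imaginary parts agree because the real parts agree at \<open>\<i> x\<close>.\<close>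
    have "Re (\<phi> (\<i> *\<^sub>C x)) = Re (cinner H (\<i> *\<^sub>C x) a)" by (intro Re_eq E_scale x)
    then show ?thesis
      using Re_eq[OF x] x a EH by (simp add: phi_scale cinner_scaleC_left complex_eq_iff)
  qed
  have "hnorm H a \<le> M"
  proof -
    have "Re (cinner H a (e n)) \<le> M * hnorm H (e n)" for n
      using bound[OF e[of n]] eq[OF e[of n]] cinner_Re_commute[OF a eH[of n]]
        complex_Re_le_cmod[of "\<phi> (e n)"] by simp
    moreover have "(\<lambda>n. Re (cinner H a (e n))) \<longlonglongrightarrow> Re (cinner H a a)"
      using tendsto_cinner_right[OF eH a a lim] by (intro tendsto_intros)
    moreover have "(\<lambda>n. M * hnorm H (e n)) \<longlonglongrightarrow> M * hnorm H a"
      using tendsto_hnorm[OF eH a lim] by (intro tendsto_intros)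
    ultimately have "Re (cinner H a a) \<le> M * hnorm H a" by (intro LIMSEQ_le) auto
    then have "hnorm H a * hnorm H a \<le> M * hnorm H a"
      using a by (simp add: power2_eq_square flip: hnorm_sq)
    then show ?thesis using M hnorm_nonneg[OF a] by (cases "hnorm H a = 0") auto
  qed
  then show ?thesis using that a eq by blast
qed

end

section \<open>Bounded operators and adjoints\<close>

lemma bounded_op_closed: "\<lbrakk>bounded_op H K T; x \<in> carrier H\<rbrakk> \<Longrightarrow> T x \<in> carrier K"
  by (simp add: bounded_op_def)

lemma bounded_op_add:
  "\<lbrakk>bounded_op H K T; x \<in> carrier H; y \<in> carrier H\<rbrakk> \<Longrightarrow> T (x + y) = T x + T y"
  by (simp add: bounded_op_def)

lemma bounded_op_scaleC: "\<lbrakk>bounded_op H K T; x \<in> carrier H\<rbrakk> \<Longrightarrow> T (a *\<^sub>C x) = a *\<^sub>C T x"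
  by (simp add: bounded_op_def)

lemma bounded_op_zero: "\<lbrakk>bounded_op H K T; hilbert_space H\<rbrakk> \<Longrightarrow> T 0 = 0"
  using bounded_op_scaleC[of H K T 0 0] hilbert_space.zero_closed[of H] by simp

lemma bounded_op_diff:
  assumes T: "bounded_op H K T" and "hilbert_space H" and x: "x \<in> carrier H" and y: "y \<in> carrier H"
  shows "T (x - y) = T x - T y"
proof -
  have "T (x + (- 1) *\<^sub>C y) = T x + (- 1) *\<^sub>C T y"
    using assms by (simp only: bounded_op_add bounded_op_scaleC hilbert_space.scaleC_closed)
  then show ?thesis by simp
qed

lemma bounded_op_sum:
  assumes T: "bounded_op H K T" and H: "hilbert_space H" and "\<And>i. i \<in> F \<Longrightarrow> f i \<in> carrier H"
  shows "T (sum f F) = (\<Sum>i\<in>F. T (f i))"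
  using assms(3)
proof (induction F rule: infinite_finite_induct)
  case (insert i F)
  then show ?case
    by (simp add: bounded_op_add[OF T] hilbert_space.sum_closed[OF H])
qed (use bounded_op_zero[OF T H] in auto)

lemma bounded_op_bound:
  assumes "bounded_op H K T" "hilbert_space H"
  obtains M where "M \<ge> 0" "\<And>x. x \<in> carrier H \<Longrightarrow> hnorm K (T x) \<le> M * hnorm H x"
proof -
  obtain M where M: "\<forall>x\<in>carrier H. hnorm K (T x) \<le> M * hnorm H x"
    using assms by (auto simp: bounded_op_def)
  have "hnorm K (T x) \<le> max M 0 * hnorm H x" if "x \<in> carrier H" for x
    using M that hilbert_space.hnorm_nonneg[OF assms(2) that] mult_right_mono[of M "max M 0" "hnorm H x"]
    by force
  then show ?thesis using that[of "max M 0"] by simp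
qed

lemma bounded_opI:
  assumes "\<And>x. x \<in> carrier H \<Longrightarrow> T x \<in> carrier K"
    and "\<And>x y. \<lbrakk>x \<in> carrier H; y \<in> carrier H\<rbrakk> \<Longrightarrow> T (x + y) = T x + T y"
    and "\<And>a x. x \<in> carrier H \<Longrightarrow> T (a *\<^sub>C x) = a *\<^sub>C T x"
    and "\<And>x. x \<in> carrier H \<Longrightarrow> hnorm K (T x) \<le> M * hnorm H x"
  shows "bounded_op H K T"
  using assms unfolding bounded_op_def by blast

lemma bounded_op_compose:
  assumes T: "bounded_op H K T" and R: "bounded_op K L R" and H: "hilbert_space H"
    and K: "hilbert_space K"
  shows "bounded_op H L (\<lambda>x. R (T x))"
proof -
  obtain M where M: "M \<ge> 0" "\<And>x. x \<in> carrier H \<Longrightarrow> hnorm K (T x) \<le> M * hnorm H x"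
    using bounded_op_bound[OF T H] by blast
  obtain N where N: "N \<ge> 0" "\<And>x. x \<in> carrier K \<Longrightarrow> hnorm L (R x) \<le> N * hnorm K x"
    using bounded_op_bound[OF R K] by blast
  have "hnorm L (R (T x)) \<le> (N * M) * hnorm H x" if x: "x \<in> carrier H" for x
  proof -
    have "hnorm L (R (T x)) \<le> N * hnorm K (T x)"
      by (intro N(2) bounded_op_closed[OF T] x)
    also have "\<dots> \<le> N * (M * hnorm H x)" by (intro mult_left_mono M(2) N(1) x)
    finally show ?thesis by simp
  qed
  then show ?thesis
    by (intro bounded_opI)
      (simp_all add: bounded_op_closed[OF T] bounded_op_add[OF T] bounded_op_scaleC[OF T]
        bounded_op_closed[OF R] bounded_op_add[OF R] bounded_op_scaleC[OF R])
qed

lemma bounded_op_id: "bounded_op H H (\<lambda>x. x)"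
  by (rule bounded_opI[where M = 1]) auto

lemma hadj_eqI:
  assumes H: "hilbert_space H" and x: "x \<in> carrier H"
    and eq: "\<And>h. h \<in> carrier H \<Longrightarrow> cinner K (T h) y = cinner H h x"
  shows "hadj H K T y = x"
  unfolding hadj_def
proof (rule the_equality)
  show "x \<in> carrier H \<and> (\<forall>h\<in>carrier H. cinner K (T h) y = cinner H h x)" using x eq by blast
  fix x' assume x': "x' \<in> carrier H \<and> (\<forall>h\<in>carrier H. cinner K (T h) y = cinner H h x')"
  then show "x' = x"
    using x eq by (intro hilbert_space.cinner_ext[OF H]) metis+
qed

context
  fixes H :: "'a::complex_vector hilbert" and K :: "'b::complex_vector hilbert" and T
  assumes H: "hilbert_space H" and K: "hilbert_space K" and T: "bounded_op H K T"
begin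

interpretation H: hilbert_space H by (rule H)
interpretation K: hilbert_space K by (rule K)

text \<open>Riesz representation of \<open>h \<mapsto> \<langle>T h, y\<rangle>\<close> shows that the description defining
  \<open>hadj\<close> is satisfied.\<close>

lemma hadj_closed_and_cinner:
  assumes y: "y \<in> carrier K"
  shows "hadj H K T y \<in> carrier H \<and> (\<forall>h\<in>carrier H. cinner K (T h) y = cinner H h (hadj H K T y))"
proof -
  obtain M where M: "M \<ge> 0" "\<And>x. x \<in> carrier H \<Longrightarrow> hnorm K (T x) \<le> M * hnorm H x"
    using bounded_op_bound[OF T H] by blast
  have "cmod (cinner K (T x) y) \<le> (M * hnorm K y) * hnorm H x" if x: "x \<in> carrier H" for x
  proof -
    have "cmod (cinner K (T x) y) \<le> hnorm K (T x) * hnorm K y"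
      by (intro K.cauchy_schwarz bounded_op_closed[OF T] x y)
    also have "\<dots> \<le> (M * hnorm H x) * hnorm K y"
      by (intro mult_right_mono M(2) K.hnorm_nonneg x y)
    finally show ?thesis by (simp add: mult_ac)
  qed
  then obtain a where a: "a \<in> carrier H" "\<And>x. x \<in> carrier H \<Longrightarrow> cinner K (T x) y = cinner H x a"
    using y M(1)
    by (auto intro: H.riesz_subspace[of "carrier H" "\<lambda>x. cinner K (T x) y" "M * hnorm K y"]
        simp: H.closed bounded_op_add[OF T] bounded_op_scaleC[OF T] bounded_op_closed[OF T]
          K.cinner_simps K.hnorm_nonneg)
  have "hadj H K T y = a" by (rule hadj_eqI[OF H a])
  then show ?thesis using a by simp
qed

lemma hadj_closed: "y \<in> carrier K \<Longrightarrow> hadj H K T y \<in> carrier H"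
  using hadj_closed_and_cinner by blast

lemma cinner_hadj_right:
  "\<lbrakk>h \<in> carrier H; y \<in> carrier K\<rbrakk> \<Longrightarrow> cinner H h (hadj H K T y) = cinner K (T h) y"
  using hadj_closed_and_cinner by simp

lemma cinner_hadj_left:
  "\<lbrakk>h \<in> carrier H; y \<in> carrier K\<rbrakk> \<Longrightarrow> cinner H (hadj H K T y) h = cinner K y (T h)"
  using cinner_hadj_right[of h y] H.cinner_commute[of "hadj H K T y" h]
    K.cinner_commute[of y "T h"] hadj_closed bounded_op_closed[OF T] by simp

lemma hnorm_hadj_le:
  assumes M: "\<And>x. x \<in> carrier H \<Longrightarrow> hnorm K (T x) \<le> M * hnorm H x" and y: "y \<in> carrier K" and "M \<ge> 0"
  shows "hnorm H (hadj H K T y) \<le> M * hnorm K y"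
proof -
  let ?x = "hadj H K T y"
  have x: "?x \<in> carrier H" using hadj_closed y by blast
  have "(hnorm H ?x)\<^sup>2 = Re (cinner K (T ?x) y)"
    using x y by (simp add: H.hnorm_sq cinner_hadj_right)
  also have "\<dots> \<le> cmod (cinner K (T ?x) y)" by (rule complex_Re_le_cmod)
  also have "\<dots> \<le> hnorm K (T ?x) * hnorm K y"
    using x y by (intro K.cauchy_schwarz bounded_op_closed[OF T])
  also have "\<dots> \<le> M * hnorm H ?x * hnorm K y"
    using x y by (intro mult_right_mono M K.hnorm_nonneg)
  finally have "hnorm H ?x * hnorm H ?x \<le> hnorm H ?x * (M * hnorm K y)"
    by (simp add: power2_eq_square mult_ac)
  then show ?thesis
    using H.hnorm_nonneg[OF x] K.hnorm_nonneg[OF y] \<open>M \<ge> 0\<close> by (cases "hnorm H ?x = 0") auto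
qed

lemma bounded_op_hadj: "bounded_op K H (hadj H K T)"
proof -
  obtain M where M: "M \<ge> 0" "\<And>x. x \<in> carrier H \<Longrightarrow> hnorm K (T x) \<le> M * hnorm H x"
    using bounded_op_bound[OF T H] by blast
  note Tc = bounded_op_closed[OF T]
  show ?thesis
  proof (rule bounded_opI[where M = M])
    show "hadj H K T (x + y) = hadj H K T x + hadj H K T y"
      if "x \<in> carrier K" "y \<in> carrier K" for x y
      using that by (intro hadj_eqI[OF H])
        (auto simp: K.cinner_simps H.cinner_simps cinner_hadj_right hadj_closed Tc)
    show "hadj H K T (a *\<^sub>C x) = a *\<^sub>C hadj H K T x" if "x \<in> carrier K" for a x
      using that by (intro hadj_eqI[OF H])
        (auto simp: K.cinner_simps H.cinner_simps cinner_hadj_right hadj_closed Tc)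
    show "hnorm H (hadj H K T y) \<le> M * hnorm K y" if "y \<in> carrier K" for y
      by (rule hnorm_hadj_le[OF M(2) that M(1)])
  qed (rule hadj_closed)
qed

end

section \<open>Constructions of Hilbert spaces\<close>

text \<open>All axioms, completeness included, are carried over by a linear isometry. No assumption relates the
  inner product of \<open>K\<close> to that of \<open>H\<close> off the carrier, so this covers both spaces transported along
  an injective map and reflected spaces.\<close>

lemma hilbert_space_isometric_image:
  fixes K :: "'b::complex_vector hilbert"
  assumes H: "hilbert_space H" and K: "carrier K = T ` carrier H"
    and T_add: "\<And>x y. \<lbrakk>x \<in> carrier H; y \<in> carrier H\<rbrakk> \<Longrightarrow> T (x + y) = T x + T y"
    and T_scale: "\<And>a x. x \<in> carrier H \<Longrightarrow> T (a *\<^sub>C x) = a *\<^sub>C T x"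
    and iso: "\<And>x y. \<lbrakk>x \<in> carrier H; y \<in> carrier H\<rbrakk> \<Longrightarrow> cinner K (T x) (T y) = cinner H x y"
  shows "hilbert_space K"
proof -
  interpret hilbert_space H by (rule H)
  have T_zero: "T 0 = 0" using T_scale[OF zero_closed, of 0] by simp
  have T_diff: "T (x - y) = T x - T y" if "x \<in> carrier H" "y \<in> carrier H" for x y
    using T_add[of x "(- 1) *\<^sub>C y"] T_scale[of y "- 1"] that by (simp add: closed)
  have norm: "hnorm K (T x) = hnorm H x" if "x \<in> carrier H" for x
    using that by (simp add: hnorm_def iso)
  show ?thesis
  proof
    show "0 \<in> carrier K" using K T_zero zero_closed by force
    show "x + y \<in> carrier K" if "x \<in> carrier K" "y \<in> carrier K" for x y
      using that unfolding K by (auto simp flip: T_add intro: add_closed)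
    show "a *\<^sub>C x \<in> carrier K" if "x \<in> carrier K" for a x
      using that unfolding K by (auto simp flip: T_scale intro: scaleC_closed)
    show "cinner K (x + y) z = cinner K x z + cinner K y z"
      if "x \<in> carrier K" "y \<in> carrier K" "z \<in> carrier K" for x y z
      using that unfolding K by (auto simp: iso cinner_simps simp flip: T_add)
    show "cinner K (a *\<^sub>C x) y = a * cinner K x y" if "x \<in> carrier K" "y \<in> carrier K" for a x y
      using that unfolding K by (auto simp: iso cinner_simps simp flip: T_scale)
    show "cinner K x y = cnj (cinner K y x)" if "x \<in> carrier K" "y \<in> carrier K" for x y
      using that unfolding K by (auto simp: iso intro: cinner_commute)
    show "Re (cinner K x x) > 0" if x: "x \<in> carrier K" "x \<noteq> 0" for x
    proof -
      obtain a where "a \<in> carrier H" "x = T a" using x unfolding K by blast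
      then show ?thesis using x T_zero by (auto simp: iso intro: cinner_pos)
    qed
    fix X :: "nat \<Rightarrow> 'b"
    assume X: "\<And>n. X n \<in> carrier K"
      and cauchy: "\<forall>e>0. \<exists>N. \<forall>m\<ge>N. \<forall>n\<ge>N. hnorm K (X m - X n) < e"
    have "\<exists>y\<in>carrier H. X n = T y" for n using X[of n] unfolding K by auto
    then obtain Y where Y: "\<And>n. Y n \<in> carrier H" "\<And>n. X n = T (Y n)" by metis
    have "\<forall>e>0. \<exists>N. \<forall>m\<ge>N. \<forall>n\<ge>N. hnorm H (Y m - Y n) < e"
      using cauchy by (simp add: Y norm closed flip: T_diff)
    then obtain y where y: "y \<in> carrier H" "(\<lambda>n. hnorm H (Y n - y)) \<longlonglongrightarrow> 0"
      using complete[of Y] Y by blast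
    then have "(\<lambda>n. hnorm K (X n - T y)) \<longlonglongrightarrow> 0"
      by (simp add: Y norm closed flip: T_diff)
    then show "\<exists>x\<in>carrier K. (\<lambda>n. hnorm K (X n - x)) \<longlonglongrightarrow> 0" using y K by blast
  qed
qed

text \<open>The inner product is set to 0 off the carrier because \<open>formal_RKHS\<close> demands that normalization.\<close>

definition transported_space :: "'a hilbert \<Rightarrow> ('a \<Rightarrow> 'b) \<Rightarrow> 'b hilbert" where
  "transported_space H T = \<lparr>carrier = T ` carrier H,
     cinner = (\<lambda>f g. if f \<in> T ` carrier H \<and> g \<in> T ` carrier H
       then cinner H (inv_into (carrier H) T f) (inv_into (carrier H) T g) else 0)\<rparr>"

lemma carrier_transported [simp]: "carrier (transported_space H T) = T ` carrier H"
  by (simp add: transported_space_def)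

lemma cinner_transported:
  "\<lbrakk>inj_on T (carrier H); x \<in> carrier H; y \<in> carrier H\<rbrakk>
    \<Longrightarrow> cinner (transported_space H T) (T x) (T y) = cinner H x y"
  by (simp add: transported_space_def)

lemma cinner_transported_off:
  "f \<notin> T ` carrier H \<or> g \<notin> T ` carrier H \<Longrightarrow> cinner (transported_space H T) f g = 0"
  by (auto simp: transported_space_def)

lemma hilbert_space_transported:
  fixes T :: "'a::complex_vector \<Rightarrow> 'b::complex_vector"
  assumes "hilbert_space H" "inj_on T (carrier H)"
    and "\<And>x y. \<lbrakk>x \<in> carrier H; y \<in> carrier H\<rbrakk> \<Longrightarrow> T (x + y) = T x + T y"
    and "\<And>a x. x \<in> carrier H \<Longrightarrow> T (a *\<^sub>C x) = a *\<^sub>C T x"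
  shows "hilbert_space (transported_space H T)"
  using assms by (intro hilbert_space_isometric_image[of H _ T]) (simp_all add: cinner_transported)

lemma hilbert_space_orthogonal_complement:
  assumes H: "hilbert_space (H :: 'a::complex_vector hilbert)" and B: "B \<subseteq> carrier H"
  shows "hilbert_space \<lparr>carrier = {x \<in> carrier H. \<forall>b\<in>B. cinner H b x = 0}, cinner = cinner H\<rparr>"
    (is "hilbert_space ?N")
proof -
  interpret hilbert_space H by (rule H)
  have norm: "hnorm ?N = hnorm H" by (simp add: hnorm_def fun_eq_iff)
  have BH: "b \<in> carrier H" if "b \<in> B" for b using that B by blast
  show ?thesis
  proof
    fix X :: "nat \<Rightarrow> 'a"
    assume X: "\<And>n. X n \<in> carrier ?N"
      and cauchy: "\<forall>e>0. \<exists>N. \<forall>m\<ge>N. \<forall>n\<ge>N. hnorm ?N (X m - X n) < e"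
    have XH: "X n \<in> carrier H" for n using X[of n] by simp
    obtain x where x: "x \<in> carrier H" "(\<lambda>n. hnorm H (X n - x)) \<longlonglongrightarrow> 0"
      using complete[of X] XH cauchy norm by auto
    have "cinner H b x = 0" if b: "b \<in> B" for b
      using tendsto_cinner_right[OF XH x(1) BH[OF b] x(2)] X b
      by (simp add: LIMSEQ_const_iff)
    then show "\<exists>x\<in>carrier ?N. (\<lambda>n. hnorm ?N (X n - x)) \<longlonglongrightarrow> 0"
      using x norm by auto
  next
    show "cinner ?N x y = cnj (cinner ?N y x)" if "x \<in> carrier ?N" "y \<in> carrier ?N" for x y
      using that by (auto intro: cinner_commute)
  qed (auto simp: cinner_simps BH cinner_pos)
qed

lemma hsum_simps [simp]:
  "carrier (hsum H K) = carrier H \<times> carrier K"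
  "cinner (hsum H K) p q = cinner H (fst p) (fst q) + cinner K (snd p) (snd q)"
  by (simp_all add: hsum_def)

lemma scaleC_prod_simps [simp]: "fst (a *\<^sub>C p) = a *\<^sub>C fst p" "snd (a *\<^sub>C p) = a *\<^sub>C snd p"
  by (simp_all add: scaleC_prod_def)

lemma hilbert_space_hsum:
  assumes H: "hilbert_space (H :: 'a::complex_vector hilbert)"
    and K: "hilbert_space (K :: 'b::complex_vector hilbert)"
  shows "hilbert_space (hsum H K)"
proof -
  interpret H: hilbert_space H by (rule H)
  interpret K: hilbert_space K by (rule K)
  have norm: "hnorm (hsum H K) p = sqrt ((hnorm H (fst p))\<^sup>2 + (hnorm K (snd p))\<^sup>2)"
    if "p \<in> carrier (hsum H K)" for p
    using that by (auto simp: hnorm_def H.cinner_self_nonneg K.cinner_self_nonneg)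
  show ?thesis
  proof
    fix X :: "nat \<Rightarrow> 'a \<times> 'b"
    assume X: "\<And>n. X n \<in> carrier (hsum H K)"
      and cauchy: "\<forall>e>0. \<exists>N. \<forall>m\<ge>N. \<forall>n\<ge>N. hnorm (hsum H K) (X m - X n) < e"
    have Xc: "fst (X n) \<in> carrier H" "snd (X n) \<in> carrier K" for n
      using X[of n] by (auto simp: mem_Times_iff)
    have d: "X m - X n \<in> carrier (hsum H K)" for m n
      using Xc by (auto simp: mem_Times_iff H.closed K.closed)
    have le1: "hnorm H (fst (X m) - fst (X n)) \<le> hnorm (hsum H K) (X m - X n)" for m n
      unfolding norm[OF d] by (simp add: real_le_rsqrt)
    have le2: "hnorm K (snd (X m) - snd (X n)) \<le> hnorm (hsum H K) (X m - X n)" for m n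
      unfolding norm[OF d] by (simp add: real_le_rsqrt)
    obtain x where x: "x \<in> carrier H" "(\<lambda>n. hnorm H (fst (X n) - x)) \<longlonglongrightarrow> 0"
      using H.complete[of "\<lambda>n. fst (X n)"] Xc cauchy le1 by (meson le_less_trans)
    obtain y where y: "y \<in> carrier K" "(\<lambda>n. hnorm K (snd (X n) - y)) \<longlonglongrightarrow> 0"
      using K.complete[of "\<lambda>n. snd (X n)"] Xc cauchy le2 by (meson le_less_trans)
    have "hnorm (hsum H K) (X n - (x, y)) =
        sqrt ((hnorm H (fst (X n) - x))\<^sup>2 + (hnorm K (snd (X n) - y))\<^sup>2)" for n
      using Xc x y by (subst norm) (auto simp: mem_Times_iff H.closed K.closed)
    moreover have "(\<lambda>n. sqrt ((hnorm H (fst (X n) - x))\<^sup>2 + (hnorm K (snd (X n) - y))\<^sup>2))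
        \<longlonglongrightarrow> sqrt (0\<^sup>2 + 0\<^sup>2)"
      by (intro tendsto_intros x y)
    ultimately have "(\<lambda>n. hnorm (hsum H K) (X n - (x, y))) \<longlonglongrightarrow> 0" by simp
    then show "\<exists>p\<in>carrier (hsum H K). (\<lambda>n. hnorm (hsum H K) (X n - p)) \<longlonglongrightarrow> 0"
      using x y by (intro bexI[of _ "(x, y)"]) auto
  next
    show "Re (cinner (hsum H K) p p) > 0" if "p \<in> carrier (hsum H K)" "p \<noteq> 0" for p
      using that H.cinner_pos[of "fst p"] K.cinner_pos[of "snd p"]
        H.cinner_self_nonneg[of "fst p"] K.cinner_self_nonneg[of "snd p"]
      by (cases "fst p = 0") (auto simp: prod_eq_iff mem_Times_iff intro: add_pos_nonneg add_nonneg_pos)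
    show "cinner (hsum H K) p q = cnj (cinner (hsum H K) q p)"
      if "p \<in> carrier (hsum H K)" "q \<in> carrier (hsum H K)" for p q
      using that H.cinner_commute[of "fst p" "fst q"] K.cinner_commute[of "snd p" "snd q"] by auto
  qed (auto simp: mem_Times_iff H.cinner_simps K.cinner_simps distrib_left)
qed

text \<open>The index type is arbitrary: words give the Fock space \<open>H2\<close>, a finite type gives \<open>hpow\<close>, and
  natural numbers give the sequence space through which positive contractions are factored.\<close>

definition ell2 :: "'y hilbert \<Rightarrow> ('i \<Rightarrow> 'y) hilbert" where
  "ell2 Y = \<lparr>carrier = {f. (\<forall>i. f i \<in> carrier Y) \<and> (\<lambda>i. (hnorm Y (f i))\<^sup>2) summable_on UNIV},
     cinner = (\<lambda>f g. \<Sum>\<^sub>\<infinity>i. cinner Y (f i) (g i))\<rparr>"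

lemma H2_eq_ell2: "H2 Y = ell2 Y"
  by (simp add: H2_def ell2_def)

lemma hpow_eq_ell2: "hpow Y = (ell2 Y :: ('d::finite \<Rightarrow> 'y) hilbert)"
  by (simp add: hpow_def ell2_def)

context
  fixes Y :: "'y::complex_vector hilbert"
  assumes Y: "hilbert_space Y"
begin

interpretation Y: hilbert_space Y by (rule Y)

lemma ell2_component: "f \<in> carrier (ell2 Y) \<Longrightarrow> f i \<in> carrier Y"
  by (simp add: ell2_def)

lemma ell2_summable: "f \<in> carrier (ell2 Y) \<Longrightarrow> (\<lambda>i. (hnorm Y (f i))\<^sup>2) summable_on A"
  by (auto simp: ell2_def intro: summable_on_subset_banach)

lemma ell2_summable_cinner:
  assumes f: "f \<in> carrier (ell2 Y)" and g: "g \<in> carrier (ell2 Y)"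
  shows "(\<lambda>i. cinner Y (f i) (g i)) summable_on A"
proof -
  have "(\<lambda>i. (hnorm Y (f i))\<^sup>2 + (hnorm Y (g i))\<^sup>2) summable_on A"
    by (intro summable_on_add ell2_summable f g)
  moreover have "norm (cinner Y (f i) (g i)) \<le> (hnorm Y (f i))\<^sup>2 + (hnorm Y (g i))\<^sup>2" for i
  proof -
    have "2 * (hnorm Y (f i) * hnorm Y (g i)) \<le> (hnorm Y (f i))\<^sup>2 + (hnorm Y (g i))\<^sup>2"
      using sum_squares_bound[of "hnorm Y (f i)" "hnorm Y (g i)"] by simp
    moreover have "0 \<le> hnorm Y (f i) * hnorm Y (g i)"
      using f g by (simp add: ell2_component Y.hnorm_nonneg)
    ultimately show ?thesis
      using Y.cauchy_schwarz[of "f i" "g i"] f g by (simp add: ell2_component)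
  qed
  ultimately have "(\<lambda>i. norm (cinner Y (f i) (g i))) summable_on A"
    by (rule summable_on_comparison_test) auto
  then show ?thesis by (rule abs_summable_summable)
qed

lemma ell2_cinner_has_sum:
  assumes "f \<in> carrier (ell2 Y)" and "g \<in> carrier (ell2 Y)"
  shows "((\<lambda>i. cinner Y (f i) (g i)) has_sum cinner (ell2 Y) f g) UNIV"
  using ell2_summable_cinner[OF assms, of UNIV] by (simp add: ell2_def)

lemma ell2_cinner_eqI:
  assumes "((\<lambda>i. cinner Y (f i) (g i)) has_sum c) UNIV"
  shows "cinner (ell2 Y) f g = c"
  using assms by (simp add: ell2_def infsumI)

lemma ell2_cinner_self_has_sum:
  assumes f: "f \<in> carrier (ell2 Y)"
  shows "((\<lambda>i. (hnorm Y (f i))\<^sup>2) has_sum Re (cinner (ell2 Y) f f)) UNIV"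
  using has_sum_Re[OF ell2_cinner_has_sum[OF f f]] f by (simp add: Y.hnorm_sq ell2_component)

lemma ell2_cinner_self_nonneg: "f \<in> carrier (ell2 Y) \<Longrightarrow> Re (cinner (ell2 Y) f f) \<ge> 0"
  by (rule has_sum_nonneg[OF ell2_cinner_self_has_sum]) auto

lemma ell2_hnorm_nonneg: "f \<in> carrier (ell2 Y) \<Longrightarrow> hnorm (ell2 Y) f \<ge> 0"
  by (simp add: hnorm_def ell2_cinner_self_nonneg)

lemma ell2_hnorm_has_sum:
  assumes f: "f \<in> carrier (ell2 Y)"
  shows "((\<lambda>i. (hnorm Y (f i))\<^sup>2) has_sum (hnorm (ell2 Y) f)\<^sup>2) UNIV"
  using ell2_cinner_self_has_sum[OF f] ell2_cinner_self_nonneg[OF f] by (simp add: hnorm_def)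

lemma ell2_add_closed:
  assumes f: "f \<in> carrier (ell2 Y)" and g: "g \<in> carrier (ell2 Y)"
  shows "f + g \<in> carrier (ell2 Y)"
proof -
  have "(\<lambda>i. 2 * (hnorm Y (f i))\<^sup>2 + 2 * (hnorm Y (g i))\<^sup>2) summable_on UNIV"
    by (intro summable_on_add summable_on_cmult_right ell2_summable f g)
  then have "(\<lambda>i. (hnorm Y (f i + g i))\<^sup>2) summable_on UNIV"
    by (rule summable_on_comparison_test)
      (use f g in \<open>auto intro: Y.hnorm_add_sq_le simp: ell2_component\<close>)
  then show ?thesis using f g by (simp add: ell2_def Y.closed)
qed

lemma ell2_scaleC_closed:
  assumes f: "f \<in> carrier (ell2 Y)"
  shows "a *\<^sub>C f \<in> carrier (ell2 Y)"
proof -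
  have "(\<lambda>i. (cmod a)\<^sup>2 * (hnorm Y (f i))\<^sup>2) summable_on UNIV"
    by (intro summable_on_cmult_right ell2_summable f)
  then have "(\<lambda>i. (hnorm Y (a *\<^sub>C f i))\<^sup>2) summable_on UNIV"
    using f by (simp add: Y.hnorm_scaleC ell2_component power_mult_distrib)
  then show ?thesis using f by (simp add: ell2_def Y.closed)
qed

lemma ell2_diff_closed:
  "\<lbrakk>f \<in> carrier (ell2 Y); g \<in> carrier (ell2 Y)\<rbrakk> \<Longrightarrow> f - g \<in> carrier (ell2 Y)"
  using ell2_add_closed[of f "(- 1) *\<^sub>C g"] ell2_scaleC_closed[of g "- 1"] by simp

lemma ell2_component_le:
  assumes f: "f \<in> carrier (ell2 Y)"
  shows "hnorm Y (f i) \<le> hnorm (ell2 Y) f"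
proof -
  have "(\<Sum>j\<in>{i}. (hnorm Y (f j))\<^sup>2) \<le> (hnorm (ell2 Y) f)\<^sup>2"
    by (rule finite_sum_le_has_sum[OF ell2_hnorm_has_sum[OF f]]) auto
  then have "(hnorm Y (f i))\<^sup>2 \<le> (hnorm (ell2 Y) f)\<^sup>2" by simp
  then show ?thesis
    by (rule power2_le_imp_le) (rule ell2_hnorm_nonneg[OF f])
qed

lemma ell2_complete:
  fixes X :: "nat \<Rightarrow> 'i \<Rightarrow> 'y"
  assumes X: "\<And>n. X n \<in> carrier (ell2 Y)"
    and cauchy: "\<forall>e>0. \<exists>N. \<forall>m\<ge>N. \<forall>n\<ge>N. hnorm (ell2 Y) (X m - X n) < e"
  shows "\<exists>x\<in>carrier (ell2 Y). (\<lambda>n. hnorm (ell2 Y) (X n - x)) \<longlonglongrightarrow> 0"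
proof -
  note Xc = ell2_component[OF X]
  have le: "hnorm Y (X m i - X n i) \<le> hnorm (ell2 Y) (X m - X n)" for m n i
    using ell2_component_le[OF ell2_diff_closed[OF X X], of m n i] by simp
  have "\<exists>y\<in>carrier Y. (\<lambda>n. hnorm Y (X n i - y)) \<longlonglongrightarrow> 0" for i
    using Y.complete[of "\<lambda>n. X n i"] Xc cauchy le by (meson le_less_trans)
  then obtain x where x: "\<And>i. x i \<in> carrier Y" and lim: "\<And>i. (\<lambda>n. hnorm Y (X n i - x i)) \<longlonglongrightarrow> 0"
    by metis
  \<comment> \<open>Finite partial sums pass to the coordinatewise limit, and the bound on them is uniform.\<close>
  have tail: "\<exists>N. \<forall>m\<ge>N. X m - x \<in> carrier (ell2 Y) \<and> hnorm (ell2 Y) (X m - x) \<le> e" if e: "e > 0" for e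
  proof -
    obtain N where N: "\<And>m n. \<lbrakk>m \<ge> N; n \<ge> N\<rbrakk> \<Longrightarrow> hnorm (ell2 Y) (X m - X n) < e"
      using cauchy e by meson
    have "X m - x \<in> carrier (ell2 Y) \<and> hnorm (ell2 Y) (X m - x) \<le> e" if m: "m \<ge> N" for m
    proof -
      have fin: "(\<Sum>i\<in>F. (hnorm Y (X m i - x i))\<^sup>2) \<le> e\<^sup>2" if F: "finite F" for F
      proof -
        have "(\<Sum>i\<in>F. (hnorm Y (X m i - X n i))\<^sup>2) \<le> e\<^sup>2" if n: "n \<ge> N" for n
        proof -
          have "(\<Sum>i\<in>F. (hnorm Y ((X m - X n) i))\<^sup>2) \<le> (hnorm (ell2 Y) (X m - X n))\<^sup>2"
            using F by (intro finite_sum_le_has_sum[OF ell2_hnorm_has_sum] ell2_diff_closed X) auto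
          also have "\<dots> \<le> e\<^sup>2"
            using N[OF m n] ell2_hnorm_nonneg[OF ell2_diff_closed[OF X X], of m n]
            by (intro power_mono) auto
          finally show ?thesis by simp
        qed
        moreover have "(\<lambda>n. hnorm Y (X m i - X n i)) \<longlonglongrightarrow> hnorm Y (X m i - x i)" for i
        proof (rule Y.tendsto_hnorm)
          have "hnorm Y (X m i - X n i - (X m i - x i)) = hnorm Y (X n i - x i)" for n
            using Y.hnorm_diff_commute[OF Xc x, of n i] by simp
          then show "(\<lambda>n. hnorm Y (X m i - X n i - (X m i - x i))) \<longlonglongrightarrow> 0" using lim by simp
        qed (auto intro: Y.diff_closed Xc x)
        then have "(\<lambda>n. \<Sum>i\<in>F. (hnorm Y (X m i - X n i))\<^sup>2)
            \<longlonglongrightarrow> (\<Sum>i\<in>F. (hnorm Y (X m i - x i))\<^sup>2)"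
          by (intro tendsto_sum tendsto_power)
        ultimately show ?thesis by (intro LIMSEQ_le_const2) blast+
      qed
      have "(\<lambda>i. (hnorm Y ((X m - x) i))\<^sup>2) summable_on UNIV"
        using fin by (intro nonneg_bdd_above_summable_on) (auto intro!: bdd_aboveI[of _ "e\<^sup>2"])
      then have mem: "X m - x \<in> carrier (ell2 Y)"
        by (simp add: ell2_def Y.diff_closed Xc x)
      have "(hnorm (ell2 Y) (X m - x))\<^sup>2 \<le> e\<^sup>2"
        by (rule has_sum_le_finite_sums[OF ell2_hnorm_has_sum[OF mem]]) (simp add: fin)
      then show ?thesis using mem e power2_le_imp_le[of _ e] by simp
    qed
    then show ?thesis by blast
  qed
  obtain m where "X m - x \<in> carrier (ell2 Y)" using tail[of 1] by auto
  then have "x \<in> carrier (ell2 Y)" using ell2_diff_closed[OF X, of "X m - x" m] by simp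
  moreover have "(\<lambda>n. hnorm (ell2 Y) (X n - x)) \<longlonglongrightarrow> 0"
  proof (rule LIMSEQ_I)
    fix r :: real assume "r > 0"
    then obtain N where N: "\<And>m. m \<ge> N \<Longrightarrow> X m - x \<in> carrier (ell2 Y) \<and> hnorm (ell2 Y) (X m - x) \<le> r / 2"
      using tail[of "r / 2"] by auto
    have "norm (hnorm (ell2 Y) (X m - x) - 0) < r" if "m \<ge> N" for m
      using N[OF that] ell2_hnorm_nonneg[of "X m - x"] \<open>r > 0\<close> by auto
    then show "\<exists>N. \<forall>m\<ge>N. norm (hnorm (ell2 Y) (X m - x) - 0) < r" by blast
  qed
  ultimately show ?thesis by blast
qed

lemma hilbert_space_ell2: "hilbert_space (ell2 Y :: ('i \<Rightarrow> 'y) hilbert)"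
proof
  show "0 \<in> carrier (ell2 Y)" by (simp add: ell2_def Y.zero_closed)
  fix f g h :: "'i \<Rightarrow> 'y" and a
  assume f: "f \<in> carrier (ell2 Y)"
  show "a *\<^sub>C f \<in> carrier (ell2 Y)" by (rule ell2_scaleC_closed[OF f])
  show "Re (cinner (ell2 Y) f f) > 0" if nz: "f \<noteq> 0"
  proof -
    obtain i where i: "f i \<noteq> 0" using nz by (auto simp: fun_eq_iff)
    have "0 < Re (cinner Y (f i) (f i))" using i f by (intro Y.cinner_pos ell2_component)
    also have "\<dots> = (\<Sum>j\<in>{i}. (hnorm Y (f j))\<^sup>2)" using f by (simp add: Y.hnorm_sq ell2_component)
    also have "\<dots> \<le> Re (cinner (ell2 Y) f f)"
      by (rule finite_sum_le_has_sum[OF ell2_cinner_self_has_sum[OF f]]) auto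
    finally show ?thesis .
  qed
  assume g: "g \<in> carrier (ell2 Y)"
  show "f + g \<in> carrier (ell2 Y)" by (rule ell2_add_closed[OF f g])
  show "cinner (ell2 Y) (a *\<^sub>C f) g = a * cinner (ell2 Y) f g"
    using has_sum_cmult_right[OF ell2_cinner_has_sum[OF f g], of a] f g
    by (intro ell2_cinner_eqI) (simp add: Y.cinner_simps ell2_component)
  have "((\<lambda>i. cinner Y (f i) (g i)) has_sum cnj (cinner (ell2 Y) g f)) UNIV"
    using ell2_cinner_has_sum[OF g f] Y.cinner_commute[OF ell2_component[OF f] ell2_component[OF g]]
    by (simp add: has_sum_cnj_iff)
  then show "cinner (ell2 Y) f g = cnj (cinner (ell2 Y) g f)"
    by (rule ell2_cinner_eqI)
  assume h: "h \<in> carrier (ell2 Y)"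
  show "cinner (ell2 Y) (f + g) h = cinner (ell2 Y) f h + cinner (ell2 Y) g h"
    using has_sum_add[OF ell2_cinner_has_sum[OF f h] ell2_cinner_has_sum[OF g h]] f g h
    by (intro ell2_cinner_eqI) (simp add: Y.cinner_simps ell2_component)
qed (rule ell2_complete)

end

section \<open>Positive contractions and their range spaces\<close>

locale positive_contraction = hilbert_space G
  for G :: "'a::complex_vector hilbert" and P :: "'a \<Rightarrow> 'a" +
  assumes P_closed: "x \<in> carrier G \<Longrightarrow> P x \<in> carrier G"
    and P_add: "\<lbrakk>x \<in> carrier G; y \<in> carrier G\<rbrakk> \<Longrightarrow> P (x + y) = P x + P y"
    and P_scaleC: "x \<in> carrier G \<Longrightarrow> P (a *\<^sub>C x) = a *\<^sub>C P x"
    and P_symmetric: "\<lbrakk>x \<in> carrier G; y \<in> carrier G\<rbrakk> \<Longrightarrow> cinner G (P x) y = cinner G x (P y)"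
    and P_nonneg: "x \<in> carrier G \<Longrightarrow> 0 \<le> Re (cinner G (P x) x)"
    and P_le: "x \<in> carrier G \<Longrightarrow> Re (cinner G (P x) x) \<le> Re (cinner G x x)"
begin

lemma P_diff: "\<lbrakk>x \<in> carrier G; y \<in> carrier G\<rbrakk> \<Longrightarrow> P (x - y) = P x - P y"
  using P_add[of x "(- 1) *\<^sub>C y"] P_scaleC[of y "- 1"] by (simp add: closed)

lemma hnorm_P_sq_le:
  assumes x: "x \<in> carrier G"
  shows "(hnorm G (P x))\<^sup>2 \<le> Re (cinner G (P x) x)"
proof -
  have "0 \<le> Re (cinner G (P (x - P x)) (x - P x))"
    by (intro P_nonneg closed P_closed x)
  also have "\<dots> = Re (cinner G (P x) x) - 2 * Re (cinner G (P x) (P x)) + Re (cinner G (P (P x)) (P x))"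
    using x P_closed[OF x] P_closed[OF P_closed[OF x]]
    by (simp add: P_diff cinner_simps P_symmetric[OF P_closed[OF x] x])
  finally have "0 \<le> Re (cinner G (P x) x) - 2 * Re (cinner G (P x) (P x))
      + Re (cinner G (P (P x)) (P x))" .
  then show ?thesis using P_le[OF P_closed[OF x]] P_closed[OF x] by (simp add: hnorm_sq)
qed

text \<open>On numbers in the unit interval, \<open>t - t\<^sup>2\<close> again lies between 0 and \<open>t\<close>. For operators,
  \<open>P - P\<^sup>2 = P (I - P) P + (I - P) P (I - P)\<close> is positive; this is \<open>hnorm_P_sq_le\<close>.\<close>

lemma positive_contraction_diff_square: "positive_contraction G (\<lambda>x. P x - P (P x))"
proof
  fix x y a assume x: "x \<in> carrier G"
  note c = P_closed[OF x] P_closed[OF P_closed[OF x]]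
  show "P x - P (P x) \<in> carrier G" using c by (intro closed)
  show "P (a *\<^sub>C x) - P (P (a *\<^sub>C x)) = a *\<^sub>C (P x - P (P x))"
    using x c by (simp add: P_scaleC scaleC_diff_right)
  have eq: "Re (cinner G (P x - P (P x)) x) = Re (cinner G (P x) x) - (hnorm G (P x))\<^sup>2"
    using x c by (simp add: cinner_simps hnorm_sq P_symmetric[OF c(1) x])
  show "0 \<le> Re (cinner G (P x - P (P x)) x)" using eq hnorm_P_sq_le[OF x] by simp
  show "Re (cinner G (P x - P (P x)) x) \<le> Re (cinner G x x)"
    using eq P_le[OF x] zero_le_power2[of "hnorm G (P x)"] by linarith
  assume y: "y \<in> carrier G"
  show "P (x + y) - P (P (x + y)) = P x - P (P x) + (P y - P (P y))"
    using x y c P_closed[OF y] by (simp add: P_add)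
  show "cinner G (P x - P (P x)) y = cinner G x (P y - P (P y))"
    using x y c P_closed[OF y] P_closed[OF P_closed[OF y]]
    by (simp add: cinner_simps P_symmetric)
qed

end

primrec residual :: "('a::complex_vector \<Rightarrow> 'a) \<Rightarrow> nat \<Rightarrow> 'a \<Rightarrow> 'a" where
  "residual P 0 = P"
| "residual P (Suc n) = (\<lambda>x. residual P n x - residual P n (residual P n x))"

context positive_contraction
begin

lemma positive_contraction_residual: "positive_contraction G (residual P n)"
proof (induction n)
  case 0
  then show ?case using positive_contraction_axioms by simp
next
  case (Suc n)
  then show ?case using positive_contraction.positive_contraction_diff_square by fastforce
qed

lemmas residual_closed = positive_contraction.P_closed[OF positive_contraction_residual]

text \<open>The telescoping sum behind the factorization: consecutive residuals differ by a square.\<close>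

lemma sum_residual:
  assumes x: "x \<in> carrier G" and y: "y \<in> carrier G"
  shows "(\<Sum>k<n. cinner G (residual P k x) (residual P k y)) = cinner G (P x) y - cinner G (residual P n x) y"
proof (induction n)
  case (Suc n)
  have "cinner G (residual P (Suc n) x) y =
      cinner G (residual P n x) y - cinner G (residual P n x) (residual P n y)"
    using x y residual_closed[of x n] residual_closed[of "residual P n x" n]
    by (simp add: cinner_simps positive_contraction.P_symmetric[OF positive_contraction_residual])
  then show ?case using Suc by simp
qed simp

definition root_map :: "'a \<Rightarrow> nat \<Rightarrow> 'a" where
  "root_map x = (\<lambda>n. residual P n x)"

lemma root_map_closed:
  assumes x: "x \<in> carrier G"
  shows "root_map x \<in> carrier (ell2 G)"
proof -
  have "(\<Sum>k<n. (hnorm G (residual P k x))\<^sup>2) \<le> Re (cinner G (P x) x)" for n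
  proof -
    have "(\<Sum>k<n. (hnorm G (residual P k x))\<^sup>2)
        = Re (\<Sum>k<n. cinner G (residual P k x) (residual P k x))"
      using x by (simp add: hnorm_sq residual_closed)
    then show ?thesis
      using x positive_contraction.P_nonneg[OF positive_contraction_residual x, of n]
      by (simp add: sum_residual)
  qed
  then have "summable (\<lambda>k. (hnorm G (residual P k x))\<^sup>2)"
    by (intro summableI_nonneg_bounded) auto
  then have "(\<lambda>k. (hnorm G (residual P k x))\<^sup>2) summable_on UNIV"
    by (subst summable_on_UNIV_nonneg_real_iff) auto
  then show ?thesis
    using x by (simp add: ell2_def root_map_def residual_closed)
qed

text \<open>The residuals tend to 0 strongly, since the sum of \<open>\<parallel>P\<^sub>n x\<parallel>\<^sup>2\<close> is bounded by
  \<open>\<langle>P x, x\<rangle>\<close>. Hence the telescoping sum converges to the form of \<open>P\<close>, and \<open>root_map\<close> does the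
  work of a square root of \<open>P\<close>.\<close>

lemma cinner_root_map:
  assumes x: "x \<in> carrier G" and y: "y \<in> carrier G"
  shows "cinner (ell2 G) (root_map x) (root_map y) = cinner G (P x) y"
proof (rule LIMSEQ_unique)
  note G = hilbert_space_axioms
  show "(\<lambda>n. \<Sum>k<n. cinner G (residual P k x) (residual P k y))
      \<longlonglongrightarrow> cinner (ell2 G) (root_map x) (root_map y)"
    using has_sum_imp_sums[OF ell2_cinner_has_sum[OF G root_map_closed[OF x] root_map_closed[OF y]]]
    by (simp add: root_map_def sums_def)
  have "(\<lambda>n. (hnorm G (residual P n x))\<^sup>2) \<longlonglongrightarrow> 0"
    using has_sum_imp_sums[OF ell2_hnorm_has_sum[OF G root_map_closed[OF x]]]
    by (intro summable_LIMSEQ_zero sums_summable) (simp add: root_map_def)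
  then have "(\<lambda>n. sqrt ((hnorm G (residual P n x))\<^sup>2)) \<longlonglongrightarrow> sqrt 0"
    by (rule tendsto_real_sqrt)
  then have "(\<lambda>n. hnorm G (residual P n x)) \<longlonglongrightarrow> 0"
    using x by (simp add: hnorm_nonneg residual_closed)
  then have "(\<lambda>n. hnorm G (residual P n x) * hnorm G y) \<longlonglongrightarrow> 0"
    by (rule tendsto_mult_left_zero)
  then have "(\<lambda>n. cinner G (residual P n x) y) \<longlonglongrightarrow> 0"
    by (rule Lim_null_comparison[rotated])
      (use x y in \<open>auto intro!: always_eventually cauchy_schwarz residual_closed\<close>)
  then show "(\<lambda>n. \<Sum>k<n. cinner G (residual P k x) (residual P k y)) \<longlonglongrightarrow> cinner G (P x) y"
    using tendsto_diff[OF tendsto_const[of "cinner G (P x) y"]] x y by (fastforce simp: sum_residual)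
qed

lemma bounded_op_root_map: "bounded_op G (ell2 G) root_map"
proof (rule bounded_opI[where M = 1])
  fix x y a assume x: "x \<in> carrier G"
  show "root_map x \<in> carrier (ell2 G)" by (rule root_map_closed[OF x])
  show "root_map (a *\<^sub>C x) = a *\<^sub>C root_map x"
    using x by (simp add: root_map_def fun_eq_iff
        positive_contraction.P_scaleC[OF positive_contraction_residual])
  show "hnorm (ell2 G) (root_map x) \<le> 1 * hnorm G x"
    using x P_le[OF x] by (simp add: hnorm_def cinner_root_map)
  assume y: "y \<in> carrier G"
  show "root_map (x + y) = root_map x + root_map y"
    using x y by (simp add: root_map_def fun_eq_iff
        positive_contraction.P_add[OF positive_contraction_residual])
qed

end

text \<open>The Hilbert space of the range of a square root of \<open>P\<close> with the quotient norm, described by its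
  reproducing property; the last axiom is the normalization that makes the record unique.\<close>

locale operator_range = positive_contraction G P + H: hilbert_space H
  for G :: "'a::complex_vector hilbert" and P and H :: "'a hilbert" +
  assumes sub: "carrier H \<subseteq> carrier G"
    and P_mem: "x \<in> carrier G \<Longrightarrow> P x \<in> carrier H"
    and reproducing: "\<lbrakk>f \<in> carrier H; x \<in> carrier G\<rbrakk> \<Longrightarrow> cinner H f (P x) = cinner G f x"
    and cinner_off: "f \<notin> carrier H \<or> g \<notin> carrier H \<Longrightarrow> cinner H f g = 0"

text \<open>Let \<open>R\<close> be the adjoint of \<open>root_map\<close>, so that \<open>P = R \<circ> root_map\<close>. The orthogonal complement \<open>N\<close> of the
  kernel of \<open>R\<close> contains every \<open>root_map x\<close>, and \<open>R\<close> is injective on it; transporting \<open>N\<close> along \<open>R\<close>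
  gives the space, and the reproducing property is the adjoint relation.\<close>

lemma (in positive_contraction) operator_range_exists: "\<exists>H. operator_range G P H"
proof -
  define X where "X = (ell2 G :: (nat \<Rightarrow> 'a) hilbert)"
  define R where "R = hadj G X root_map"
  note G = hilbert_space_axioms
  have X: "hilbert_space X" unfolding X_def by (rule hilbert_space_ell2[OF G])
  interpret X: hilbert_space X by (rule X)
  have J: "bounded_op G X root_map" unfolding X_def by (rule bounded_op_root_map)
  have Rb: "bounded_op X G R" unfolding R_def by (rule bounded_op_hadj[OF G X J])
  note Jc = bounded_op_closed[OF J] and Rc = bounded_op_closed[OF Rb]
  define B where "B = {b \<in> carrier X. R b = 0}"
  define N where "N = \<lparr>carrier = {a \<in> carrier X. \<forall>b\<in>B. cinner X b a = 0}, cinner = cinner X\<rparr>"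
  have N: "hilbert_space N"
    unfolding N_def by (rule hilbert_space_orthogonal_complement[OF X]) (auto simp: B_def)
  interpret N: hilbert_space N by (rule N)
  have NX: "a \<in> carrier X" if "a \<in> carrier N" for a using that by (simp add: N_def)
  have JN: "root_map x \<in> carrier N" if x: "x \<in> carrier G" for x
    using x Jc[OF x] cinner_hadj_left[OF G X J x] unfolding N_def B_def R_def by fastforce
  have RJ: "R (root_map x) = P x" if x: "x \<in> carrier G" for x
    unfolding R_def
    by (rule hadj_eqI[OF G P_closed[OF x]])
      (use x in \<open>simp add: X_def cinner_root_map P_symmetric\<close>)
  have inj: "inj_on R (carrier N)"
  proof (rule inj_onI)
    fix a b assume ab: "a \<in> carrier N" "b \<in> carrier N" "R a = R b"
    have d: "a - b \<in> carrier N" using ab by (intro N.closed)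
    have "R (a - b) = 0" using ab by (simp add: bounded_op_diff[OF Rb X] NX)
    then have "cinner X (a - b) (a - b) = 0" using d by (simp add: N_def B_def)
    then show "a = b" using X.cinner_pos[of "a - b"] NX[OF d] by fastforce
  qed
  define H where "H = transported_space N R"
  have cH: "carrier H = R ` carrier N" by (simp add: H_def)
  have iH: "cinner H (R a) (R b) = cinner X a b" if "a \<in> carrier N" "b \<in> carrier N" for a b
    unfolding H_def cinner_transported[OF inj that] by (simp add: N_def)
  have H: "hilbert_space H"
    unfolding H_def using N inj
    by (rule hilbert_space_transported)
      (auto simp: bounded_op_add[OF Rb] bounded_op_scaleC[OF Rb] NX)
  have "operator_range G P H"
  proof (intro operator_range.intro positive_contraction_axioms H operator_range_axioms.intro)
    show "carrier H \<subseteq> carrier G" using cH NX Rc by auto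
    show "P x \<in> carrier H" if "x \<in> carrier G" for x
      using that JN RJ unfolding cH by force
    show "cinner H f (P x) = cinner G f x" if f: "f \<in> carrier H" and x: "x \<in> carrier G" for f x
    proof -
      obtain a where a: "a \<in> carrier N" "f = R a" using f unfolding cH by blast
      have "cinner H f (P x) = cinner X a (root_map x)"
        using iH[OF a(1) JN[OF x]] RJ[OF x] a by simp
      also have "\<dots> = cinner G f x"
        unfolding a(2) R_def using cinner_hadj_left[OF G X J x NX[OF a(1)]] by simp
      finally show ?thesis .
    qed
    show "cinner H f g = 0" if "f \<notin> carrier H \<or> g \<notin> carrier H" for f g
      using that unfolding H_def carrier_transported by (rule cinner_transported_off)
  qed
  then show ?thesis by blast
qed

context operator_range
begin

lemma hnorm_P: "x \<in> carrier G \<Longrightarrow> hnorm H (P x) = sqrt (Re (cinner G (P x) x))"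
  by (simp add: hnorm_def reproducing P_mem)

lemma cmod_cinner_le:
  "\<lbrakk>f \<in> carrier H; x \<in> carrier G\<rbrakk> \<Longrightarrow> cmod (cinner G f x) \<le> hnorm H f * sqrt (Re (cinner G (P x) x))"
  using H.cauchy_schwarz[of f "P x"] by (simp add: reproducing P_mem hnorm_P)

text \<open>The converse of \<open>cmod_cinner_le\<close>. The estimate makes \<open>P x \<mapsto> \<langle>x, f\<rangle>\<close> a well-defined bounded
  functional on the subspace \<open>P ` carrier G\<close>; its Riesz representative in \<open>H\<close> has the same inner
  products with all \<open>x\<close> as \<open>f\<close>, hence equals \<open>f\<close>.\<close>

lemma memI:
  assumes f: "f \<in> carrier G" and C: "C \<ge> 0"
    and bound: "\<And>x. x \<in> carrier G \<Longrightarrow> cmod (cinner G f x) \<le> C * sqrt (Re (cinner G (P x) x))"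
  shows "f \<in> carrier H \<and> hnorm H f \<le> C"
proof -
  define \<phi> where "\<phi> e = cinner G (inv_into (carrier G) P e) f" for e
  have \<phi>: "\<phi> (P x) = cinner G x f" if x: "x \<in> carrier G" for x
  proof -
    define x' where "x' = inv_into (carrier G) P (P x)"
    have x': "x' \<in> carrier G" "P x' = P x"
      unfolding x'_def using x by (auto intro: inv_into_into f_inv_into_f)
    have d: "x' - x \<in> carrier G" using x x' by (intro closed)
    have "cmod (cinner G f (x' - x)) \<le> 0"
      using bound[OF d] x x' d by (simp add: P_diff)
    then have "cinner G (x' - x) f = 0" using cinner_commute[OF d f] by simp
    then show ?thesis using x x' f by (simp add: \<phi>_def x'_def cinner_diff_left)
  qed
  obtain a where a: "a \<in> carrier H" "\<And>e. e \<in> P ` carrier G \<Longrightarrow> \<phi> e = cinner H e a" "hnorm H a \<le> C"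
  proof (rule H.riesz_subspace[of "P ` carrier G" \<phi> C])
    show "P ` carrier G \<subseteq> carrier H" using P_mem by blast
    show "0 \<in> P ` carrier G" using P_diff[of 0 0] zero_closed by force
    show "x + y \<in> P ` carrier G" if "x \<in> P ` carrier G" "y \<in> P ` carrier G" for x y
      using that by (auto simp flip: P_add intro: closed)
    show "b *\<^sub>C x \<in> P ` carrier G" if "x \<in> P ` carrier G" for b x
      using that by (auto simp flip: P_scaleC intro: closed)
    show "\<phi> (x + y) = \<phi> x + \<phi> y" if "x \<in> P ` carrier G" "y \<in> P ` carrier G" for x y
      using that f by (auto simp: \<phi> cinner_simps simp flip: P_add)
    show "\<phi> (b *\<^sub>C x) = b * \<phi> x" if "x \<in> P ` carrier G" for b x
      using that f by (auto simp: \<phi> cinner_simps simp flip: P_scaleC)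
    show "cmod (\<phi> x) \<le> C * hnorm H x" if x: "x \<in> P ` carrier G" for x
    proof -
      obtain y where y: "y \<in> carrier G" "x = P y" using x by blast
      have "cmod (cinner G y f) = cmod (cinner G f y)"
        using cinner_commute[OF y(1) f] by simp
      then show ?thesis using bound[OF y(1)] y by (simp add: \<phi> hnorm_P)
    qed
  qed (use C in auto)
  have "f = a"
  proof (rule cinner_ext[OF f])
    show aG: "a \<in> carrier G" using a sub by blast
    fix x assume x: "x \<in> carrier G"
    have "cinner G x f = cinner H (P x) a" using a(2)[of "P x"] \<phi>[OF x] x by simp
    also have "\<dots> = cnj (cinner H a (P x))" using H.cinner_commute P_mem x a(1) by blast
    also have "\<dots> = cinner G x a"
      using reproducing[OF a(1) x] cinner_commute[OF x aG] by simp
    finally show "cinner G x f = cinner G x a" .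
  qed
  then show ?thesis using a by simp
qed

text \<open>Totality of the vectors \<open>P x\<close>: by the reproducing property, orthogonality to all of them in \<open>H\<close> is
  orthogonality to every \<open>x\<close> in \<open>G\<close>, and \<open>f\<close> itself is one of these.\<close>

lemma eq_zeroI:
  assumes f: "f \<in> carrier H" and "\<And>x. x \<in> carrier G \<Longrightarrow> cinner H f (P x) = 0"
  shows "f = 0"
proof -
  have "cinner H f f = 0"
  proof -
    have "cinner G f f = 0" using assms sub by (auto simp: reproducing)
    then show ?thesis using cinner_pos[of f] f sub by fastforce
  qed
  then show ?thesis using H.cinner_pos[OF f] by fastforce
qed

end

section \<open>The Fock space \<open>H2\<close> and its shifts\<close>

definition backward_shift :: "'d \<Rightarrow> ('d, 'a) nc_series \<Rightarrow> ('d, 'a) nc_series" where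
  "backward_shift j f = (\<lambda>v. f (j # v))"

definition monomial :: "'d list \<Rightarrow> 'a::zero \<Rightarrow> ('d, 'a) nc_series" where
  "monomial w y = (\<lambda>v. if v = w then y else 0)"

lemma const_series_eq_monomial: "const_series y = monomial [] y"
  by (simp add: const_series_def monomial_def fun_eq_iff)

lemma reflect_reflect [simp]: "reflect (reflect f) = f"
  by (simp add: reflect_def fun_eq_iff)

lemma reflect_linear [simp]:
  "reflect (f + g) = reflect f + reflect g"
  "reflect (f - g) = reflect f - reflect g"
  "reflect (a *\<^sub>C h) = a *\<^sub>C reflect h"
  for f g :: "'d list \<Rightarrow> 'a::ab_group_add" and h :: "'d list \<Rightarrow> 'b::complex_vector"
  by (simp_all add: reflect_def fun_eq_iff)

lemma reflect_monomial [simp]: "reflect (monomial w y) = monomial (rev w) y"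
  by (auto simp: reflect_def monomial_def fun_eq_iff)

lemma backward_shift_linear [simp]:
  "backward_shift j (f + g) = backward_shift j f + backward_shift j g"
  "backward_shift j (f - g) = backward_shift j f - backward_shift j g"
  "backward_shift j (a *\<^sub>C h) = a *\<^sub>C backward_shift j h"
  for f g :: "'d list \<Rightarrow> 'a::ab_group_add" and h :: "'d list \<Rightarrow> 'b::complex_vector"
  by (simp_all add: backward_shift_def fun_eq_iff)

lemma backward_shift_left_shift [simp]:
  "backward_shift i (left_shift j f) = (if i = j then f else 0)"
  by (auto simp: backward_shift_def left_shift_def fun_eq_iff)

lemma left_shift_Nil [simp]: "left_shift j f [] = 0"
  by (simp add: left_shift_def)

lemma backward_shift_const [simp]: "backward_shift i (monomial [] y) = 0"
  by (auto simp: backward_shift_def monomial_def fun_eq_iff)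

lemma monomial_Nil_Nil [simp]: "monomial [] y [] = y"
  by (simp add: monomial_def)

lemma nc_series_eqI:
  assumes "f [] = g []" "\<And>j. backward_shift j f = backward_shift j g"
  shows "f = g"
proof
  fix v
  show "f v = g v"
    using assms(1) fun_cong[OF assms(2)] by (cases v) (auto simp: backward_shift_def)
qed

lemma reflect_right_shift: "reflect (right_shift j f) = left_shift j (reflect f)"
proof
  fix v
  show "reflect (right_shift j f) v = left_shift j (reflect f) v"
    by (cases v) (auto simp: reflect_def right_shift_def left_shift_def)
qed

lemma has_sum_Cons:
  fixes g :: "'d::finite list \<Rightarrow> 'c::{topological_comm_monoid_add, t3_space}"
  assumes "\<And>j. ((\<lambda>v. g (j # v)) has_sum c j) UNIV"
  shows "(g has_sum (g [] + (\<Sum>j\<in>UNIV. c j))) UNIV"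
proof -
  have part: "(g has_sum c j) (range ((#) j))" for j
    using has_sum_reindex[of "(#) j" UNIV g "c j"] assms[of j] by (simp add: o_def)
  have "(g has_sum (\<Sum>j\<in>F. c j)) (\<Union>j\<in>F. range ((#) j))" if "finite F" for F
    using that
  proof (induction F)
    case (insert j F)
    have "(g has_sum (c j + (\<Sum>j\<in>F. c j))) (range ((#) j) \<union> (\<Union>j\<in>F. range ((#) j)))"
      using insert by (intro has_sum_Un_disjoint part) auto
    then show ?case using insert by simp
  qed simp
  from this[of UNIV] have "(g has_sum (\<Sum>j\<in>UNIV. c j)) (\<Union>j. range ((#) j))" by simp
  moreover have "(g has_sum g []) {[]}" using has_sum_finite[of "{[]}" g] by simp
  ultimately have "(g has_sum (g [] + (\<Sum>j\<in>UNIV. c j))) ({[]} \<union> (\<Union>j. range ((#) j)))"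
    by (intro has_sum_Un_disjoint) auto
  moreover have "{[]} \<union> (\<Union>j. range ((#) j)) = (UNIV :: 'd list set)"
    by (auto simp: image_iff) (metis list.exhaust)
  ultimately show ?thesis by simp
qed

context
  fixes Y :: "'y::complex_vector hilbert"
  assumes Y: "hilbert_space Y"
begin

interpretation Y: hilbert_space Y by (rule Y)

lemma hilbert_space_H2: "hilbert_space (H2 Y :: ('d, 'y) nc_series hilbert)"
  unfolding H2_eq_ell2 by (rule hilbert_space_ell2[OF Y])

lemma H2_component: "f \<in> carrier (H2 Y) \<Longrightarrow> f v \<in> carrier Y"
  by (simp add: H2_def)

lemma H2_component_le: "f \<in> carrier (H2 Y) \<Longrightarrow> hnorm Y (f v) \<le> hnorm (H2 Y) f"
  using ell2_component_le[OF Y] by (simp add: H2_eq_ell2)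

lemma backward_shift_H2:
  assumes f: "f \<in> carrier (H2 Y)"
  shows "backward_shift j f \<in> carrier (H2 Y)"
proof -
  have "(\<lambda>v. (hnorm Y (f v))\<^sup>2) summable_on range ((#) j)"
    using f by (simp add: H2_eq_ell2 ell2_summable[OF Y])
  then have "(\<lambda>v. (hnorm Y (f (j # v)))\<^sup>2) summable_on UNIV"
    by (subst (asm) summable_on_reindex) (auto simp: o_def)
  then show ?thesis using f by (simp add: H2_def backward_shift_def)
qed

text \<open>Only finitely many letters occur, so square-summability can be checked on the tails.\<close>

lemma H2_memI:
  fixes f :: "('d::finite, 'y) nc_series"
  assumes "f [] \<in> carrier Y" and f: "\<And>j. backward_shift j f \<in> carrier (H2 Y)"
  shows "f \<in> carrier (H2 Y)"
proof -
  have "\<exists>c. ((\<lambda>v. (hnorm Y (f (j # v)))\<^sup>2) has_sum c) UNIV" for j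
    using f[of j] by (simp add: H2_def backward_shift_def summable_on_def)
  then obtain c where "\<And>j. ((\<lambda>v. (hnorm Y (f (j # v)))\<^sup>2) has_sum c j) UNIV" by metis
  then have "(\<lambda>v. (hnorm Y (f v))\<^sup>2) summable_on UNIV"
    using has_sum_Cons[of "\<lambda>v. (hnorm Y (f v))\<^sup>2"] summable_on_def by blast
  moreover have "f v \<in> carrier Y" for v
    using assms(1) H2_component[OF f] by (cases v) (auto simp: backward_shift_def)
  ultimately show ?thesis by (simp add: H2_def)
qed

text \<open>The Fock space is the orthogonal sum of the constants and the ranges of the left shifts; this is
  the only computation with sums over words that the shifts need.\<close>

lemma H2_cinner_split:
  fixes f g :: "('d::finite, 'y) nc_series"
  assumes f: "f \<in> carrier (H2 Y)" and g: "g \<in> carrier (H2 Y)"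
  shows "cinner (H2 Y) f g = cinner Y (f []) (g [])
    + (\<Sum>j\<in>UNIV. cinner (H2 Y) (backward_shift j f) (backward_shift j g))"
proof -
  have "((\<lambda>v. cinner Y (f (j # v)) (g (j # v))) has_sum
      cinner (H2 Y) (backward_shift j f) (backward_shift j g)) UNIV" for j
    using ell2_cinner_has_sum[OF Y, of "backward_shift j f" "backward_shift j g"]
      backward_shift_H2[OF f, of j] backward_shift_H2[OF g, of j]
    by (simp add: H2_eq_ell2 backward_shift_def)
  from has_sum_Cons[OF this] show ?thesis
    unfolding H2_eq_ell2 by (rule ell2_cinner_eqI[OF Y])
qed

lemma H2_hnorm_split:
  fixes f :: "('d::finite, 'y) nc_series"
  assumes f: "f \<in> carrier (H2 Y)"
  shows "(hnorm (H2 Y) f)\<^sup>2 = (hnorm Y (f []))\<^sup>2 + (\<Sum>j\<in>UNIV. (hnorm (H2 Y) (backward_shift j f))\<^sup>2)"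
  using H2_cinner_split[OF f f] f
  by (simp add: hilbert_space.hnorm_sq[OF hilbert_space_H2] Y.hnorm_sq H2_component backward_shift_H2)

lemma left_shift_H2:
  fixes f :: "('d::finite, 'y) nc_series"
  assumes "f \<in> carrier (H2 Y)"
  shows "left_shift j f \<in> carrier (H2 Y)"
  by (rule H2_memI) (auto simp: Y.closed assms hilbert_space.zero_closed[OF hilbert_space_H2])

lemma cinner_left_shift:
  fixes f h :: "('d::finite, 'y) nc_series"
  assumes f: "f \<in> carrier (H2 Y)" and h: "h \<in> carrier (H2 Y)"
  shows "cinner (H2 Y) (left_shift j h) f = cinner (H2 Y) h (backward_shift j f)"
proof -
  interpret G: hilbert_space "H2 Y :: ('d, 'y) nc_series hilbert" by (rule hilbert_space_H2)
  have "cinner (H2 Y) (left_shift j h) f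
      = (\<Sum>i\<in>UNIV. if i = j then cinner (H2 Y) h (backward_shift i f) else 0)"
    using f h backward_shift_H2[OF f]
    by (simp add: H2_cinner_split[OF left_shift_H2[OF h] f] H2_component if_distrib
        if_distribR cong: if_cong sum.cong)
  then show ?thesis by simp
qed

lemma hnorm_left_shift:
  fixes h :: "('d::finite, 'y) nc_series"
  assumes h: "h \<in> carrier (H2 Y)"
  shows "hnorm (H2 Y) (left_shift j h) = hnorm (H2 Y) h"
  using cinner_left_shift[OF left_shift_H2[OF h] h, of j j] by (simp add: hnorm_def)

lemma bij_rev: "bij (rev :: 'a list \<Rightarrow> 'a list)"
  by (simp add: involuntory_imp_bij)

lemma reflect_H2:
  assumes f: "f \<in> carrier (H2 Y)"
  shows "reflect f \<in> carrier (H2 Y)"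
proof -
  have "(\<lambda>v. (hnorm Y (f (rev v)))\<^sup>2) summable_on UNIV"
    using f summable_on_reindex_bij_betw[of rev UNIV UNIV "\<lambda>v. (hnorm Y (f v))\<^sup>2"]
    by (simp add: H2_def bij_rev)
  then show ?thesis using f by (simp add: H2_def reflect_def)
qed

lemma cinner_reflect: "cinner (H2 Y) (reflect f) (reflect g) = cinner (H2 Y) f g"
  using infsum_reindex_bij_betw[of rev UNIV UNIV "\<lambda>v. cinner Y (f v) (g v)"]
  by (simp add: H2_def reflect_def bij_rev)

lemma monomial_H2: "y \<in> carrier Y \<Longrightarrow> monomial w y \<in> carrier (H2 Y)"
proof -
  assume y: "y \<in> carrier Y"
  have "(\<lambda>v. (hnorm Y (monomial w y v))\<^sup>2) summable_on UNIV"
    by (rule summable_on_cong_neutral[THEN iffD1, of _ "{w}" "\<lambda>v. (hnorm Y (monomial w y v))\<^sup>2"])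
      (auto simp: monomial_def)
  then show ?thesis using y by (simp add: H2_def monomial_def Y.closed)
qed

lemma cinner_monomial:
  assumes f: "f \<in> carrier (H2 Y)" and y: "y \<in> carrier Y"
  shows "cinner (H2 Y) f (monomial w y) = cinner Y (f w) y"
proof -
  have "((\<lambda>v. cinner Y (f v) (monomial w y v)) has_sum (\<Sum>v\<in>{w}. cinner Y (f v) (monomial w y v))) UNIV"
    by (rule has_sum_finite_neutralI[of "{w}"]) (use f in \<open>auto simp: monomial_def H2_component\<close>)
  then show ?thesis
    unfolding H2_eq_ell2 by (intro ell2_cinner_eqI[OF Y]) (simp add: monomial_def)
qed

lemma cinner_monomial_left:
  assumes f: "f \<in> carrier (H2 Y)" and y: "y \<in> carrier Y"
  shows "cinner (H2 Y) (monomial w y) f = cinner Y y (f w)"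
  using cinner_monomial[OF f y, of w] Y.cinner_commute[OF y H2_component[OF f]]
    hilbert_space.cinner_commute[OF hilbert_space_H2 monomial_H2[OF y] f] by simp

lemma hadj_left_shift:
  fixes f :: "('d::finite, 'y) nc_series"
  assumes f: "f \<in> carrier (H2 Y)"
  shows "hadj (H2 Y) (H2 Y) (left_shift j) f = backward_shift j f"
  by (intro hadj_eqI hilbert_space_H2 backward_shift_H2 f cinner_left_shift)

lemma hadj_right_shift:
  fixes f :: "('d::finite, 'y) nc_series"
  assumes f: "f \<in> carrier (H2 Y)"
  shows "hadj (H2 Y) (H2 Y) (right_shift j) f = reflect (backward_shift j (reflect f))"
proof (intro hadj_eqI hilbert_space_H2 reflect_H2 backward_shift_H2 f)
  fix h :: "('d, 'y) nc_series"
  assume h: "h \<in> carrier (H2 Y)"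
  have "cinner (H2 Y) (right_shift j h) f = cinner (H2 Y) (left_shift j (reflect h)) (reflect f)"
    by (simp flip: reflect_right_shift add: cinner_reflect)
  also have "\<dots> = cinner (H2 Y) (reflect h) (backward_shift j (reflect f))"
    by (intro cinner_left_shift reflect_H2 f h)
  also have "\<dots> = cinner (H2 Y) h (reflect (backward_shift j (reflect f)))"
    using cinner_reflect[of "reflect h" "backward_shift j (reflect f)"] cinner_reflect by (metis reflect_reflect)
  finally show "cinner (H2 Y) (right_shift j h) f
      = cinner (H2 Y) h (reflect (backward_shift j (reflect f)))" .
qed

end

section \<open>Multiplication by a Schur-class series\<close>

text \<open>Splittings of a word into prefix and suffix, sorted by whether the suffix is empty. All
  convolution coefficients are handled through this recursion on the last letter.\<close>

lemma sum_splits_snoc: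
  fixes g :: "'d list \<Rightarrow> 'd list \<Rightarrow> 'c::comm_monoid_add"
  shows "(\<Sum>(a, b) | a @ b = w @ [j]. g a b) = g (w @ [j]) [] + (\<Sum>(a, b) | a @ b = w. g a (b @ [j]))"
proof -
  have fin: "finite {(a, b). a @ b = (w :: 'd list)}" for w
  proof (rule finite_subset)
    show "{(a, b). a @ b = w} \<subseteq> (\<lambda>n. (take n w, drop n w)) ` {..length w}"
    proof
      fix p assume "p \<in> {(a, b). a @ b = w}"
      then have "p = (take (length (fst p)) w, drop (length (fst p)) w)" "length (fst p) \<le> length w"
        by auto
      then show "p \<in> (\<lambda>n. (take n w, drop n w)) ` {..length w}" by blast
    qed
  qed simp
  have eq: "{(a, b). a @ b = w @ [j]} = insert (w @ [j], []) ((\<lambda>(a, b). (a, b @ [j])) ` {(a, b). a @ b = w})"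
  proof (rule set_eqI)
    fix p :: "'d list \<times> 'd list"
    obtain a b where p: "p = (a, b)" by (cases p)
    show "p \<in> {(a, b). a @ b = w @ [j]}
        \<longleftrightarrow> p \<in> insert (w @ [j], []) ((\<lambda>(a, b). (a, b @ [j])) ` {(a, b). a @ b = w})"
      unfolding p by (cases b rule: rev_cases) auto
  qed
  have "inj_on (\<lambda>(a, b). (a, b @ [j])) {(a, b). a @ b = w}"
    by (auto simp: inj_on_def)
  then show ?thesis
    unfolding eq using fin[of w]
    by (subst sum.insert) (auto simp: sum.reindex split_def)
qed

lemma sum_splits_Nil: "(\<Sum>(a, b) | a @ b = []. g a b) = g [] []"
proof -
  have "{(a, b). a @ b = []} = {([], [])}" by auto
  then show ?thesis by simp
qed

locale schur_function = U: hilbert_space U + Y: hilbert_space Y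
  for U :: "'u::complex_vector hilbert" and Y :: "'y::complex_vector hilbert" +
  fixes S :: "('d::finite, 'u \<Rightarrow> 'y) nc_series"
  assumes schur: "schur_class U Y S"
begin

sublocale HU: hilbert_space "H2 U :: ('d, 'u) nc_series hilbert"
  by (rule hilbert_space_H2[OF U.hilbert_space_axioms])

sublocale G: hilbert_space "H2 Y :: ('d, 'y) nc_series hilbert"
  by (rule hilbert_space_H2[OF Y.hilbert_space_axioms])

lemmas hU = U.hilbert_space_axioms and hY = Y.hilbert_space_axioms
  and hHU = HU.hilbert_space_axioms and hG = G.hilbert_space_axioms

lemma S_bounded: "bounded_op U Y (S \<alpha>)"
  using schur by (simp add: schur_class_def)

lemma S_zero [simp]: "S \<alpha> 0 = 0"
  by (rule bounded_op_zero[OF S_bounded hU])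

text \<open>Left multiplication by \<open>S\<close> conjugated by the reflection, that is, right convolution with the
  reflected coefficients; in this form it commutes with left shifts.\<close>

definition M :: "('d, 'u) nc_series \<Rightarrow> ('d, 'y) nc_series" where
  "M f = reflect (series_apply S (reflect f))"

lemma M_Nil [simp]: "M f [] = S [] (f [])"
  by (simp add: M_def reflect_def series_apply_def sum_splits_Nil del: append_is_Nil_conv)

lemma M_Cons: "M f (j # v) = S (rev v @ [j]) (f []) + M (backward_shift j f) v"
  by (simp add: M_def reflect_def series_apply_def sum_splits_snoc backward_shift_def)

lemma M_const: "M (monomial [] u) v = S (rev v) u"
proof (cases v)
  case (Cons j w)
  have "M 0 w = 0" by (simp add: M_def reflect_def series_apply_def)
  then show ?thesis by (simp add: Cons M_Cons)
qed simp

text \<open>The basic identity: the commutator of \<open>M\<close> with a backward shift sees only the constant term.\<close>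

lemma backward_shift_M:
  "backward_shift j (M f) = backward_shift j (M (monomial [] (f []))) + M (backward_shift j f)"
  by (auto simp: fun_eq_iff backward_shift_def M_Cons[of f] M_const)

lemma M_left_shift: "M (left_shift j f) = left_shift j (M f)"
proof (rule nc_series_eqI)
  have "M 0 = 0" by (simp add: M_def reflect_def series_apply_def fun_eq_iff)
  moreover have "M (monomial [] 0) = 0" by (simp add: fun_eq_iff M_const)
  moreover have "backward_shift i (0 :: ('d, 'y) nc_series) = 0" for i
    by (simp add: backward_shift_def fun_eq_iff)
  ultimately show "backward_shift i (M (left_shift j f)) = backward_shift i (left_shift j (M f))" for i
    by (simp add: backward_shift_M[of _ "left_shift j f"])
qed simp

lemma M_bounded: "bounded_op (H2 U) (H2 Y) M"
  and M_contractive: "f \<in> carrier (H2 U) \<Longrightarrow> hnorm (H2 Y) (M f) \<le> hnorm (H2 U) f"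
proof -
  have S: "bounded_op (H2 U) (H2 Y) (series_apply S)"
    and S_le: "\<And>f. f \<in> carrier (H2 U) \<Longrightarrow> hnorm (H2 Y) (series_apply S f) \<le> hnorm (H2 U) f"
    using schur by (auto simp: schur_class_def contraction_def)
  have le: "hnorm (H2 Y) (M f) \<le> hnorm (H2 U) f" if f: "f \<in> carrier (H2 U)" for f
    using S_le[OF reflect_H2[OF hU f]] by (simp add: M_def hnorm_def cinner_reflect hU hY)
  show "bounded_op (H2 U) (H2 Y) M"
    by (rule bounded_opI[where M = 1])
      (auto simp: M_def bounded_op_add[OF S] bounded_op_scaleC[OF S] bounded_op_closed[OF S]
        reflect_H2 hU hY le[unfolded M_def])
  show "f \<in> carrier (H2 U) \<Longrightarrow> hnorm (H2 Y) (M f) \<le> hnorm (H2 U) f" by (rule le)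
qed

lemmas M_closed = bounded_op_closed[OF M_bounded]

definition N :: "('d, 'y) nc_series \<Rightarrow> ('d, 'u) nc_series" where
  "N = hadj (H2 U) (H2 Y) M"

lemma N_bounded: "bounded_op (H2 Y) (H2 U) N"
  unfolding N_def by (rule bounded_op_hadj[OF hHU hG M_bounded])

lemmas N_closed = bounded_op_closed[OF N_bounded]

lemma cinner_N:
  "\<lbrakk>h \<in> carrier (H2 U); x \<in> carrier (H2 Y)\<rbrakk> \<Longrightarrow> cinner (H2 U) h (N x) = cinner (H2 Y) (M h) x"
  "\<lbrakk>h \<in> carrier (H2 U); x \<in> carrier (H2 Y)\<rbrakk> \<Longrightarrow> cinner (H2 U) (N x) h = cinner (H2 Y) x (M h)"
  unfolding N_def
  by (simp_all only: cinner_hadj_right[OF hHU hG M_bounded] cinner_hadj_left[OF hHU hG M_bounded])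

lemma N_contractive: "x \<in> carrier (H2 Y) \<Longrightarrow> hnorm (H2 U) (N x) \<le> hnorm (H2 Y) x"
  using hnorm_hadj_le[OF hHU hG M_bounded, where M = 1 and y = x] M_contractive
  by (simp add: N_def)

lemma N_backward_shift:
  assumes x: "x \<in> carrier (H2 Y)"
  shows "N (backward_shift j x) = backward_shift j (N x)"
proof (rule HU.cinner_ext)
  show "N (backward_shift j x) \<in> carrier (H2 U)" by (intro N_closed backward_shift_H2[OF hY] x)
  show "backward_shift j (N x) \<in> carrier (H2 U)" by (intro N_closed backward_shift_H2[OF hU] x)
  fix h :: "('d, 'u) nc_series" assume h: "h \<in> carrier (H2 U)"
  show "cinner (H2 U) h (N (backward_shift j x)) = cinner (H2 U) h (backward_shift j (N x))"
    using x h
    by (simp add: cinner_N backward_shift_H2[OF hY] M_closed N_closed left_shift_H2[OF hU]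
        M_left_shift flip: cinner_left_shift[OF hY] cinner_left_shift[OF hU])
qed

text \<open>The defect operator of the contraction \<open>N = M\<^sup>*\<close>.\<close>

definition P :: "('d, 'y) nc_series \<Rightarrow> ('d, 'y) nc_series" where
  "P x = x - M (N x)"

lemma cinner_P:
  "\<lbrakk>x \<in> carrier (H2 Y); y \<in> carrier (H2 Y)\<rbrakk>
    \<Longrightarrow> cinner (H2 Y) (P x) y = cinner (H2 Y) x y - cinner (H2 U) (N x) (N y)"
  by (simp add: P_def G.cinner_simps M_closed N_closed cinner_N)

lemma Re_cinner_P:
  "x \<in> carrier (H2 Y) \<Longrightarrow> Re (cinner (H2 Y) (P x) x) = (hnorm (H2 Y) x)\<^sup>2 - (hnorm (H2 U) (N x))\<^sup>2"
  by (simp add: cinner_P G.hnorm_sq HU.hnorm_sq N_closed)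

sublocale positive_contraction "H2 Y" P
proof
  fix x y :: "('d, 'y) nc_series" and a assume x: "x \<in> carrier (H2 Y)"
  show "P x \<in> carrier (H2 Y)" using x by (simp add: P_def G.closed M_closed N_closed)
  show "P (a *\<^sub>C x) = a *\<^sub>C P x"
    using x by (simp add: P_def bounded_op_scaleC[OF N_bounded] bounded_op_scaleC[OF M_bounded]
        N_closed scaleC_diff_right)
  show "0 \<le> Re (cinner (H2 Y) (P x) x)"
    using x N_contractive[OF x] HU.hnorm_nonneg[OF N_closed[OF x]]
    by (simp add: Re_cinner_P power_mono)
  show "Re (cinner (H2 Y) (P x) x) \<le> Re (cinner (H2 Y) x x)"
    using x by (simp add: Re_cinner_P G.hnorm_sq)
  assume y: "y \<in> carrier (H2 Y)"
  show "P (x + y) = P x + P y"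
    using x y by (simp add: P_def bounded_op_add[OF N_bounded] bounded_op_add[OF M_bounded] N_closed)
  show "cinner (H2 Y) (P x) y = cinner (H2 Y) x (P y)"
    using x y cinner_P[OF y x] G.cinner_commute[OF x, of "P y"] G.cinner_commute[OF x y]
      HU.cinner_commute[OF N_closed[OF x] N_closed[OF y]]
    by (simp add: cinner_P) (simp add: P_def G.closed M_closed N_closed)
qed

text \<open>Together with \<open>P_Nil\<close> this says that the block operator of the model undoes its adjoint on the
  vectors built from \<open>P\<close>: the backward shift of \<open>P x + M (N x)\<^sub>\<emptyset> = x - M (N x - (N x)\<^sub>\<emptyset>)\<close>
  cancels the commutator term of \<open>backward_shift_M\<close>.\<close>

lemma backward_shift_P:
  assumes x: "x \<in> carrier (H2 Y)"
  shows "backward_shift j (P x + M (monomial [] (N x []))) = P (backward_shift j x)"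
  by (simp add: P_def backward_shift_M[of j "N x"] N_backward_shift[OF x])

lemma P_Nil: "(P x + M (monomial [] (N x []))) [] = x []"
  by (simp add: P_def)

text \<open>The left shift is isometric, and \<open>N\<close> of a left-shifted series is the left shift of \<open>N x\<close>
  plus a constant term. So the form of \<open>P\<close> drops exactly by the square norm of that term; this single identity bounds both
  the state operators and the input operators.\<close>

lemma Re_cinner_P_left_shift:
  assumes x: "x \<in> carrier (H2 Y)"
  shows "Re (cinner (H2 Y) (P (left_shift j x)) (left_shift j x))
      = Re (cinner (H2 Y) (P x) x) - (hnorm U (N (left_shift j x) []))\<^sup>2"
proof -
  have L: "left_shift j x \<in> carrier (H2 Y)" by (rule left_shift_H2[OF hY x])
  have N0: "N 0 = 0" by (rule bounded_op_zero[OF N_bounded hG])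
  have "(hnorm (H2 U) (N (left_shift j x)))\<^sup>2 = (hnorm U (N (left_shift j x) []))\<^sup>2
      + (\<Sum>i\<in>UNIV. if i = j then (hnorm (H2 U) (N x))\<^sup>2 else 0)"
    unfolding H2_hnorm_split[OF hU N_closed[OF L]]
    by (intro arg_cong2[where f = "(+)"] refl sum.cong)
      (auto simp: N0 simp flip: N_backward_shift[OF L])
  then show ?thesis
    by (simp add: Re_cinner_P[OF L] Re_cinner_P[OF x] hnorm_left_shift[OF hY x])
qed

end

section \<open>Colligations\<close>

lemma hpow_simps [simp]:
  "carrier (hpow X) = {f. \<forall>j. f j \<in> carrier X}"
  "cinner (hpow X) f g = (\<Sum>j\<in>UNIV. cinner X (f j) (g j))"
  by (simp_all add: hpow_def)

lemma hilbert_space_hpow: "hilbert_space X \<Longrightarrow> hilbert_space (hpow X :: ('d::finite \<Rightarrow> 'x::complex_vector) hilbert)"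
  unfolding hpow_eq_ell2 by (rule hilbert_space_ell2)

lemma block_op_apply [simp]:
  "block_op W (x, u) = (\<lambda>j. opA W j x + opB W j u, opC W x + opD W u)"
  by (simp add: block_op_def)

lemma hnorm_hpow_le:
  assumes X: "hilbert_space X" and h: "h \<in> carrier (hpow X :: ('d::finite \<Rightarrow> 'x::complex_vector) hilbert)"
  shows "hnorm (hpow X) h \<le> (\<Sum>j\<in>UNIV. hnorm X (h j))"
proof -
  have "hnorm (hpow X) h = L2_set (\<lambda>j. hnorm X (h j)) UNIV"
    using h by (simp add: hnorm_def[of "hpow X"] L2_set_def hilbert_space.hnorm_sq[OF X])
  also have "\<dots> \<le> (\<Sum>j\<in>UNIV. hnorm X (h j))"
    using h by (intro L2_set_le_sum) (auto intro: hilbert_space.hnorm_nonneg[OF X])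
  finally show ?thesis .
qed

lemma hnorm_hsum_le:
  assumes H: "hilbert_space H" and K: "hilbert_space K" and "x \<in> carrier H" "y \<in> carrier K"
  shows "hnorm (hsum H K) (x, y) \<le> hnorm H x + hnorm K y"
  using assms sqrt_add_le_add_sqrt[of "Re (cinner H x x)" "Re (cinner K y y)"]
  by (simp add: hilbert_space.cinner_self_nonneg hnorm_def)

lemma hnorm_le_hnorm_hsum:
  assumes "hilbert_space H" "hilbert_space K" "x \<in> carrier H" "y \<in> carrier K"
  shows "hnorm H x \<le> hnorm (hsum H K) (x, y)" "hnorm K y \<le> hnorm (hsum H K) (x, y)"
  using assms by (simp_all add: hilbert_space.cinner_self_nonneg hnorm_def)

text \<open>Boundedness of the block operator follows from that of its blocks, since the direct sums are finite.\<close>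

lemma is_colligationI:
  fixes W :: "('d::finite, 'x::complex_vector, 'u::complex_vector, 'y::complex_vector) colligation"
  assumes X: "hilbert_space X" and U: "hilbert_space U" and Y: "hilbert_space Y"
    and A: "\<And>j. bounded_op X X (opA W j)" and B: "\<And>j. bounded_op U X (opB W j)"
    and C: "bounded_op X Y (opC W)" and D: "bounded_op U Y (opD W)"
  shows "is_colligation X U Y W"
proof -
  interpret X: hilbert_space X by (rule X)
  interpret Y: hilbert_space Y by (rule Y)
  interpret U: hilbert_space U by (rule U)
  note c = bounded_op_closed[OF A] bounded_op_closed[OF B] bounded_op_closed[OF C] bounded_op_closed[OF D]
  have "\<forall>j. \<exists>a b. \<forall>x\<in>carrier X. \<forall>u\<in>carrier U. a \<ge> 0 \<and> b \<ge> 0 \<and>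
      hnorm X (opA W j x) \<le> a * hnorm X x \<and> hnorm X (opB W j u) \<le> b * hnorm U u"
    using bounded_op_bound[OF A X] bounded_op_bound[OF B U] by metis
  then obtain a b where ab: "\<And>j x u. \<lbrakk>x \<in> carrier X; u \<in> carrier U\<rbrakk> \<Longrightarrow> a j \<ge> 0 \<and> b j \<ge> 0 \<and>
      hnorm X (opA W j x) \<le> a j * hnorm X x \<and> hnorm X (opB W j u) \<le> b j * hnorm U u"
    by metis
  obtain e where e: "e \<ge> 0" "\<And>x. x \<in> carrier X \<Longrightarrow> hnorm Y (opC W x) \<le> e * hnorm X x"
    using bounded_op_bound[OF C X] by blast
  obtain r where r: "r \<ge> 0" "\<And>u. u \<in> carrier U \<Longrightarrow> hnorm Y (opD W u) \<le> r * hnorm U u"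
    using bounded_op_bound[OF D U] by blast
  define m where "m = (\<Sum>j\<in>UNIV. a j + b j) + (e + r)"
  have "bounded_op (hsum X U) (hsum (hpow X) Y) (block_op W)"
  proof (rule bounded_opI[where M = m])
    fix p q k assume "p \<in> carrier (hsum X U)"
    then obtain x u where p: "p = (x, u)" "x \<in> carrier X" "u \<in> carrier U" by auto
    show "block_op W p \<in> carrier (hsum (hpow X) Y)"
      using p c by (auto simp: X.add_closed Y.add_closed)
    show "block_op W (k *\<^sub>C p) = k *\<^sub>C block_op W p"
      using p by (simp add: scaleC_prod_def fun_eq_iff scaleC_add_right bounded_op_scaleC[OF A]
          bounded_op_scaleC[OF B] bounded_op_scaleC[OF C] bounded_op_scaleC[OF D])
    show "hnorm (hsum (hpow X) Y) (block_op W p) \<le> m * hnorm (hsum X U) p"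
    proof -
      define n where "n = hnorm (hsum X U) p"
      have n: "hnorm X x \<le> n" "hnorm U u \<le> n"
        unfolding n_def p(1) by (rule hnorm_le_hnorm_hsum[OF X U p(2,3)])+
      have "hnorm (hsum (hpow X) Y) (block_op W p)
          \<le> hnorm (hpow X) (\<lambda>j. opA W j x + opB W j u) + hnorm Y (opC W x + opD W u)"
        unfolding p block_op_apply using p c
        by (intro hnorm_hsum_le hilbert_space_hpow X Y) (auto simp: X.add_closed Y.add_closed)
      also have "\<dots> \<le> (\<Sum>j\<in>UNIV. hnorm X (opA W j x + opB W j u)) + (hnorm Y (opC W x) + hnorm Y (opD W u))"
        using p c by (intro add_mono hnorm_hpow_le X Y.hnorm_triangle) (auto simp: X.add_closed)
      also have "\<dots> \<le> (\<Sum>j\<in>UNIV. (a j + b j) * n) + (e * n + r * n)"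
      proof (intro add_mono sum_mono)
        fix j
        have "hnorm X (opA W j x + opB W j u) \<le> hnorm X (opA W j x) + hnorm X (opB W j u)"
          using p c by (intro X.hnorm_triangle)
        also have "\<dots> \<le> a j * hnorm X x + b j * hnorm U u"
          using ab[OF p(2,3), of j] by linarith
        also have "\<dots> \<le> a j * n + b j * n"
          using ab[OF p(2,3), of j] n by (intro add_mono mult_left_mono) auto
        finally show "hnorm X (opA W j x + opB W j u) \<le> (a j + b j) * n" by (simp add: distrib_right)
        show "hnorm Y (opC W x) \<le> e * n"
          using e(2)[OF p(2)] mult_left_mono[OF n(1) e(1)] by linarith
        show "hnorm Y (opD W u) \<le> r * n"
          using r(2)[OF p(3)] mult_left_mono[OF n(2) r(1)] by linarith
      qed
      also have "\<dots> = m * n" by (simp add: m_def distrib_right sum_distrib_right)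
      finally show ?thesis by (simp add: n_def)
    qed
    assume "q \<in> carrier (hsum X U)"
    then obtain x' u' where q: "q = (x', u')" "x' \<in> carrier X" "u' \<in> carrier U" by auto
    show "block_op W (p + q) = block_op W p + block_op W q"
      using p q by (simp add: fun_eq_iff bounded_op_add[OF A]
          bounded_op_add[OF B] bounded_op_add[OF C] bounded_op_add[OF D] add_ac)
  qed
  then show ?thesis using A B C D by (simp add: is_colligation_def)
qed

lemma transfer_function_Nil: "transfer_function W [] u = opD W u"
proof -
  have empty: "{(v, j). v @ [j] = []} = {}" by auto
  show ?thesis unfolding transfer_function_def empty by simp
qed

lemma transfer_function_snoc:
  "transfer_function W (w @ [j]) u = opC W (word_op (opA W) w (opB W j u))"
proof -
  have one: "{(v, i). v @ [i] = w @ [j]} = {(w, j)}" by auto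
  show ?thesis unfolding transfer_function_def one by simp
qed

lemma word_op_snoc: "word_op A (v @ [j]) x = word_op A v (A j x)"
  by (induction v) auto

lemma word_op_bounded:
  assumes X: "hilbert_space X" and A: "\<And>j. bounded_op X X (A j)"
  shows "bounded_op X X (word_op A v)"
proof (induction v)
  case Nil
  then show ?case using bounded_op_id[of X] by (simp add: fun_eq_iff[symmetric])
next
  case (Cons j v)
  then show ?case using bounded_op_compose[OF Cons.IH A[of j] X X] by simp
qed

section \<open>The functional model\<close>

context schur_function
begin

abbreviation "W \<equiv> dBR_colligation U Y S"

lemma M_const_reflect: "reflect (series_apply S (const_series u)) = M (monomial [] u)"
  by (simp add: M_def const_series_eq_monomial)

lemma opA_dBR: "f \<in> carrier (H2 Y) \<Longrightarrow> opA W j f = backward_shift j f"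
  by (simp add: dBR_colligation_def hadj_left_shift[OF hY])

lemma opB_dBR:
  assumes u: "u \<in> carrier U"
  shows "opB W j u = backward_shift j (M (monomial [] u))"
proof -
  have eq: "series_apply S (const_series u) = reflect (M (monomial [] u))"
    by (simp flip: M_const_reflect)
  have "reflect (M (monomial [] u)) \<in> carrier (H2 Y)"
    by (intro reflect_H2[OF hY] M_closed monomial_H2[OF hU] u)
  then show ?thesis by (simp add: dBR_colligation_def eq hadj_right_shift[OF hY])
qed

lemma opB_dBR_left_shift:
  assumes u: "u \<in> carrier U"
  shows "opB W j u = hadj (H2 Y) (H2 Y) (left_shift j) (reflect (series_apply S (const_series u)))"
  unfolding M_const_reflect opB_dBR[OF u]
  by (rule hadj_left_shift[OF hY, symmetric]) (intro M_closed monomial_H2[OF hU] u)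

lemma opC_dBR [simp]: "opC W f = f []" and opD_dBR [simp]: "opD W = S []"
  by (simp_all add: dBR_colligation_def)

context
  fixes H :: "('d, 'y) nc_series hilbert"
  assumes H: "operator_range (H2 Y) P H"
begin

interpretation R: operator_range "H2 Y" P H by (rule H)

lemma HG: "f \<in> carrier H \<Longrightarrow> f \<in> carrier (H2 Y)"
  using R.sub by blast

lemma hnorm_G_le: "f \<in> carrier H \<Longrightarrow> hnorm (H2 Y) f \<le> hnorm H f"
proof -
  assume f: "f \<in> carrier H"
  have "(hnorm (H2 Y) f)\<^sup>2 \<le> cmod (cinner (H2 Y) f f)"
    using G.hnorm_sq[OF HG[OF f]] by (simp add: complex_Re_le_cmod)
  also have "\<dots> \<le> hnorm H f * sqrt (Re (cinner (H2 Y) (P f) f))"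
    by (intro R.cmod_cinner_le f HG)
  also have "\<dots> \<le> hnorm H f * hnorm (H2 Y) f"
    using P_le[OF HG[OF f]] R.H.hnorm_nonneg[OF f]
    by (intro mult_left_mono) (auto simp: hnorm_def)
  finally show ?thesis
    using G.hnorm_nonneg[OF HG[OF f]] R.H.hnorm_nonneg[OF f]
    by (cases "hnorm (H2 Y) f = 0") (auto simp: power2_eq_square)
qed

text \<open>Invariance and contractivity by the membership test \<open>memI\<close>: move the shift to \<open>x\<close> and use that
  left shifts decrease the form of \<open>P\<close>.\<close>

lemma backward_shift_range:
  assumes f: "f \<in> carrier H"
  shows "backward_shift j f \<in> carrier H \<and> hnorm H (backward_shift j f) \<le> hnorm H f"
proof (rule R.memI)
  fix x :: "('d, 'y) nc_series"
  assume x: "x \<in> carrier (H2 Y)"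
  have L: "left_shift j x \<in> carrier (H2 Y)" by (rule left_shift_H2[OF hY x])
  have "cmod (cinner (H2 Y) (backward_shift j f) x) = cmod (cinner (H2 Y) f (left_shift j x))"
    using cinner_left_shift[OF hY HG[OF f] x, of j]
      G.cinner_commute[OF backward_shift_H2[OF hY HG[OF f], of j] x]
      G.cinner_commute[OF HG[OF f] L] by simp
  also have "\<dots> \<le> hnorm H f * sqrt (Re (cinner (H2 Y) (P (left_shift j x)) (left_shift j x)))"
    by (rule R.cmod_cinner_le[OF f L])
  also have "\<dots> \<le> hnorm H f * sqrt (Re (cinner (H2 Y) (P x) x))"
    using Re_cinner_P_left_shift[OF x, of j] R.H.hnorm_nonneg[OF f]
    by (intro mult_left_mono real_sqrt_le_mono) auto
  finally show "cmod (cinner (H2 Y) (backward_shift j f) x)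
      \<le> hnorm H f * sqrt (Re (cinner (H2 Y) (P x) x))" .
qed (use f in \<open>auto intro: backward_shift_H2[OF hY] HG R.H.hnorm_nonneg\<close>)

text \<open>Here the term by which the form of \<open>P\<close> drops under the left shift supplies the estimate.\<close>

lemma backward_shift_M_range:
  assumes u: "u \<in> carrier U"
  shows "backward_shift j (M (monomial [] u)) \<in> carrier H
    \<and> hnorm H (backward_shift j (M (monomial [] u))) \<le> hnorm U u"
proof (rule R.memI)
  let ?g = "M (monomial [] u)"
  have c: "monomial [] u \<in> carrier (H2 U)" by (rule monomial_H2[OF hU u])
  have g: "?g \<in> carrier (H2 Y)" by (rule M_closed[OF c])
  show "backward_shift j ?g \<in> carrier (H2 Y)" by (rule backward_shift_H2[OF hY g])
  fix x :: "('d, 'y) nc_series"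
  assume x: "x \<in> carrier (H2 Y)"
  have L: "left_shift j x \<in> carrier (H2 Y)" by (rule left_shift_H2[OF hY x])
  define n where "n = N (left_shift j x) []"
  have n: "n \<in> carrier U" unfolding n_def by (rule H2_component[OF hU N_closed[OF L]])
  have "cinner (H2 Y) (left_shift j x) ?g = cinner U n u"
    using cinner_monomial[OF hU N_closed[OF L] u, of "[]"] cinner_N(2)[OF c L] by (simp add: n_def)
  then have "cmod (cinner (H2 Y) (backward_shift j ?g) x) = cmod (cinner U u n)"
    using cinner_left_shift[OF hY g x, of j] U.cinner_commute[OF u n]
      G.cinner_commute[OF backward_shift_H2[OF hY g, of j] x] by simp
  also have "\<dots> \<le> hnorm U u * hnorm U n" by (rule U.cauchy_schwarz[OF u n])
  also have "\<dots> \<le> hnorm U u * sqrt (Re (cinner (H2 Y) (P x) x))"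
  proof (rule mult_left_mono)
    have "(hnorm U n)\<^sup>2 \<le> Re (cinner (H2 Y) (P x) x)"
      using Re_cinner_P_left_shift[OF x, of j] P_nonneg[OF L] by (simp add: n_def)
    then show "hnorm U n \<le> sqrt (Re (cinner (H2 Y) (P x) x))" by (rule real_le_rsqrt)
  qed (rule U.hnorm_nonneg[OF u])
  finally show "cmod (cinner (H2 Y) (backward_shift j ?g) x)
      \<le> hnorm U u * sqrt (Re (cinner (H2 Y) (P x) x))" .
qed (rule U.hnorm_nonneg[OF u])

lemma is_colligation_dBR: "is_colligation H U Y W"
proof (rule is_colligationI[OF R.H.hilbert_space_axioms hU hY])
  show "bounded_op H H (opA W j)" for j
    by (rule bounded_opI[where M = 1])
      (simp_all add: opA_dBR HG R.H.closed G.closed backward_shift_range)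
  show "bounded_op U H (opB W j)" for j
  proof (rule bounded_opI[where M = 1])
    fix u v a assume u: "u \<in> carrier U"
    have M_eq: "M (monomial [] w) = (\<lambda>v. S (rev v) w)" for w by (simp add: fun_eq_iff M_const)
    show "opB W j u \<in> carrier H" "hnorm H (opB W j u) \<le> 1 * hnorm U u"
      using backward_shift_M_range[OF u] by (simp_all add: opB_dBR[OF u])
    show "opB W j (a *\<^sub>C u) = a *\<^sub>C opB W j u"
      using u by (simp add: opB_dBR U.closed M_eq backward_shift_def fun_eq_iff
          bounded_op_scaleC[OF S_bounded])
    assume v: "v \<in> carrier U"
    show "opB W j (u + v) = opB W j u + opB W j v"
      using u v by (simp add: opB_dBR U.closed M_eq backward_shift_def fun_eq_iff
          bounded_op_add[OF S_bounded])
  qed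
  show "bounded_op H Y (opC W)"
  proof (rule bounded_opI[where M = 1])
    fix f assume f: "f \<in> carrier H"
    show "opC W f \<in> carrier Y" using H2_component[OF hY HG[OF f]] by simp
    show "hnorm Y (opC W f) \<le> 1 * hnorm H f"
      using H2_component_le[OF hY HG[OF f], of "[]"] hnorm_G_le[OF f] by simp
  qed simp_all
  show "bounded_op U Y (opD W)" by (simp add: S_bounded)
qed

lemma word_op_dBR:
  "f \<in> carrier H \<Longrightarrow> word_op (opA W) v f \<in> carrier H \<and> word_op (opA W) v f = (\<lambda>w. f (rev v @ w))"
proof (induction v)
  case (Cons j v)
  then have IH: "word_op (opA W) v f \<in> carrier H" "word_op (opA W) v f = (\<lambda>w. f (rev v @ w))"
    by blast+
  have "word_op (opA W) (j # v) f = backward_shift j (word_op (opA W) v f)"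
    using opA_dBR[OF HG[OF IH(1)]] by simp
  then show ?case using backward_shift_range[OF IH(1), of j] by (simp add: IH(2) backward_shift_def)
qed simp

lemma observable_dBR: "observable H W"
  unfolding observable_def
proof (rule inj_onI)
  fix f g assume fg: "f \<in> carrier H" "g \<in> carrier H"
    and eq: "(\<lambda>v. opC W (word_op (opA W) v f)) = (\<lambda>v. opC W (word_op (opA W) v g))"
  have "f (rev v) = g (rev v)" for v
    using fun_cong[OF eq, of v] word_op_dBR[OF fg(1), of v] word_op_dBR[OF fg(2), of v] by simp
  then have "f v = g v" for v by (metis rev_rev_ident)
  then show "f = g" by blast
qed

lemma is_realization_dBR: "is_realization U S W"
  unfolding is_realization_def
proof (intro allI ballI)
  fix v u assume u: "u \<in> carrier U"
  show "transfer_function W v u = S v u"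
  proof (cases v rule: rev_cases)
    case Nil
    then show ?thesis by (simp add: transfer_function_Nil)
  next
    case (snoc w j)
    have b: "opB W j u \<in> carrier H" using backward_shift_M_range[OF u] by (simp add: opB_dBR[OF u])
    show ?thesis
      using word_op_dBR[OF b, of w]
      by (simp add: snoc transfer_function_snoc opB_dBR[OF u] backward_shift_def M_const)
  qed
qed

lemma block_op_dBR:
  assumes f: "f \<in> carrier H" and u: "u \<in> carrier U"
  shows "block_op W (f, u) = (\<lambda>j. backward_shift j (f + M (monomial [] u)), (f + M (monomial [] u)) [])"
  using f u by (simp add: opA_dBR HG opB_dBR fun_eq_iff)

text \<open>With \<open>g = f + M u\<close> the block operator lists the backward shifts and constant term of \<open>g\<close>, so pairing it with
  the given vector reassembles \<open>\<langle>g, x\<rangle>\<close> in the Fock space.\<close>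

lemma hadj_block_op_dBR:
  assumes x: "x \<in> carrier (H2 Y)"
  shows "hadj (hsum H U) (hsum (hpow H) Y) (block_op W) (\<lambda>j. P (backward_shift j x), x [])
    = (P x, N x [])"
proof (rule hadj_eqI)
  show "hilbert_space (hsum H U)" by (rule hilbert_space_hsum[OF R.H.hilbert_space_axioms hU])
  have n: "N x [] \<in> carrier U" by (rule H2_component[OF hU N_closed[OF x]])
  then show "(P x, N x []) \<in> carrier (hsum H U)" using R.P_mem[OF x] by simp
  fix p assume "p \<in> carrier (hsum H U)"
  then obtain f u where p: "p = (f, u)" "f \<in> carrier H" "u \<in> carrier U" by auto
  have c: "monomial [] u \<in> carrier (H2 U)" by (rule monomial_H2[OF hU p(3)])
  define g where "g = f + M (monomial [] u)"
  have g: "g \<in> carrier (H2 Y)" unfolding g_def by (intro G.closed HG p M_closed c)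
  have gj: "backward_shift j g \<in> carrier H" for j
    unfolding g_def backward_shift_linear
    using backward_shift_range[OF p(2)] backward_shift_M_range[OF p(3)] by (intro R.H.closed) auto
  have "cinner (hsum (hpow H) Y) (block_op W p) (\<lambda>j. P (backward_shift j x), x [])
      = (\<Sum>j\<in>UNIV. cinner H (backward_shift j g) (P (backward_shift j x))) + cinner Y (g []) (x [])"
    unfolding p(1) block_op_dBR[OF p(2,3)] g_def by simp
  also have "\<dots> = cinner (H2 Y) g x"
    using gj by (simp add: R.reproducing backward_shift_H2[OF hY x] H2_cinner_split[OF hY g x])
  also have "\<dots> = cinner (H2 Y) f x + cinner (H2 Y) (M (monomial [] u)) x"
    unfolding g_def by (rule G.cinner_add_left[OF HG[OF p(2)] M_closed[OF c] x])
  also have "\<dots> = cinner H f (P x) + cinner U u (N x [])"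
    using cinner_monomial_left[OF hU N_closed[OF x] p(3), of "[]"]
    by (simp add: R.reproducing[OF p(2) x] cinner_N(1)[OF c x])
  finally show "cinner (hsum (hpow H) Y) (block_op W p) (\<lambda>j. P (backward_shift j x), x [])
      = cinner (hsum H U) p (P x, N x [])" by (simp add: p(1))
qed

text \<open>The operator \<open>W W\<^sup>* - I\<close> is selfadjoint and vanishes on a total set, so it is zero. Totality is
  tested with left-shifted series for the components in \<open>H\<close> and with constants for the component in \<open>Y\<close>.\<close>

lemma coisometric_dBR: "coisometric H U Y W"
  unfolding coisometric_def
proof
  define X where "X = hsum H U"
  define Z where "Z = (hsum (hpow H) Y :: (('d \<Rightarrow> ('d, 'y) nc_series) \<times> 'y) hilbert)"
  have X: "hilbert_space X"
    unfolding X_def by (rule hilbert_space_hsum[OF R.H.hilbert_space_axioms hU])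
  have Z: "hilbert_space Z"
    unfolding Z_def by (intro hilbert_space_hsum hilbert_space_hpow R.H.hilbert_space_axioms hY)
  interpret Z: hilbert_space Z by (rule Z)
  have T: "bounded_op X Z (block_op W)"
    using is_colligation_dBR by (simp add: is_colligation_def X_def Z_def)
  note adj = cinner_hadj_left[OF X Z T] cinner_hadj_right[OF X Z T]
  note cl = hadj_closed[OF X Z T] bounded_op_closed[OF T]
  define q where "q x = (\<lambda>j. P (backward_shift j x), x [])" for x
  have q: "q x \<in> carrier Z" if "x \<in> carrier (H2 Y)" for x
    using that by (simp add: q_def Z_def R.P_mem backward_shift_H2[OF hY] H2_component[OF hY])
  have fix_q: "block_op W (hadj X Z (block_op W) (q x)) = q x" if x: "x \<in> carrier (H2 Y)" for x
  proof -
    have n: "N x [] \<in> carrier U" by (rule H2_component[OF hU N_closed[OF x]])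
    show ?thesis
      unfolding X_def Z_def q_def hadj_block_op_dBR[OF x] block_op_dBR[OF R.P_mem[OF x] n]
        backward_shift_P[OF x] P_Nil ..
  qed
  fix p :: "('d \<Rightarrow> ('d, 'y) nc_series) \<times> 'y"
  assume "p \<in> carrier (hsum (hpow H) Y)"
  then have p: "p \<in> carrier Z" by (simp add: Z_def)
  define r where "r = block_op W (hadj X Z (block_op W) p) - p"
  have r: "r \<in> carrier Z" unfolding r_def by (intro Z.closed cl p)
  have orth: "cinner Z r (q x) = 0" if x: "x \<in> carrier (H2 Y)" for x
  proof -
    have "cinner Z (block_op W (hadj X Z (block_op W) p)) (q x)
        = cinner Z p (block_op W (hadj X Z (block_op W) (q x)))"
      using p q[OF x] cl by (simp flip: adj)
    then show ?thesis
      unfolding r_def using p q[OF x] cl by (simp add: Z.cinner_diff_left fix_q[OF x])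
  qed
  obtain h y where hy: "r = (h, y)" "\<And>j. h j \<in> carrier H" "y \<in> carrier Y"
    using r by (auto simp: Z_def)
  have "h j = 0" for j
  proof (rule R.eq_zeroI[OF hy(2)])
    fix x :: "('d, 'y) nc_series" assume x: "x \<in> carrier (H2 Y)"
    have P0: "P 0 = 0" using P_scaleC[OF G.zero_closed, of 0] by simp
    have "cinner Z r (q (left_shift j x))
        = (\<Sum>i\<in>UNIV. if i = j then cinner H (h i) (P x) else 0)"
      using hy by (simp add: Z_def q_def P0 if_distrib[of P] if_distrib[of "cinner H _"]
          cong: if_cong sum.cong)
    then show "cinner H (h j) (P x) = 0" using orth[OF left_shift_H2[OF hY x]] by simp
  qed
  moreover have "y = 0"
  proof -
    have P0: "P 0 = 0" using P_scaleC[OF G.zero_closed, of 0] by simp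
    have "cinner Z r (q (monomial [] y)) = cinner Y y y"
      using hy by (simp add: Z_def q_def P0)
    then show ?thesis
      using orth[OF monomial_H2[OF hY hy(3)]] Y.cinner_pos[OF hy(3)] by force
  qed
  ultimately have "r = 0" by (simp add: hy(1) prod_eq_iff fun_eq_iff)
  then show "block_op W (hadj (hsum H U) (hsum (hpow H) Y) (block_op W) p) = p"
    by (simp add: r_def X_def Z_def)
qed

end

end

section \<open>Formal reproducing kernel spaces\<close>

text \<open>The vectors \<open>E\<close> on which the two inner products agree form a subspace containing all kernel
  functions. For \<open>f\<close> in the first space the functional \<open>e \<mapsto> \<langle>e, f\<rangle>\<close> on \<open>E\<close> has a Riesz representative in
  the second; testing on kernel functions shows that it has the coefficients of \<open>f\<close>.\<close>

lemma formal_RKHS_subset: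
  fixes K1 K2 :: "('d, 'y::complex_vector) nc_series hilbert"
  assumes Y: "hilbert_space Y" and K1: "formal_RKHS Y F K1" and K2: "formal_RKHS Y F K2"
    and f: "f \<in> carrier K1"
  shows "f \<in> carrier K2 \<and> hnorm K2 f \<le> hnorm K1 f"
proof -
  interpret Y: hilbert_space Y by (rule Y)
  interpret K1: hilbert_space K1 using K1 by (simp add: formal_RKHS_def)
  interpret K2: hilbert_space K2 using K2 by (simp add: formal_RKHS_def)
  define k where "k \<beta> y = (\<lambda>\<alpha>. F \<alpha> (rev \<beta>) y)" for \<beta> y
  define E where "E = {e \<in> carrier K1 \<inter> carrier K2.
    \<forall>g \<in> carrier K1 \<inter> carrier K2. cinner K1 g e = cinner K2 g e}"
  have kE: "k \<beta> y \<in> E" if "y \<in> carrier Y" for \<beta> y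
    using that K1 K2 unfolding E_def k_def formal_RKHS_def by fastforce
  have E12: "e \<in> carrier K1" "e \<in> carrier K2" if "e \<in> E" for e using that by (simp_all add: E_def)
  have norm_E: "hnorm K1 e = hnorm K2 e" if "e \<in> E" for e
    using that unfolding hnorm_def E_def by auto
  obtain a where a: "a \<in> carrier K2" "\<And>e. e \<in> E \<Longrightarrow> cinner K1 e f = cinner K2 e a"
    "hnorm K2 a \<le> hnorm K1 f"
  proof (rule K2.riesz_subspace[of E "\<lambda>e. cinner K1 e f" "hnorm K1 f"])
    show "E \<subseteq> carrier K2" using E12 by blast
    show "0 \<in> E" by (simp add: E_def K1.closed K2.closed)
    show "x + y \<in> E" if "x \<in> E" "y \<in> E" for x y
      using that by (simp add: E_def K1.closed K2.closed K1.cinner_add_right K2.cinner_add_right)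
    show "b *\<^sub>C x \<in> E" if "x \<in> E" for b x
      using that by (simp add: E_def K1.closed K2.closed K1.cinner_scaleC_right K2.cinner_scaleC_right)
    show "cmod (cinner K1 x f) \<le> hnorm K1 f * hnorm K2 x" if "x \<in> E" for x
      using K1.cauchy_schwarz[OF E12(1)[OF that] f] norm_E[OF that] by (simp add: mult.commute)
  qed (use f E12 in \<open>auto simp: K1.cinner_add_left K1.cinner_scaleC_left K1.hnorm_nonneg\<close>)
  have "f = a"
  proof
    fix \<beta>
    have fY: "f \<beta> \<in> carrier Y" "a \<beta> \<in> carrier Y"
      using f a(1) K1 K2 by (simp_all add: formal_RKHS_def)
    show "f \<beta> = a \<beta>"
    proof (rule Y.cinner_ext[OF fY])
      fix y assume y: "y \<in> carrier Y"
      have "cinner K1 f (k \<beta> y) = cinner Y (f \<beta>) y" "cinner K2 a (k \<beta> y) = cinner Y (a \<beta>) y"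
        using K1 K2 f a(1) y by (simp_all add: formal_RKHS_def k_def)
      then show "cinner Y y (f \<beta>) = cinner Y y (a \<beta>)"
        using a(2)[OF kE[OF y]] K1.cinner_commute[OF E12(1)[OF kE[OF y]] f, of \<beta>]
          K2.cinner_commute[OF E12(2)[OF kE[OF y]] a(1), of \<beta>]
          Y.cinner_commute[OF y fY(1)] Y.cinner_commute[OF y fY(2)] by simp
    qed
  qed
  then show ?thesis using a by simp
qed

lemma (in hilbert_space) polarization:
  assumes x: "x \<in> carrier H" and y: "y \<in> carrier H"
  shows "cinner H x y = (of_real ((hnorm H (x + y))\<^sup>2 - (hnorm H x)\<^sup>2 - (hnorm H y)\<^sup>2)
    + \<i> * of_real ((hnorm H (x + \<i> *\<^sub>C y))\<^sup>2 - (hnorm H x)\<^sup>2 - (hnorm H y)\<^sup>2)) / 2"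
  using x y by (simp add: hnorm_add_sq closed cinner_scaleC_right hnorm_scaleC complex_eq_iff)

lemma formal_RKHS_unique:
  fixes K1 K2 :: "('d, 'y::complex_vector) nc_series hilbert"
  assumes Y: "hilbert_space Y" and K1: "formal_RKHS Y F K1" and K2: "formal_RKHS Y F K2"
  shows "K1 = K2"
proof -
  interpret K1: hilbert_space K1 using K1 by (simp add: formal_RKHS_def)
  interpret K2: hilbert_space K2 using K2 by (simp add: formal_RKHS_def)
  note s12 = formal_RKHS_subset[OF Y K1 K2] and s21 = formal_RKHS_subset[OF Y K2 K1]
  have c: "carrier K1 = carrier K2" using s12 s21 by blast
  have n: "hnorm K1 f = hnorm K2 f" if "f \<in> carrier K2" for f
    using s12[of f] s21[of f] that c by force
  have "cinner K1 f g = cinner K2 f g" for f g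
  proof (cases "f \<in> carrier K2 \<and> g \<in> carrier K2")
    case True
    then have f2: "f \<in> carrier K2" and g2: "g \<in> carrier K2" by auto
    then have f1: "f \<in> carrier K1" and g1: "g \<in> carrier K1" using c by auto
    show ?thesis
      unfolding K1.polarization[OF f1 g1] K2.polarization[OF f2 g2]
      by (simp add: n K2.closed f2 g2)
  next
    case False
    then show ?thesis using K1 K2 c unfolding formal_RKHS_def by metis
  qed
  then have "cinner K1 = cinner K2" by blast
  then show ?thesis using c by (intro hilbert.equality) auto
qed

lemma RKHS_eqI: "\<lbrakk>hilbert_space Y; formal_RKHS Y F H\<rbrakk> \<Longrightarrow> RKHS Y F = H"
  unfolding RKHS_def by (blast intro: formal_RKHS_unique)

text \<open>This undoes the reflection in the definition of \<open>dBR_space\<close>.\<close>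

lemma reflected_reflected [simp]: "reflected_space (reflected_space H) = H"
  by (simp add: reflected_space_def image_image)

lemma hilbert_space_reflected:
  fixes H :: "('d, 'y::complex_vector) nc_series hilbert"
  assumes "hilbert_space H"
  shows "hilbert_space (reflected_space H)"
  by (rule hilbert_space_isometric_image[OF assms, of _ reflect]) (simp_all add: reflected_space_def)

section \<open>The de Branges--Rovnyak kernel\<close>

lemma sum_splits_left_Nil:
  "(\<Sum>(a, b) | a @ b = w. if a = [] then g b else 0) = (g w :: 'c::comm_monoid_add)"
proof (induction w arbitrary: g rule: rev_induct)
  case Nil
  then show ?case by (simp add: sum_splits_Nil[of "\<lambda>a b. if a = [] then g b else 0"] del: append_is_Nil_conv)
next
  case (snoc j w)
  show ?case
    by (simp add: sum_splits_snoc[of "\<lambda>a b. if a = [] then g b else 0"] snoc[of "\<lambda>b. g (b @ [j])"])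
qed

lemma sum_splits_right_Nil:
  "(\<Sum>(a, b) | a @ b = w. if b = [] then g a else 0) = (g w :: 'c::comm_monoid_add)"
proof (cases w rule: rev_cases)
  case Nil
  then show ?thesis by (simp add: sum_splits_Nil[of "\<lambda>a b. if b = [] then g a else 0"] del: append_is_Nil_conv)
next
  case (snoc w' j)
  then show ?thesis
    by (simp add: sum_splits_snoc[of "\<lambda>a b. if b = [] then g a else 0"])
qed

lemma sum_splits_rev:
  "(\<Sum>(a, b) | a @ b = rev w. g a b) = (\<Sum>(a, b) | a @ b = w. g (rev b) (rev a) :: 'c::comm_monoid_add)"
  by (rule sum.reindex_bij_witness[where i = "\<lambda>(a, b). (rev b, rev a)" and j = "\<lambda>(a, b). (rev b, rev a)"])
    (auto simp flip: rev_append)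

context schur_function
begin

text \<open>The coefficients of \<open>M\<^sub>S\<^sup>*\<close> applied to the monomial \<open>y z\<^sup>\<beta>\<close>: at \<open>v\<close> there is
  \<open>s\<^sub>a\<^sup>* y\<close> if \<open>\<beta> = a v\<close>, and 0 if \<open>v\<close> is no suffix of \<open>\<beta>\<close>.\<close>

definition adj_coeff :: "'d list \<Rightarrow> 'y \<Rightarrow> 'd list \<Rightarrow> 'u" where
  "adj_coeff \<beta> y v = (\<Sum>(a, b) | a @ b = \<beta>. if b = v then hadj U Y (S a) y else 0)"

lemma S_sum:
  "(\<And>i. i \<in> F \<Longrightarrow> f i \<in> carrier U) \<Longrightarrow> S \<alpha> (sum f F) = (\<Sum>i\<in>F. S \<alpha> (f i))"
  by (rule bounded_op_sum[OF S_bounded hU])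

lemma adj_S_closed: "y \<in> carrier Y \<Longrightarrow> hadj U Y (S a) y \<in> carrier U"
  by (rule hadj_closed[OF hU hY S_bounded])

lemma adj_coeff_Nil: "adj_coeff \<beta> y [] = hadj U Y (S \<beta>) y"
  unfolding adj_coeff_def by (rule sum_splits_right_Nil)

lemma adj_coeff_Nil_snoc: "adj_coeff [] y (v @ [i]) = 0"
  unfolding adj_coeff_def by (simp add: sum_splits_Nil[of "\<lambda>a b. if b = v @ [i] then hadj U Y (S a) y else 0"] del: append_is_Nil_conv)

lemma adj_coeff_snoc_snoc:
  "adj_coeff (\<beta> @ [j]) y (v @ [i]) = (if i = j then adj_coeff \<beta> y v else 0)"
proof -
  have "adj_coeff (\<beta> @ [j]) y (v @ [i])
      = (\<Sum>(a, b) | a @ b = \<beta>. if b @ [j] = v @ [i] then hadj U Y (S a) y else 0)"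
    unfolding adj_coeff_def
    by (simp only: sum_splits_snoc[of "\<lambda>a b. if b = v @ [i] then hadj U Y (S a) y else 0"]) simp
  then show ?thesis by (auto simp: adj_coeff_def split_def)
qed

lemma adj_coeff_closed: "y \<in> carrier Y \<Longrightarrow> adj_coeff \<beta> y v \<in> carrier U"
  unfolding adj_coeff_def by (intro U.sum_closed) (auto simp: adj_S_closed U.closed)

text \<open>Multiplying out the formal kernel: the Szego factor forces equal suffixes of \<open>\<alpha>\<close> and \<open>\<beta>\<close>, and
  the remaining prefixes carry the coefficients of \<open>S\<close> and of its adjoint.\<close>

lemma dBR_kernel_eq:
  assumes y: "y \<in> carrier Y"
  shows "dBR_kernel U Y S \<alpha> (rev \<beta>) y
    = monomial \<beta> y \<alpha> - (\<Sum>(a, v) | a @ v = \<alpha>. S a (adj_coeff \<beta> y v))"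
proof -
  have inner: "bimult (series_z S) szego_op \<alpha> \<gamma> x
      = (\<Sum>(a, v) | a @ v = \<alpha>. S a (if \<gamma> = rev v then x else 0))" for \<alpha> \<gamma> x
  proof -
    have "(\<Sum>(b1, b2) | b1 @ b2 = \<gamma>. series_z S a b1 (szego_op v b2 x))
        = S a (if \<gamma> = rev v then x else 0)" for a v
    proof -
      have "(\<Sum>(b1, b2) | b1 @ b2 = \<gamma>. series_z S a b1 (szego_op v b2 x))
          = (\<Sum>(b1, b2) | b1 @ b2 = \<gamma>. if b1 = [] then S a (szego_op v b2 x) else 0)"
        by (simp add: series_z_def)
      also have "\<dots> = S a (szego_op v \<gamma> x)"
        by (rule sum_splits_left_Nil[of "\<lambda>b. S a (szego_op v b x)"])
      also have "szego_op v \<gamma> x = (if \<gamma> = rev v then x else 0)"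
        by (simp add: szego_op_def szego_def scaleC_one)
      finally show ?thesis .
    qed
    then show ?thesis by (simp add: bimult_def)
  qed
  let ?F = "bimult (series_z S) szego_op"
  have F0: "?F \<alpha>' \<gamma> 0 = 0" for \<alpha>' \<gamma> by (simp add: inner sum.neutral split_def)
  have "bimult ?F (series_w_adj U Y S) \<alpha> (rev \<beta>) y
      = (\<Sum>(a1, a2) | a1 @ a2 = \<alpha>. if a2 = [] then
          (\<Sum>(b1, b2) | b1 @ b2 = rev \<beta>. ?F a1 b1 (hadj U Y (S (rev b2)) y)) else 0)"
    unfolding bimult_def[of ?F]
    by (intro sum.cong refl) (auto simp: series_w_adj_def F0 sum.neutral split_def)
  also have "\<dots> = (\<Sum>(b1, b2) | b1 @ b2 = rev \<beta>. ?F \<alpha> b1 (hadj U Y (S (rev b2)) y))"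
    by (rule sum_splits_right_Nil[of "\<lambda>a1. \<Sum>(b1, b2) | b1 @ b2 = rev \<beta>. ?F a1 b1 (hadj U Y (S (rev b2)) y)"])
  also have "\<dots> = (\<Sum>(b, v') | b @ v' = \<beta>. \<Sum>(a, v) | a @ v = \<alpha>.
      S a (if v' = v then hadj U Y (S b) y else 0))"
    by (subst sum_splits_rev) (simp add: inner)
  also have "\<dots> = (\<Sum>(a, v) | a @ v = \<alpha>. \<Sum>(b, v') | b @ v' = \<beta>.
      S a (if v' = v then hadj U Y (S b) y else 0))"
    unfolding split_def by (rule sum.swap)
  also have "\<dots> = (\<Sum>(a, v) | a @ v = \<alpha>. S a (adj_coeff \<beta> y v))"
    unfolding adj_coeff_def split_def
    by (subst S_sum) (auto simp: adj_S_closed y U.closed)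
  finally show ?thesis
    by (simp add: dBR_kernel_def szego_op_def szego_def monomial_def scaleC_one)
qed

lemma N_monomial:
  assumes y: "y \<in> carrier Y"
  shows "N (monomial (rev \<beta>) y) (rev v) = adj_coeff \<beta> y v"
proof (rule U.cinner_ext)
  have x: "monomial (rev \<beta>) y \<in> carrier (H2 Y)" by (rule monomial_H2[OF hY y])
  show "N (monomial (rev \<beta>) y) (rev v) \<in> carrier U" by (rule H2_component[OF hU N_closed[OF x]])
  show "adj_coeff \<beta> y v \<in> carrier U" by (rule adj_coeff_closed[OF y])
  fix u assume u: "u \<in> carrier U"
  have c: "monomial (rev v) u \<in> carrier (H2 U)" by (rule monomial_H2[OF hU u])
  have "cinner U u (N (monomial (rev \<beta>) y) (rev v)) = cinner Y (M (monomial (rev v) u) (rev \<beta>)) y"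
    using cinner_monomial_left[OF hU N_closed[OF x] u, of "rev v"] cinner_N(1)[OF c x]
      cinner_monomial[OF hY M_closed[OF c] y] by simp
  also have "M (monomial (rev v) u) (rev \<beta>) = (\<Sum>(a, b) | a @ b = \<beta>. S a (if b = v then u else 0))"
    by (simp add: M_def reflect_def series_apply_def monomial_def)
  also have "cinner Y \<dots> y = (\<Sum>(a, b) | a @ b = \<beta>. cinner Y (S a (if b = v then u else 0)) y)"
    unfolding split_def using u y
    by (subst Y.cinner_sum_left) (auto simp: bounded_op_closed[OF S_bounded] Y.closed)
  also have "\<dots> = (\<Sum>(a, b) | a @ b = \<beta>. cinner U u (if b = v then hadj U Y (S a) y else 0))"
    using u y cinner_hadj_right[OF hU hY S_bounded u y]
    by (intro sum.cong refl) (auto simp: split_def)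
  also have "\<dots> = cinner U u (adj_coeff \<beta> y v)"
    unfolding adj_coeff_def split_def using u y
    by (subst U.cinner_sum_right) (auto simp: adj_S_closed U.closed)
  finally show "cinner U u (N (monomial (rev \<beta>) y) (rev v)) = cinner U u (adj_coeff \<beta> y v)" .
qed

text \<open>The kernel functions are \<open>(I - M\<^sub>S M\<^sub>S\<^sup>*)\<close> applied to monomials; in terms of \<open>P\<close> both sides are
  reflected, which turns \<open>\<beta>\<close> into \<open>rev \<beta>\<close>.\<close>

lemma dBR_kernel_P:
  assumes y: "y \<in> carrier Y"
  shows "(\<lambda>\<alpha>. dBR_kernel U Y S \<alpha> (rev \<beta>) y) = reflect (P (monomial (rev \<beta>) y))"
proof
  fix \<alpha>
  have "monomial (rev \<beta>) y (rev \<alpha>) = monomial \<beta> y \<alpha>" by (simp add: monomial_def)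
  then show "dBR_kernel U Y S \<alpha> (rev \<beta>) y = reflect (P (monomial (rev \<beta>) y)) \<alpha>"
    by (simp add: dBR_kernel_eq[OF y] P_def reflect_def M_def series_apply_def N_monomial[OF y])
qed

lemma dBR_space_eq:
  assumes "operator_range (H2 Y) P H"
  shows "dBR_space U Y S = H"
proof -
  interpret R: operator_range "H2 Y" P H by (rule assms)
  have "formal_RKHS Y (dBR_kernel U Y S) (reflected_space H)"
    unfolding formal_RKHS_def
  proof (intro conjI ballI allI impI)
    show "hilbert_space (reflected_space H)"
      by (rule hilbert_space_reflected[OF R.H.hilbert_space_axioms])
    fix f v assume "f \<in> carrier (reflected_space H)"
    then obtain g where g: "g \<in> carrier H" "f = reflect g" by (auto simp: reflected_space_def)
    then show "f v \<in> carrier Y"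
      using R.sub H2_component[OF hY, of g "rev v"] by (auto simp: reflect_def)
  next
    fix \<beta> :: "'d list" and y assume y: "y \<in> carrier Y"
    have m: "monomial (rev \<beta>) y \<in> carrier (H2 Y)" by (rule monomial_H2[OF hY y])
    show "(\<lambda>\<alpha>. dBR_kernel U Y S \<alpha> (rev \<beta>) y) \<in> carrier (reflected_space H)"
      unfolding dBR_kernel_P[OF y] using R.P_mem[OF m] by (simp add: reflected_space_def)
    fix f assume "f \<in> carrier (reflected_space H)"
    then obtain g where g: "g \<in> carrier H" "f = reflect g" by (auto simp: reflected_space_def)
    then have "cinner H g (P (monomial (rev \<beta>) y)) = cinner Y (g (rev \<beta>)) y"
      using R.reproducing[OF g(1) m] R.sub cinner_monomial[OF hY _ y, of g "rev \<beta>"] by auto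
    then show "cinner (reflected_space H) f (\<lambda>\<alpha>. dBR_kernel U Y S \<alpha> (rev \<beta>) y) = cinner Y (f \<beta>) y"
      unfolding dBR_kernel_P[OF y] g(2) by (simp add: reflected_space_def) (simp add: reflect_def)
  next
    fix f g assume "f \<notin> carrier (reflected_space H) \<or> g \<notin> carrier (reflected_space H)"
    then have "reflect f \<notin> carrier H \<or> reflect g \<notin> carrier H"
      by (auto simp: reflected_space_def image_iff)
    then show "cinner (reflected_space H) f g = 0"
      using R.cinner_off by (simp add: reflected_space_def)
  qed
  then show ?thesis
    unfolding dBR_space_def by (simp add: RKHS_eqI[OF hY])
qed

section \<open>Observable coisometric realizations\<close>

context
  fixes X :: "'x::complex_vector hilbert" and V :: "('d, 'x, 'u, 'y) colligation"
  assumes X: "hilbert_space X" and V: "is_colligation X U Y V" and obs: "observable X V"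
    and coiso: "coisometric X U Y V" and real: "is_realization U S V"
begin

interpretation X: hilbert_space X by (rule X)

lemma V_bounded:
  "bounded_op X X (opA V j)" "bounded_op U X (opB V j)" "bounded_op X Y (opC V)" "bounded_op U Y (opD V)"
  using V by (simp_all add: is_colligation_def)

definition obs_coeff :: "'d list \<Rightarrow> 'x \<Rightarrow> 'y" where
  "obs_coeff v x = opC V (word_op (opA V) v x)"

lemma obs_coeff_bounded: "bounded_op X Y (obs_coeff v)"
  unfolding obs_coeff_def
  by (rule bounded_op_compose[OF word_op_bounded[OF X V_bounded(1)] V_bounded(3) X X])

lemma obs_coeff_A: "obs_coeff v (opA V j x) = obs_coeff (v @ [j]) x"
  by (simp add: obs_coeff_def word_op_snoc)

lemma obs_coeff_B: "u \<in> carrier U \<Longrightarrow> obs_coeff v (opB V j u) = S (v @ [j]) u"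
  using real unfolding is_realization_def obs_coeff_def by (metis transfer_function_snoc)

lemma opD_V: "u \<in> carrier U \<Longrightarrow> opD V u = S [] u"
  using real unfolding is_realization_def by (metis transfer_function_Nil)

text \<open>The vectors representing, through the inner product of the state space, the coefficients of the
  observability map; they become the kernel functions.\<close>

definition adj_obs :: "'d list \<Rightarrow> 'y \<Rightarrow> 'x" where
  "adj_obs v = hadj X Y (obs_coeff v)"

lemma adj_obs_closed: "y \<in> carrier Y \<Longrightarrow> adj_obs v y \<in> carrier X"
  unfolding adj_obs_def by (rule hadj_closed[OF X hY obs_coeff_bounded])

lemma cinner_adj_obs:
  "\<lbrakk>x \<in> carrier X; y \<in> carrier Y\<rbrakk> \<Longrightarrow> cinner X x (adj_obs v y) = cinner Y (obs_coeff v x) y"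
  unfolding adj_obs_def by (rule cinner_hadj_right[OF X hY obs_coeff_bounded])

text \<open>The adjoint of the block operator maps \<open>adj_obs \<beta>' y\<close> in position \<open>j\<close> to
  \<open>(adj_obs \<beta> y, s\<^sub>\<beta>\<^sup>* y)\<close> for \<open>\<beta> = \<beta>' j\<close>, and \<open>y\<close> in the output component to the same pair for the empty word.
  Coisometry means that the block operator maps this pair back.\<close>

lemma coisometric_recursion:
  assumes y: "y \<in> carrier Y"
  shows "opA V i (adj_obs \<beta> y) + opB V i (hadj U Y (S \<beta>) y)
      = (if \<beta> \<noteq> [] \<and> last \<beta> = i then adj_obs (butlast \<beta>) y else 0)" (is ?A)
    and "opC V (adj_obs \<beta> y) + S [] (hadj U Y (S \<beta>) y) = (if \<beta> = [] then y else 0)" (is ?C)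
proof -
  define p where "p = ((\<lambda>i. if \<beta> \<noteq> [] \<and> last \<beta> = i then adj_obs (butlast \<beta>) y else 0),
    if \<beta> = [] then y else 0)"
  have p: "p \<in> carrier (hsum (hpow X) Y)"
    using y by (simp add: p_def adj_obs_closed X.closed Y.closed)
  have "hadj (hsum X U) (hsum (hpow X) Y) (block_op V) p = (adj_obs \<beta> y, hadj U Y (S \<beta>) y)"
  proof (rule hadj_eqI[OF hilbert_space_hsum[OF X hU]])
    show "(adj_obs \<beta> y, hadj U Y (S \<beta>) y) \<in> carrier (hsum X U)"
      using y by (simp add: adj_obs_closed adj_S_closed)
    fix q assume "q \<in> carrier (hsum X U)"
    then obtain x u where q: "q = (x, u)" "x \<in> carrier X" "u \<in> carrier U" by auto
    note c = bounded_op_closed[OF V_bounded(1) q(2)] bounded_op_closed[OF V_bounded(2) q(3)]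
      bounded_op_closed[OF V_bounded(3) q(2)] bounded_op_closed[OF V_bounded(4) q(3)]
    have "cinner (hsum (hpow X) Y) (block_op V q) p = cinner Y (obs_coeff \<beta> x + S \<beta> u) y"
    proof (cases \<beta> rule: rev_cases)
      case Nil
      then show ?thesis
        using y q c by (simp add: p_def obs_coeff_def opD_V X.closed)
    next
      case (snoc \<beta>' j)
      have p_snoc: "p = (\<lambda>i. if i = j then adj_obs \<beta>' y else 0, 0)"
        by (auto simp: p_def snoc)
      have "cinner X (opA V i x + opB V i u) (if i = j then adj_obs \<beta>' y else 0)
          = (if i = j then cinner X (opA V j x + opB V j u) (adj_obs \<beta>' y) else 0)" for i
        using c by (simp add: X.closed)
      then have "cinner (hsum (hpow X) Y) (block_op V q) p
          = cinner X (opA V j x + opB V j u) (adj_obs \<beta>' y)"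
        unfolding p_snoc q(1) using c by (simp add: Y.closed)
      also have "\<dots> = cinner Y (obs_coeff \<beta>' (opA V j x + opB V j u)) y"
        using y c by (simp add: cinner_adj_obs X.closed)
      also have "\<dots> = cinner Y (obs_coeff \<beta> x + S \<beta> u) y"
        using y q c by (simp add: bounded_op_add[OF obs_coeff_bounded] obs_coeff_A obs_coeff_B snoc)
      finally show ?thesis .
    qed
    also have "\<dots> = cinner (hsum X U) q (adj_obs \<beta> y, hadj U Y (S \<beta>) y)"
      using y q bounded_op_closed[OF obs_coeff_bounded q(2)] bounded_op_closed[OF S_bounded q(3)]
      by (simp add: Y.cinner_add_left cinner_adj_obs cinner_hadj_right[OF hU hY S_bounded])
    finally show "cinner (hsum (hpow X) Y) (block_op V q) p
        = cinner (hsum X U) q (adj_obs \<beta> y, hadj U Y (S \<beta>) y)" .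
  qed
  then have "block_op V (adj_obs \<beta> y, hadj U Y (S \<beta>) y) = p"
    using coiso p unfolding coisometric_def by metis
  then show ?A ?C
    using y by (auto simp: p_def fun_eq_iff opD_V adj_S_closed)
qed

text \<open>Peeling the last letters off \<open>\<alpha>\<close> and \<open>\<beta>\<close> with \<open>coisometric_recursion\<close> produces one product
  \<open>s\<^sub>\<alpha> s\<^sub>\<beta>\<^sup>*\<close> at each stage and stops when the letters differ or a word is exhausted; the kernel obeys
  the same recursion.\<close>

lemma obs_coeff_adj_obs:
  assumes y: "y \<in> carrier Y"
  shows "obs_coeff \<alpha> (adj_obs \<beta> y) = dBR_kernel U Y S \<alpha> (rev \<beta>) y"
  unfolding dBR_kernel_eq[OF y]
proof (induction \<alpha> arbitrary: \<beta> rule: rev_induct)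
  case Nil
  have "obs_coeff [] (adj_obs \<beta> y) = (if \<beta> = [] then y else 0) - S [] (hadj U Y (S \<beta>) y)"
    using coisometric_recursion(2)[OF y, of \<beta>] by (simp add: obs_coeff_def eq_diff_eq)
  then show ?case
    by (simp add: sum_splits_Nil[of "\<lambda>a v. S a (adj_coeff \<beta> y v)"] adj_coeff_Nil monomial_def
        del: append_is_Nil_conv)
next
  case (snoc i \<alpha>)
  note IH = snoc.IH
  let ?s = "hadj U Y (S \<beta>) y"
  have s: "?s \<in> carrier U" by (rule adj_S_closed[OF y])
  note c = bounded_op_closed[OF V_bounded(2) s]
  let ?r = "if \<beta> \<noteq> [] \<and> last \<beta> = i then adj_obs (butlast \<beta>) y else 0"
  have r: "?r \<in> carrier X" using y by (simp add: adj_obs_closed X.closed)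
  have "opA V i (adj_obs \<beta> y) = ?r - opB V i ?s"
    using coisometric_recursion(1)[OF y, of i \<beta>] by (simp add: eq_diff_eq)
  then have "obs_coeff (\<alpha> @ [i]) (adj_obs \<beta> y) = obs_coeff \<alpha> ?r - S (\<alpha> @ [i]) ?s"
    using bounded_op_diff[OF obs_coeff_bounded X r c] obs_coeff_B[OF s]
    by (simp flip: obs_coeff_A)
  moreover have "obs_coeff \<alpha> ?r = monomial \<beta> y (\<alpha> @ [i])
      - (\<Sum>(a, v) | a @ v = \<alpha>. S a (adj_coeff \<beta> y (v @ [i])))"
  proof (cases \<beta> rule: rev_cases)
    case Nil
    then show ?thesis
      using bounded_op_zero[OF obs_coeff_bounded X]
      by (simp add: adj_coeff_Nil_snoc monomial_def split_def)
  next
    case (snoc \<beta>' j)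
    have "monomial (\<beta>' @ [j]) y (\<alpha> @ [i]) = (if i = j then monomial \<beta>' y \<alpha> else 0)"
      by (simp add: monomial_def)
    then show ?thesis
      unfolding snoc using bounded_op_zero[OF obs_coeff_bounded X] IH[of \<beta>']
      by (cases "i = j") (auto simp add: adj_coeff_snoc_snoc split_def)
  qed
  ultimately show ?case
    by (simp add: sum_splits_snoc[of "\<lambda>a v. S a (adj_coeff \<beta> y v)"] adj_coeff_Nil)
qed

definition obs_map :: "'x \<Rightarrow> ('d, 'y) nc_series" where
  "obs_map x = (\<lambda>v. obs_coeff v x)"

lemma inj_obs_map: "inj_on obs_map (carrier X)"
proof -
  have "obs_map = (\<lambda>x v. opC V (word_op (opA V) v x))"
    by (simp add: fun_eq_iff obs_map_def obs_coeff_def)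
  then show ?thesis using obs by (simp add: observable_def)
qed

lemma obs_map_linear:
  "\<lbrakk>x \<in> carrier X; x' \<in> carrier X\<rbrakk> \<Longrightarrow> obs_map (x + x') = obs_map x + obs_map x'"
  "x \<in> carrier X \<Longrightarrow> obs_map (a *\<^sub>C x) = a *\<^sub>C obs_map x"
  by (simp_all add: obs_map_def fun_eq_iff bounded_op_add[OF obs_coeff_bounded]
      bounded_op_scaleC[OF obs_coeff_bounded])

lemma formal_RKHS_obs_map: "formal_RKHS Y (dBR_kernel U Y S) (transported_space X obs_map)"
  unfolding formal_RKHS_def carrier_transported
proof (intro conjI ballI allI impI)
  show "hilbert_space (transported_space X obs_map)"
    by (rule hilbert_space_transported[OF X inj_obs_map obs_map_linear])
  show "f v \<in> carrier Y" if "f \<in> obs_map ` carrier X" for f v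
    using that bounded_op_closed[OF obs_coeff_bounded] by (auto simp: obs_map_def)
  show "cinner (transported_space X obs_map) f g = 0"
    if "f \<notin> obs_map ` carrier X \<or> g \<notin> obs_map ` carrier X" for f g
    using that by (rule cinner_transported_off)
  fix \<beta> y assume y: "y \<in> carrier Y"
  have k: "(\<lambda>\<alpha>. dBR_kernel U Y S \<alpha> (rev \<beta>) y) = obs_map (adj_obs \<beta> y)"
    by (simp add: obs_map_def obs_coeff_adj_obs[OF y])
  show "(\<lambda>\<alpha>. dBR_kernel U Y S \<alpha> (rev \<beta>) y) \<in> obs_map ` carrier X"
    unfolding k using adj_obs_closed[OF y] by blast
  fix f assume "f \<in> obs_map ` carrier X"
  then obtain x where x: "x \<in> carrier X" "f = obs_map x" by blast
  show "cinner (transported_space X obs_map) f (\<lambda>\<alpha>. dBR_kernel U Y S \<alpha> (rev \<beta>) y) = cinner Y (f \<beta>) y"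
    unfolding k x(2) cinner_transported[OF inj_obs_map x(1) adj_obs_closed[OF y]]
    using cinner_adj_obs[OF x(1) y] by (simp add: obs_map_def)
qed

lemma unitarily_equivalent_dBR: "unitarily_equivalent U X V (dBR_space U Y S) W"
  unfolding unitarily_equivalent_def
proof (intro exI conjI ballI)
  define T where "T x = reflect (obs_map x)" for x
  have eq: "dBR_space U Y S = reflected_space (transported_space X obs_map)"
    by (simp add: dBR_space_def RKHS_eqI[OF hY formal_RKHS_obs_map])
  have T_cinner: "cinner (dBR_space U Y S) (T x) (T x') = cinner X x x'"
    if "x \<in> carrier X" "x' \<in> carrier X" for x x'
    unfolding eq using cinner_transported[OF inj_obs_map that] by (simp add: reflected_space_def T_def)
  have T_image: "T ` carrier X = carrier (dBR_space U Y S)"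
    unfolding eq by (simp add: reflected_space_def T_def image_image)
  have "bounded_op X (dBR_space U Y S) T"
  proof (rule bounded_opI[where M = 1])
    show "T x \<in> carrier (dBR_space U Y S)" if "x \<in> carrier X" for x
      unfolding T_image[symmetric] using that by blast
    show "hnorm (dBR_space U Y S) (T x) \<le> 1 * hnorm X x" if "x \<in> carrier X" for x
      using that by (simp add: hnorm_def T_cinner)
  qed (simp_all add: T_def obs_map_linear)
  then show "unitary_op X (dBR_space U Y S) (\<lambda>x. reflect (obs_map x))"
    using T_image T_cinner unfolding unitary_op_def T_def by simp
  fix x u assume x: "x \<in> carrier X" and u: "u \<in> carrier U"
  \<comment> \<open>The concrete form of the space supplies that it lies in the Fock space, where the shift adjoints are known.\<close>
  obtain H where H: "operator_range (H2 Y) P H" using operator_range_exists by blast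
  have TG: "T x \<in> carrier (H2 Y)"
    using T_image x operator_range.sub[OF H] by (auto simp: dBR_space_eq[OF H])
  note c = bounded_op_closed[OF V_bounded(1) x] bounded_op_closed[OF V_bounded(2) u]
  have "reflect (obs_map (opA V j x + opB V j u)) = opA W j (T x) + opB W j u" for j
    unfolding opA_dBR[OF TG] opB_dBR[OF u] obs_map_linear(1)[OF c]
    by (simp add: fun_eq_iff T_def reflect_def obs_map_def backward_shift_def obs_coeff_A
        obs_coeff_B[OF u] M_const)
  then show "map_prod (\<lambda>h j. reflect (obs_map (h j))) id (block_op V (x, u))
      = block_op W (reflect (obs_map x), u)"
    by (simp add: T_def opD_V[OF u]) (simp add: reflect_def obs_map_def obs_coeff_def)
qed

end

end

theorem theorem4p3:
  fixes U :: "'u::complex_vector hilbert"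
    and Y :: "'y::complex_vector hilbert"
    and S :: "('d::finite, 'u \<Rightarrow> 'y) nc_series"
  assumes "hilbert_space U" and "hilbert_space Y" and "schur_class U Y S"
  shows "hilbert_space (dBR_space U Y S) \<and>
    (\<forall>j. \<forall>u\<in>carrier U. opB (dBR_colligation U Y S) j u =
       hadj (H2 Y) (H2 Y) (left_shift j) (reflect (series_apply S (const_series u)))) \<and>
    is_colligation (dBR_space U Y S) U Y (dBR_colligation U Y S) \<and>
    observable (dBR_space U Y S) (dBR_colligation U Y S) \<and>
    coisometric (dBR_space U Y S) U Y (dBR_colligation U Y S) \<and>
    is_realization U S (dBR_colligation U Y S) \<and>
    (\<forall>(X :: 'x::complex_vector hilbert) W.
       hilbert_space X \<and> is_colligation X U Y W \<and> observable X W \<and> coisometric X U Y W \<and>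
       is_realization U S W \<longrightarrow>
       unitarily_equivalent U X W (dBR_space U Y S) (dBR_colligation U Y S))"
proof -
  interpret schur_function U Y S
    using assms by (intro schur_function.intro schur_function_axioms.intro)
  obtain H where H: "operator_range (H2 Y) P H" using operator_range_exists by blast
  interpret R: operator_range "H2 Y" P H by (rule H)
  show ?thesis
    unfolding dBR_space_eq[OF H]
    by (intro conjI allI impI ballI R.H.hilbert_space_axioms opB_dBR_left_shift
        is_colligation_dBR[OF H] observable_dBR[OF H] coisometric_dBR[OF H] is_realization_dBR[OF H]
        unitarily_equivalent_dBR[unfolded dBR_space_eq[OF H]]; blast)
qed

end
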